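(* Let $K$ be a field, let $\Delta$ be the cyclic quiver with $s\geq 1$ vertices and $s$ arrows, let $n\geq 2$, and let $A=K\Delta/R_\Delta^n$. Let $\alpha:A\times A\to D(A)$ be a $2$-cocycle. If $\Delta_{T_\alpha(A)}=\Delta$, then $T_\alpha(A)$ is isomorphic to $K\Delta/R_\Delta^{2n}$ and $T_\alpha(A)$ is a symmetric algebra.
   Context: All algebras are finite dimensional over the field $K$; $D=\mathrm{Hom}_K(-,K)$, and $D(A)$ is an $A$-bimodule via $(a\varphi b)(c)=\varphi(bca)$. $\Delta$ has vertices $1,\dots,s$ and arrows $x_i$ from $i$ to $i+1$, with indices modulo $s$; paths are written left to right, and $e_i$ is the trivial path at $i$. $R_\Delta$ is the arrow ideal of $K\Delta$, so $R_\Delta^m$ is the ideal generated by the paths of length $m$. A $2$-cocycle is a $K$-bilinear map $\alpha:A\times A\to D(A)$ with $a\,\alpha(b,c)-\alpha(ab,c)+\alpha(a,bc)-\alpha(a,b)\,c=0$ for all $a,b,c\in A$. The Hochschild extension algebra $T_\alpha(A)$ is the $K$-space $A\oplus D(A)$ with multiplication $(a,x)(b,y)=(ab,\ ay+xb+\alpha(a,b))$ and identity $(1,-\alpha(1,1))$. A complete set of primitive orthogonal idempotents $e_1,\dots,e_s$ of $A$ lifts along $T_\alpha(A)\to A$ to such a set $\mathbf e_1,\dots,\mathbf e_s$ in $T=T_\alpha(A)$. The ordinary quiver $\Delta_T$ has vertices $1,\dots,s$, and the number of arrows from $i$ to $j$ is $\dim_K \mathbf e_iJ(T)\mathbf e_j/\mathbf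 e_iJ^2(T)\mathbf e_j$, where $J$ is the Jacobson radical. Equality $\Delta_{T_\alpha(A)}=\Delta$ means that these numbers agree with the numbers of arrows of $\Delta$ for all $i,j$. An algebra $T$ is symmetric if $T\cong D(T)$ as $T$-bimodules. *)

theory Defs
  imports
    "HOL-Algebra.QuotRing"
    "HOL-Algebra.Ideal_Product"
    "Graph_Theory.Arc_Walk"
    "Jordan_Normal_Form.Missing_VectorSpace"
begin

text \<open>
  A K-algebra is represented by a record of type \<^typ>\<open>('k, 'a) module\<close>: its ring fields carry the
  (noncommutative, unital) multiplication and \<^const>\<open>smult\<close> carries the scalar action. Quivers are
  directed multigraphs \<^typ>\<open>('v, 'e) pre_digraph\<close>.
\<close>

section \<open>Path algebras\<close>

text \<open>
  A path is a pair of its start vertex and its list of arrows, read left to right; \<open>(v, [])\<close> is the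
  trivial path at \<open>v\<close>.
\<close>

definition quiver_paths :: "('v, 'e) pre_digraph \<Rightarrow> ('v \<times> 'e list) set" where
  "quiver_paths G = {(u, p). \<exists>v. pre_digraph.awalk G u p v}"

definition path_end :: "('v, 'e) pre_digraph \<Rightarrow> 'v \<times> 'e list \<Rightarrow> 'v" where
  "path_end G p = pre_digraph.awlast G (fst p) (snd p)"

definition path_factorizations ::
    "('v, 'e) pre_digraph \<Rightarrow> 'v \<times> 'e list \<Rightarrow> (('v \<times> 'e list) \<times> ('v \<times> 'e list)) set" where
  "path_factorizations G r =
     {(p, q). p \<in> quiver_paths G \<and> q \<in> quiver_paths G \<and> path_end G p = fst q \<and>
              (fst p, snd p @ snd q) = r}"

text \<open>
  Elements are the finitely supported families of coefficients indexed by paths. The unit, the sum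
  of the trivial paths, lies in the carrier only if the quiver has finitely many vertices.
\<close>

definition path_algebra ::
    "('k, 'm) ring_scheme \<Rightarrow> ('v, 'e) pre_digraph \<Rightarrow> ('k, 'v \<times> 'e list \<Rightarrow> 'k) module" where
  "path_algebra K G =
     \<lparr>carrier = {f. range f \<subseteq> carrier K \<and> finite {p. f p \<noteq> \<zero>\<^bsub>K\<^esub>} \<and>
                    {p. f p \<noteq> \<zero>\<^bsub>K\<^esub>} \<subseteq> quiver_paths G},
      monoid.mult = (\<lambda>f g r. finsum K (\<lambda>(p, q). f p \<otimes>\<^bsub>K\<^esub> g q) (path_factorizations G r)),
      one = (\<lambda>(u, p). if u \<in> verts G \<and> p = [] then \<one>\<^bsub>K\<^esub> else \<zero>\<^bsub>K\<^esub>),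
      ring.zero = (\<lambda>p. \<zero>\<^bsub>K\<^esub>),
      add = (\<lambda>f g p. f p \<oplus>\<^bsub>K\<^esub> g p),
      smult = (\<lambda>c f p. c \<otimes>\<^bsub>K\<^esub> f p)\<rparr>"

definition path_elem :: "('k, 'm) ring_scheme \<Rightarrow> 'v \<times> 'e list \<Rightarrow> ('v \<times> 'e list \<Rightarrow> 'k)" where
  "path_elem K p = (\<lambda>q. if q = p then \<one>\<^bsub>K\<^esub> else \<zero>\<^bsub>K\<^esub>)"

definition arrow_ideal_power ::
    "('k, 'm) ring_scheme \<Rightarrow> ('v, 'e) pre_digraph \<Rightarrow> nat \<Rightarrow> ('v \<times> 'e list \<Rightarrow> 'k) set" where
  "arrow_ideal_power K G m =
     Idl\<^bsub>path_algebra K G\<^esub> (path_elem K ` {p \<in> quiver_paths G. length (snd p) = m})"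

text \<open>
  Besides quotients of algebras by ideals, this is also used for the quotient of a vector space by
  an arbitrary subspace; then only the fields \<^const>\<open>carrier\<close>, \<^const>\<open>ring.zero\<close>, \<^const>\<open>add\<close> and
  \<^const>\<open>smult\<close> are meaningful.
\<close>

definition quotient_algebra :: "('k, 'a, 'm) module_scheme \<Rightarrow> 'a set \<Rightarrow> ('k, 'a set) module" where
  "quotient_algebra R I =
     \<lparr>carrier = carrier (R Quot I), monoid.mult = monoid.mult (R Quot I), one = one (R Quot I),
      ring.zero = ring.zero (R Quot I), add = add (R Quot I),
      smult = (\<lambda>c X. \<Union>x\<in>X. I +>\<^bsub>R\<^esub> (c \<odot>\<^bsub>R\<^esub> x))\<rparr>"

definition truncated_path_algebra ::
    "('k, 'm) ring_scheme \<Rightarrow> ('v, 'e) pre_digraph \<Rightarrow> nat \<Rightarrow> ('k, ('v \<times> 'e list \<Rightarrow> 'k) set) module"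
where
  "truncated_path_algebra K G m = quotient_algebra (path_algebra K G) (arrow_ideal_power K G m)"

definition trivial_path ::
    "('k, 'm) ring_scheme \<Rightarrow> ('v, 'e) pre_digraph \<Rightarrow> nat \<Rightarrow> 'v \<Rightarrow> ('v \<times> 'e list \<Rightarrow> 'k) set" where
  "trivial_path K G m v = arrow_ideal_power K G m +>\<^bsub>path_algebra K G\<^esub> path_elem K (v, [])"

text \<open>The arrow \<open>i\<close> stands for \<open>x_i\<close>; it ends in \<open>i + 1\<close> if \<open>i < s\<close> and in \<open>1\<close> if \<open>i = s\<close>.\<close>

definition cyclic_quiver :: "nat \<Rightarrow> (nat, nat) pre_digraph" where
  "cyclic_quiver s =
     \<lparr>verts = {1..s}, arcs = {1..s}, tail = (\<lambda>i. i), head = (\<lambda>i. i mod s + 1)\<rparr>"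


section \<open>The dual bimodule and Hochschild extensions\<close>

text \<open>
  \<^const>\<open>ring.func_space\<close> is the pointwise vector space of extensional functions, so every linear
  form on the carrier is represented by exactly one element.
\<close>

definition dual_space ::
    "('k, 'm) ring_scheme \<Rightarrow> ('k, 'a, 'n) module_scheme \<Rightarrow> ('k, 'a \<Rightarrow> 'k) module" where
  "dual_space K A = (ring.func_space K (carrier A))
     \<lparr>carrier := {\<phi> \<in> carrier A \<rightarrow>\<^sub>E carrier K.
        (\<forall>x\<in>carrier A. \<forall>y\<in>carrier A. \<phi> (x \<oplus>\<^bsub>A\<^esub> y) = \<phi> x \<oplus>\<^bsub>K\<^esub> \<phi> y) \<and>
        (\<forall>c\<in>carrier K. \<forall>x\<in>carrier A. \<phi> (c \<odot>\<^bsub>A\<^esub> x) = c \<otimes>\<^bsub>K\<^esub> \<phi> x)}\<rparr>"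

definition dual_lact :: "('a, 'n) ring_scheme \<Rightarrow> 'a \<Rightarrow> ('a \<Rightarrow> 'k) \<Rightarrow> ('a \<Rightarrow> 'k)" where
  "dual_lact A a \<phi> = (\<lambda>c\<in>carrier A. \<phi> (c \<otimes>\<^bsub>A\<^esub> a))"

definition dual_ract :: "('a, 'n) ring_scheme \<Rightarrow> ('a \<Rightarrow> 'k) \<Rightarrow> 'a \<Rightarrow> ('a \<Rightarrow> 'k)" where
  "dual_ract A \<phi> b = (\<lambda>c\<in>carrier A. \<phi> (b \<otimes>\<^bsub>A\<^esub> c))"

definition two_cocycle ::
    "('k, 'm) ring_scheme \<Rightarrow> ('k, 'a, 'n) module_scheme \<Rightarrow> ('a \<Rightarrow> 'a \<Rightarrow> ('a \<Rightarrow> 'k)) \<Rightarrow> bool" where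
  "two_cocycle K A \<alpha> \<longleftrightarrow>
     (\<forall>a\<in>carrier A. \<alpha> a \<in> module_hom K A (dual_space K A)) \<and>
     (\<forall>b\<in>carrier A. (\<lambda>a. \<alpha> a b) \<in> module_hom K A (dual_space K A)) \<and>
     (\<forall>a\<in>carrier A. \<forall>b\<in>carrier A. \<forall>c\<in>carrier A.
        dual_lact A a (\<alpha> b c) \<ominus>\<^bsub>dual_space K A\<^esub> \<alpha> (a \<otimes>\<^bsub>A\<^esub> b) c
          \<oplus>\<^bsub>dual_space K A\<^esub> \<alpha> a (b \<otimes>\<^bsub>A\<^esub> c) \<ominus>\<^bsub>dual_space K A\<^esub> dual_ract A (\<alpha> a b) c
        = \<zero>\<^bsub>dual_space K A\<^esub>)"

definition hochschild_extension ::
    "('k, 'm) ring_scheme \<Rightarrow> ('k, 'a) module \<Rightarrow> ('a \<Rightarrow> 'a \<Rightarrow> ('a \<Rightarrow> 'k)) \<Rightarrow>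
     ('k, 'a \<times> ('a \<Rightarrow> 'k)) module" where
  "hochschild_extension K A \<alpha> = (direct_sum A (dual_space K A))
     \<lparr>monoid.mult := (\<lambda>(a, x) (b, y).
        (a \<otimes>\<^bsub>A\<^esub> b,
         dual_lact A a y \<oplus>\<^bsub>dual_space K A\<^esub> dual_ract A x b \<oplus>\<^bsub>dual_space K A\<^esub> \<alpha> a b)),
      one := (\<one>\<^bsub>A\<^esub>, \<ominus>\<^bsub>dual_space K A\<^esub> \<alpha> \<one>\<^bsub>A\<^esub> \<one>\<^bsub>A\<^esub>)\<rparr>"


section \<open>Ordinary quivers\<close>

definition right_ideal :: "'a set \<Rightarrow> ('a, 'm) ring_scheme \<Rightarrow> bool" where
  "right_ideal I R \<longleftrightarrow>
     additive_subgroup I R \<and> (\<forall>a\<in>I. \<forall>x\<in>carrier R. a \<otimes>\<^bsub>R\<^esub> x \<in> I)"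

definition maximal_right_ideal :: "'a set \<Rightarrow> ('a, 'm) ring_scheme \<Rightarrow> bool" where
  "maximal_right_ideal I R \<longleftrightarrow>
     right_ideal I R \<and> I \<noteq> carrier R \<and>
     (\<forall>J. right_ideal J R \<and> I \<subseteq> J \<longrightarrow> J = I \<or> J = carrier R)"

definition jacobson_radical :: "('a, 'm) ring_scheme \<Rightarrow> 'a set" where
  "jacobson_radical R = carrier R \<inter> \<Inter>{I. maximal_right_ideal I R}"

definition idempotent_elem :: "('a, 'm) ring_scheme \<Rightarrow> 'a \<Rightarrow> bool" where
  "idempotent_elem R e \<longleftrightarrow> e \<in> carrier R \<and> e \<otimes>\<^bsub>R\<^esub> e = e"

definition primitive_idempotent :: "('a, 'm) ring_scheme \<Rightarrow> 'a \<Rightarrow> bool" where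
  "primitive_idempotent R e \<longleftrightarrow>
     idempotent_elem R e \<and> e \<noteq> \<zero>\<^bsub>R\<^esub> \<and>
     (\<forall>f g. idempotent_elem R f \<and> idempotent_elem R g \<and>
            f \<otimes>\<^bsub>R\<^esub> g = \<zero>\<^bsub>R\<^esub> \<and> g \<otimes>\<^bsub>R\<^esub> f = \<zero>\<^bsub>R\<^esub> \<and> e = f \<oplus>\<^bsub>R\<^esub> g \<longrightarrow>
            f = \<zero>\<^bsub>R\<^esub> \<or> g = \<zero>\<^bsub>R\<^esub>)"

definition complete_primitive_orthogonal_idempotents ::
    "('a, 'm) ring_scheme \<Rightarrow> 'v set \<Rightarrow> ('v \<Rightarrow> 'a) \<Rightarrow> bool" where
  "complete_primitive_orthogonal_idempotents R V e \<longleftrightarrow>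
     finite V \<and>
     (\<forall>i\<in>V. primitive_idempotent R (e i)) \<and>
     (\<forall>i\<in>V. \<forall>j\<in>V. i \<noteq> j \<longrightarrow> e i \<otimes>\<^bsub>R\<^esub> e j = \<zero>\<^bsub>R\<^esub>) \<and>
     (\<Oplus>\<^bsub>R\<^esub>i\<in>V. e i) = \<one>\<^bsub>R\<^esub>"

definition peirce_corner :: "('a, 'm) ring_scheme \<Rightarrow> 'a \<Rightarrow> 'a set \<Rightarrow> 'a \<Rightarrow> 'a set" where
  "peirce_corner R e X f = (\<lambda>x. e \<otimes>\<^bsub>R\<^esub> x \<otimes>\<^bsub>R\<^esub> f) ` X"

definition num_quiver_arrows ::
    "('k, 'm) ring_scheme \<Rightarrow> ('k, 'a) module \<Rightarrow> 'a \<Rightarrow> 'a \<Rightarrow> nat" where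
  "num_quiver_arrows K T e f =
     (let J = jacobson_radical T in
      vectorspace.dim K
        (quotient_algebra (T\<lparr>carrier := peirce_corner T e J f\<rparr>)
                          (peirce_corner T e (ideal_prod T J J) f)))"

definition ordinary_quiver_eq ::
    "('k, 'm) ring_scheme \<Rightarrow> ('k, 'a) module \<Rightarrow> ('v \<Rightarrow> 'a) \<Rightarrow> ('v, 'e) pre_digraph \<Rightarrow> bool" where
  "ordinary_quiver_eq K T e G \<longleftrightarrow>
     (\<forall>i\<in>verts G. \<forall>j\<in>verts G.
        num_quiver_arrows K T (e i) (e j) = card {x \<in> arcs G. tail G x = i \<and> head G x = j})"


section \<open>Isomorphic and symmetric algebras\<close>

definition algebra_isomorphic ::
    "('k, 'm) ring_scheme \<Rightarrow> ('k, 'a) module \<Rightarrow> ('k, 'b) module \<Rightarrow> bool" where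
  "algebra_isomorphic K R S \<longleftrightarrow> (\<exists>h. h \<in> ring_iso R S \<and> h \<in> module_hom K R S)"

definition symmetric_algebra :: "('k, 'm) ring_scheme \<Rightarrow> ('k, 'a) module \<Rightarrow> bool" where
  "symmetric_algebra K T \<longleftrightarrow>
     (\<exists>\<theta>. \<theta> \<in> module_hom K T (dual_space K T) \<and>
          bij_betw \<theta> (carrier T) (carrier (dual_space K T)) \<and>
          (\<forall>a\<in>carrier T. \<forall>x\<in>carrier T. \<forall>b\<in>carrier T.
             \<theta> (a \<otimes>\<^bsub>T\<^esub> x \<otimes>\<^bsub>T\<^esub> b) = dual_lact T a (dual_ract T (\<theta> x) b)))"

end

theory Submission
  imports Defs
begin

text \<open>
  Write \<open>T\<close> for the Hochschild extension. Its radical is the preimage of the radical of \<open>A\<close>, and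
  \<open>rad T ^ (2 * n) = 0\<close>. As \<open>n \<ge> 2\<close>, lifts of the arrows of \<open>A\<close> lie outside \<open>rad T ^ 2\<close>, so by the
  hypothesis on the quiver they generate \<open>rad T\<close> modulo \<open>rad T ^ 2\<close>; hence the products \<open>b i k\<close> of \<open>k\<close>
  consecutive lifts starting at \<open>i\<close>, for \<open>k < 2 * n\<close>, span \<open>T\<close>. The functional dual to a path \<open>p\<close> of length
  \<open>n - 1\<close> ending at \<open>i\<close> belongs to \<open>e i T\<close> and has a nonzero product with \<open>p\<close> that is supported
  at \<open>i\<close>. This forces \<open>b i (2 * n - 1) \<noteq> 0\<close>, which makes the \<open>b i k\<close> linearly independent, and
  \<open>s dvd 2 * n - 1\<close>, so that summing the coefficients of the \<open>b i (2 * n - 1)\<close> is a symmetrizing form.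
\<close>


section \<open>Finite sums\<close>

text \<open>The cocycle is arbitrary, so the functional part of a product of lifted arrows is out of
  reach. Once \<open>T\<close> is known to be an algebra, \<open>\<alpha>\<close> is therefore
  evaluated only where one argument is 0. The bound \<open>2 * n\<close> counts \<open>n\<close>
  layers from \<open>A\<close> and \<open>n\<close> from \<open>D(A)\<close>. Lifted arrows avoid
  \<open>rad T ^ 2\<close> because the image of that ideal in \<open>A\<close> has no coefficient on
  paths of length one, which are nonzero in \<open>A\<close> as \<open>n \<ge> 2\<close>. The dual
  functional has component 0 in \<open>A\<close>, where the images of paths shorter than
  \<open>n\<close> are independent, so it involves only paths of length at least \<open>n\<close>;
  after multiplication by a path of length \<open>n - 1\<close> only its term of length
  \<open>n\<close> survives. The surviving path is closed, which yields nonvanishing and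
  divisibility at once. Independence is not a dimension count: a relation is multiplied by the path
  that completes its shortest term to length \<open>2 * n - 1\<close>, and all longer terms die.
  Isomorphism and symmetry depend only on coordinates with a convolution product, so they are proved
  for every algebra with such coordinates.\<close>

lemma (in abelian_monoid) finsum_Sigma:
  assumes "finite S" "\<And>a. a \<in> S \<Longrightarrow> finite (T a)"
    and "\<And>a b. a \<in> S \<Longrightarrow> b \<in> T a \<Longrightarrow> f a b \<in> carrier G"
  shows "(\<Oplus>a\<in>S. \<Oplus>b\<in>T a. f a b) = (\<Oplus>p\<in>Sigma S T. f (fst p) (snd p))"
  using assms
proof (induction S rule: finite_induct)
  case empty
  then show ?case by simp
next
  case (insert x F)
  have inj: "inj_on (Pair x) (T x)" by (simp add: inj_on_def)
  have split: "Sigma (insert x F) T = Pair x ` T x \<union> Sigma F T" by auto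
  have disj: "Pair x ` T x \<inter> Sigma F T = {}" using insert.hyps by auto
  have fin: "finite (Pair x ` T x)" "finite (Sigma F T)" using insert by auto
  have "(\<Oplus>p\<in>Sigma (insert x F) T. f (fst p) (snd p))
      = (\<Oplus>p\<in>Pair x ` T x. f (fst p) (snd p)) \<oplus> (\<Oplus>p\<in>Sigma F T. f (fst p) (snd p))"
    unfolding split by (rule finsum_Un_disjoint) (use fin disj insert.prems in auto)
  also have "(\<Oplus>p\<in>Pair x ` T x. f (fst p) (snd p)) = (\<Oplus>b\<in>T x. f x b)"
    by (subst finsum_reindex[OF _ inj]) (use insert.prems in \<open>auto intro!: finsum_cong'\<close>)
  also have "(\<Oplus>p\<in>Sigma F T. f (fst p) (snd p)) = (\<Oplus>a\<in>F. \<Oplus>b\<in>T a. f a b)"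
    using insert by simp
  finally show ?case
    using insert by (subst finsum_insert) (auto intro!: finsum_closed)
qed

lemma (in abelian_monoid) finsum_single:
  assumes "finite S" "a \<in> S" "f a \<in> carrier G" "\<And>x. x \<in> S \<Longrightarrow> x \<noteq> a \<Longrightarrow> f x = \<zero>"
  shows "finsum G f S = f a"
proof -
  have "finsum G f S = finsum G f (insert a (S - {a}))"
    using assms(2) by (simp add: insert_absorb)
  also have "\<dots> = f a \<oplus> finsum G f (S - {a})"
    by (rule finsum_insert) (use assms in \<open>auto intro!: zero_closed\<close>)
  also have "finsum G f (S - {a}) = \<zero>"
    using assms(4) by (intro add.finprod_one_eqI) auto
  finally show ?thesis using assms(3) by simp
qed

lemma (in abelian_monoid) finsum_reindex_bij:
  assumes "bij_betw h S T" "\<And>y. y \<in> T \<Longrightarrow> f y \<in> carrier G"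
  shows "(\<Oplus>x\<in>S. f (h x)) = finsum G f T"
  using assms finsum_reindex[of f h S] by (auto simp: bij_betw_def)

lemma additive_zero:
  assumes "abelian_group G" "abelian_group H" "h \<in> carrier G \<rightarrow> carrier H"
    and "\<And>x y. x \<in> carrier G \<Longrightarrow> y \<in> carrier G \<Longrightarrow> h (x \<oplus>\<^bsub>G\<^esub> y) = h x \<oplus>\<^bsub>H\<^esub> h y"
  shows "h \<zero>\<^bsub>G\<^esub> = \<zero>\<^bsub>H\<^esub>"
proof -
  interpret G: abelian_group G by fact
  interpret H: abelian_group H by fact
  have c: "h \<zero>\<^bsub>G\<^esub> \<in> carrier H" using assms(3) by auto
  have "h \<zero>\<^bsub>G\<^esub> \<oplus>\<^bsub>H\<^esub> h \<zero>\<^bsub>G\<^esub> = h \<zero>\<^bsub>G\<^esub> \<oplus>\<^bsub>H\<^esub> \<zero>\<^bsub>H\<^esub>"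
    using assms(4)[of "\<zero>\<^bsub>G\<^esub>" "\<zero>\<^bsub>G\<^esub>"] c by simp
  then show ?thesis using c by (metis H.add.l_cancel_one H.r_zero H.add.r_cancel_one')
qed

text \<open>Stated for bare additive maps, so that coordinates, evaluations of functionals, scalar
  multiplications and the two embeddings into the extension are all covered.\<close>

lemma additive_finsum:
  assumes "abelian_group G" "abelian_group H" "h \<in> carrier G \<rightarrow> carrier H"
    and "\<And>x y. x \<in> carrier G \<Longrightarrow> y \<in> carrier G \<Longrightarrow> h (x \<oplus>\<^bsub>G\<^esub> y) = h x \<oplus>\<^bsub>H\<^esub> h y"
    and "\<And>a. a \<in> S \<Longrightarrow> f a \<in> carrier G"
  shows "h (finsum G f S) = (\<Oplus>\<^bsub>H\<^esub>a\<in>S. h (f a))"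
proof -
  interpret G: abelian_group G by fact
  interpret H: abelian_group H by fact
  note z = additive_zero[OF assms(1-4)]
  show ?thesis using assms(5)
  proof (induction S rule: infinite_finite_induct)
    case (insert x F)
    have "finsum G f F \<in> carrier G" by (rule G.finsum_closed) (use insert in auto)
    with insert assms(3,4) show ?case
      by (subst G.finsum_insert) (auto simp: Pi_iff)
  qed (simp_all add: z)
qed


section \<open>Truncated cycle algebras in coordinates\<close>

text \<open>As the product is noncommutative, compatibility with scalars is required for each factor
  separately.\<close>

locale noncomm_algebra = K: field K + B: ring B + module K B
  for K :: "('k, 'm) ring_scheme" and B :: "('k, 'a) module" +
  assumes smult_mult_left: "\<lbrakk>c \<in> carrier K; x \<in> carrier B; y \<in> carrier B\<rbrakk> \<Longrightarrow>
      (c \<odot>\<^bsub>B\<^esub> x) \<otimes>\<^bsub>B\<^esub> y = c \<odot>\<^bsub>B\<^esub> (x \<otimes>\<^bsub>B\<^esub> y)"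
    and smult_mult_right: "\<lbrakk>c \<in> carrier K; x \<in> carrier B; y \<in> carrier B\<rbrakk> \<Longrightarrow>
      x \<otimes>\<^bsub>B\<^esub> (c \<odot>\<^bsub>B\<^esub> y) = c \<odot>\<^bsub>B\<^esub> (x \<otimes>\<^bsub>B\<^esub> y)"

text \<open>The end of the path of length \<open>k\<close> that starts at the vertex \<open>i\<close> of the cyclic quiver.\<close>

definition cycle_end :: "nat \<Rightarrow> nat \<Rightarrow> nat \<Rightarrow> nat" where
  "cycle_end s i k = (i - 1 + k) mod s + 1"

lemma cycle_end_bounds [simp]:
  "Suc 0 \<le> cycle_end s i k" "Suc 0 \<le> s \<Longrightarrow> cycle_end s i k \<le> s"
  by (simp_all add: cycle_end_def Suc_leI)

lemma cycle_end_in: "s \<ge> 1 \<Longrightarrow> cycle_end s i k \<in> {1..s}"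
  by simp

lemma cycle_end_0 [simp]: "i \<in> {1..s} \<Longrightarrow> cycle_end s i 0 = i"
  by (auto simp: cycle_end_def)

lemma cycle_end_cycle_end [simp]: "cycle_end s (cycle_end s i k) l = cycle_end s i (k + l)"
  by (simp add: cycle_end_def mod_add_left_eq add.assoc)

text \<open>Closed paths wind around the cycle. One direction extracts the divisibility by
  \<open>s\<close> from a closed path, the other lets paths be completed to closed ones.\<close>

lemma cycle_end_self_iff:
  assumes "i \<in> {1..s}"
  shows "cycle_end s i k = i \<longleftrightarrow> s dvd k"
proof
  assume "s dvd k"
  then obtain q where "k = s * q" ..
  then have "(i - 1 + k) mod s = (i - 1) mod s" by simp
  then show "cycle_end s i k = i" using assms by (auto simp: cycle_end_def)
next
  assume "cycle_end s i k = i"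
  then have "(i - 1 + k) mod s = i - 1" unfolding cycle_end_def by linarith
  also have "\<dots> = (i - 1) mod s" using assms by auto
  finally have "(i - 1 + k) mod s = (i - 1) mod s" .
  then show "s dvd k" by (metis add_diff_cancel_left' le_add1 mod_eq_dvd_iff_nat)
qed

text \<open>A path of length \<open>k\<close> goes to its complement, the path of length
  \<open>m - k\<close> that starts where it ends. As \<open>s\<close> divides \<open>m\<close>, a
  path followed by its complement is closed, so the map is an involution.\<close>

lemma bij_betw_cycle_reverse:
  assumes "s \<ge> 1" "s dvd m"
  shows "bij_betw (\<lambda>(i, k). (cycle_end s i k, m - k)) ({1..s} \<times> {..m}) ({1..s} \<times> {..m})"
  by (rule bij_betw_byWitness[where f' = "\<lambda>(i, k). (cycle_end s i k, m - k)"])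
    (use assms cycle_end_self_iff in auto)

text \<open>\<open>co x i k\<close> is the coefficient in \<open>x\<close> of the path of length \<open>k\<close> that starts at \<open>i\<close>.\<close>

locale truncated_cycle = noncomm_algebra K B
  for K :: "('k, 'm) ring_scheme" and B :: "('k, 'a) module" +
  fixes s m :: nat and co :: "'a \<Rightarrow> nat \<Rightarrow> nat \<Rightarrow> 'k"
  assumes s_pos: "s \<ge> 1"
    and co_closed: "\<lbrakk>x \<in> carrier B; i \<in> {1..s}; k < m\<rbrakk> \<Longrightarrow> co x i k \<in> carrier K"
    and co_add: "\<lbrakk>x \<in> carrier B; y \<in> carrier B; i \<in> {1..s}; k < m\<rbrakk> \<Longrightarrow>
      co (x \<oplus>\<^bsub>B\<^esub> y) i k = co x i k \<oplus>\<^bsub>K\<^esub> co y i k"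
    and co_smult: "\<lbrakk>c \<in> carrier K; x \<in> carrier B; i \<in> {1..s}; k < m\<rbrakk> \<Longrightarrow>
      co (c \<odot>\<^bsub>B\<^esub> x) i k = c \<otimes>\<^bsub>K\<^esub> co x i k"
    and co_mult: "\<lbrakk>x \<in> carrier B; y \<in> carrier B; i \<in> {1..s}; k < m\<rbrakk> \<Longrightarrow>
      co (x \<otimes>\<^bsub>B\<^esub> y) i k = (\<Oplus>\<^bsub>K\<^esub>l\<in>{..k}. co x i l \<otimes>\<^bsub>K\<^esub> co y (cycle_end s i l) (k - l))"
    and co_inject: "\<lbrakk>x \<in> carrier B; y \<in> carrier B;
      \<And>i k. \<lbrakk>i \<in> {1..s}; k < m\<rbrakk> \<Longrightarrow> co x i k = co y i k\<rbrakk> \<Longrightarrow> x = y"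
    and co_surject: "(\<And>i k. \<lbrakk>i \<in> {1..s}; k < m\<rbrakk> \<Longrightarrow> f i k \<in> carrier K) \<Longrightarrow>
      \<exists>x\<in>carrier B. \<forall>i\<in>{1..s}. \<forall>k<m. co x i k = f i k"
begin

definition of_coords :: "(nat \<Rightarrow> nat \<Rightarrow> 'k) \<Rightarrow> 'a" where
  "of_coords f = (SOME x. x \<in> carrier B \<and> (\<forall>i\<in>{1..s}. \<forall>k<m. co x i k = f i k))"

lemma of_coords:
  assumes "\<And>i k. \<lbrakk>i \<in> {1..s}; k < m\<rbrakk> \<Longrightarrow> f i k \<in> carrier K"
  shows of_coords_closed: "of_coords f \<in> carrier B"
    and co_of_coords: "\<lbrakk>i \<in> {1..s}; k < m\<rbrakk> \<Longrightarrow> co (of_coords f) i k = f i k"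
  using someI_ex[of "\<lambda>x. x \<in> carrier B \<and> (\<forall>i\<in>{1..s}. \<forall>k<m. co x i k = f i k)"]
    co_surject[of f] assms
  unfolding of_coords_def by blast+

lemma co_zero: "\<lbrakk>i \<in> {1..s}; k < m\<rbrakk> \<Longrightarrow> co \<zero>\<^bsub>B\<^esub> i k = \<zero>\<^bsub>K\<^esub>"
  by (rule additive_zero[OF B.is_abelian_group K.is_abelian_group]) (auto simp: co_closed co_add)

lemma co_finsum:
  "\<lbrakk>\<And>a. a \<in> S \<Longrightarrow> f a \<in> carrier B; i \<in> {1..s}; k < m\<rbrakk> \<Longrightarrow>
    co (finsum B f S) i k = (\<Oplus>\<^bsub>K\<^esub>a\<in>S. co (f a) i k)"
  by (rule additive_finsum[OF B.is_abelian_group K.is_abelian_group]) (auto simp: co_closed co_add)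

text \<open>For \<open>k \<ge> m\<close> this is zero, so products of basis paths can be stated
  without a condition on lengths.\<close>

definition path_basis :: "nat \<Rightarrow> nat \<Rightarrow> 'a" where
  "path_basis i k = of_coords (\<lambda>j l. if j = i \<and> l = k then \<one>\<^bsub>K\<^esub> else \<zero>\<^bsub>K\<^esub>)"

lemma path_basis_closed [simp]: "path_basis i k \<in> carrier B"
  unfolding path_basis_def by (rule of_coords_closed) auto

lemma co_path_basis:
  "\<lbrakk>j \<in> {1..s}; l < m\<rbrakk> \<Longrightarrow>
    co (path_basis i k) j l = (if j = i \<and> l = k then \<one>\<^bsub>K\<^esub> else \<zero>\<^bsub>K\<^esub>)"
  unfolding path_basis_def by (rule co_of_coords) auto

lemma expand:
  assumes "x \<in> carrier B"
  shows "x = (\<Oplus>\<^bsub>B\<^esub>p\<in>{1..s} \<times> {..<m}. co x (fst p) (snd p) \<odot>\<^bsub>B\<^esub> path_basis (fst p) (snd p))"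
    (is "x = finsum B ?f ?S")
proof (rule co_inject)
  have c: "?f p \<in> carrier B" if "p \<in> ?S" for p
    using that assms by (auto intro!: smult_closed co_closed)
  then show "finsum B ?f ?S \<in> carrier B" by (intro B.finsum_closed) auto
  fix i k assume ik: "i \<in> {1..s}" "k < m"
  have "co (finsum B ?f ?S) i k = (\<Oplus>\<^bsub>K\<^esub>p\<in>?S. co (?f p) i k)"
    by (rule co_finsum) (use c ik in auto)
  also have "\<dots> = co (?f (i, k)) i k"
  proof (rule K.finsum_single)
    show "co (?f p) i k = \<zero>\<^bsub>K\<^esub>" if "p \<in> ?S" "p \<noteq> (i, k)" for p
      using that ik assms by (auto simp: co_smult co_closed co_path_basis prod_eq_iff)
  qed (use ik assms in \<open>auto intro!: co_closed smult_closed\<close>)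
  also have "\<dots> = co x i k" using ik assms by (simp add: co_smult co_closed co_path_basis)
  finally show "co x i k = co (finsum B ?f ?S) i k" by simp
qed (rule assms)

end

text \<open>The coordinates determine an element, take arbitrary values, and govern all operations
  by the same formulas in both algebras; carrying them over is the isomorphism.\<close>

theorem truncated_cycle_isomorphic:
  assumes "truncated_cycle K B s m co" "truncated_cycle K C s m co'"
  shows "algebra_isomorphic K B C"
proof -
  interpret B: truncated_cycle K B s m co by fact
  interpret C: truncated_cycle K C s m co' by fact
  define h where "h x = C.of_coords (co x)" for x
  define g where "g x = B.of_coords (co' x)" for x
  have h: "h x \<in> carrier C" "\<lbrakk>i \<in> {1..s}; k < m\<rbrakk> \<Longrightarrow> co' (h x) i k = co x i k"
    if "x \<in> carrier B" for x i k
    unfolding h_def using that B.co_closed C.of_coords by metis+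
  have g: "g x \<in> carrier B" "\<lbrakk>i \<in> {1..s}; k < m\<rbrakk> \<Longrightarrow> co (g x) i k = co' x i k"
    if "x \<in> carrier C" for x i k
    unfolding g_def using that C.co_closed B.of_coords by metis+
  have hg: "h (g x) = x" if "x \<in> carrier C" for x
    using that by (intro C.co_inject) (simp_all add: h g)
  have gh: "g (h x) = x" if "x \<in> carrier B" for x
    using that by (intro B.co_inject) (simp_all add: h g)
  have bij: "bij_betw h (carrier B) (carrier C)"
    by (rule bij_betw_byWitness[where f' = g]) (use h g hg gh in auto)
  have mult: "h (x \<otimes>\<^bsub>B\<^esub> y) = h x \<otimes>\<^bsub>C\<^esub> h y" if "x \<in> carrier B" "y \<in> carrier B" for x y
  proof (rule C.co_inject)
    fix i k assume ik: "i \<in> {1..s}" "k < m"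
    show "co' (h (x \<otimes>\<^bsub>B\<^esub> y)) i k = co' (h x \<otimes>\<^bsub>C\<^esub> h y) i k"
      using that ik B.s_pos
      by (simp add: h B.co_mult C.co_mult) (intro B.K.finsum_cong'; auto simp: h B.co_closed)
  qed (use that h in auto)
  \<comment> \<open>The coordinates of the unit are not part of the locale. Instead,
    \<open>h\<close> is multiplicative and hits the unit of \<open>C\<close>, so the image of the
    unit of \<open>B\<close> acts as a left unit on it.\<close>
  have one: "h \<one>\<^bsub>B\<^esub> = \<one>\<^bsub>C\<^esub>"
  proof -
    have "h \<one>\<^bsub>B\<^esub> \<otimes>\<^bsub>C\<^esub> h (g \<one>\<^bsub>C\<^esub>) = h (g \<one>\<^bsub>C\<^esub>)"
      by (simp only: mult[symmetric] B.B.l_one B.B.one_closed g C.B.one_closed)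
    then have *: "h \<one>\<^bsub>B\<^esub> \<otimes>\<^bsub>C\<^esub> \<one>\<^bsub>C\<^esub> = \<one>\<^bsub>C\<^esub>" by (simp only: hg C.B.one_closed)
    show ?thesis using C.B.r_one[OF h(1)[OF B.B.one_closed]] unfolding * by simp
  qed
  have add: "h (x \<oplus>\<^bsub>B\<^esub> y) = h x \<oplus>\<^bsub>C\<^esub> h y" if "x \<in> carrier B" "y \<in> carrier B" for x y
    using that by (intro C.co_inject) (simp_all add: h B.co_add C.co_add)
  have smult: "h (c \<odot>\<^bsub>B\<^esub> x) = c \<odot>\<^bsub>C\<^esub> h x" if "c \<in> carrier K" "x \<in> carrier B" for c x
    using that by (intro C.co_inject) (simp_all add: h B.co_smult C.co_smult)
  have "h \<in> ring_iso B C"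
    using bij one add mult h by (auto simp: ring_iso_def ring_hom_def)
  moreover have "h \<in> module_hom K B C"
    using add smult h by (auto simp: module_hom_def)
  ultimately show ?thesis unfolding algebra_isomorphic_def by blast
qed

text \<open>The form \<open>t\<close> sums the coefficients of the longest paths. In
  \<open>t (x y)\<close> each path is paired with its complement of total length
  \<open>m - 1\<close>; this pairing is nondegenerate, and it is symmetric because complementation
  is an involution when \<open>s\<close> divides \<open>m - 1\<close>. The bimodule isomorphism
  sends \<open>x\<close> to \<open>t (x _)\<close>.\<close>

theorem truncated_cycle_symmetric:
  assumes "truncated_cycle K B s m co" and m: "m \<ge> 1" and dvd: "s dvd m - 1"
  shows "symmetric_algebra K B"
proof -
  interpret truncated_cycle K B s m co by fact
  define t where "t x = (\<Oplus>\<^bsub>K\<^esub>i\<in>{1..s}. co x i (m - 1))" for x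
  have end_in: "cycle_end s i k \<in> {1..s}" for i k using s_pos by simp
  have less: "k < m" if "k \<le> m - 1" for k using that m by simp
  have t_closed [simp]: "t x \<in> carrier K" if "x \<in> carrier B" for x
    unfolding t_def using that m by (intro K.finsum_closed) (auto intro!: co_closed)
  have t_add: "t (x \<oplus>\<^bsub>B\<^esub> y) = t x \<oplus>\<^bsub>K\<^esub> t y" if "x \<in> carrier B" "y \<in> carrier B" for x y
    unfolding t_def using that m
    by (subst K.finsum_addf[symmetric]) (auto intro!: co_closed K.finsum_cong' simp: co_add)
  have t_smult: "t (c \<odot>\<^bsub>B\<^esub> x) = c \<otimes>\<^bsub>K\<^esub> t x" if "c \<in> carrier K" "x \<in> carrier B" for c x
    unfolding t_def using that m
    by (subst K.finsum_rdistr) (auto intro!: co_closed K.finsum_cong' simp: co_smult)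
  let ?S = "{1..s} \<times> {..m - 1}"
  let ?rev = "\<lambda>(i, k). (cycle_end s i k, m - 1 - k)"
  have rev: "bij_betw ?rev ?S ?S" by (rule bij_betw_cycle_reverse[OF s_pos dvd])
  have t_mult: "t (x \<otimes>\<^bsub>B\<^esub> y)
      = (\<Oplus>\<^bsub>K\<^esub>p\<in>?S. co x (fst p) (snd p) \<otimes>\<^bsub>K\<^esub> co y (cycle_end s (fst p) (snd p)) (m - 1 - snd p))"
    if "x \<in> carrier B" "y \<in> carrier B" for x y
  proof -
    have "t (x \<otimes>\<^bsub>B\<^esub> y) = (\<Oplus>\<^bsub>K\<^esub>i\<in>{1..s}. \<Oplus>\<^bsub>K\<^esub>l\<in>{..m - 1}.
        co x i l \<otimes>\<^bsub>K\<^esub> co y (cycle_end s i l) (m - 1 - l))"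
      unfolding t_def
      by (rule K.finsum_cong')
        (use that m end_in less in \<open>auto simp del: atLeastAtMost_iff simp: co_mult intro!: co_closed K.finsum_closed\<close>)
    also have "\<dots> = (\<Oplus>\<^bsub>K\<^esub>p\<in>?S. co x (fst p) (snd p) \<otimes>\<^bsub>K\<^esub> co y (cycle_end s (fst p) (snd p)) (m - 1 - snd p))"
      by (rule K.finsum_Sigma) (use that m end_in less in \<open>auto simp del: atLeastAtMost_iff intro!: co_closed\<close>)
    finally show ?thesis .
  qed
  \<comment> \<open>Reindexing the sum by complementation exchanges the roles of the two
    factors.\<close>
  have t_comm: "t (x \<otimes>\<^bsub>B\<^esub> y) = t (y \<otimes>\<^bsub>B\<^esub> x)" if "x \<in> carrier B" "y \<in> carrier B" for x y
  proof -
    define f where "f p = co y (fst p) (snd p) \<otimes>\<^bsub>K\<^esub> co x (cycle_end s (fst p) (snd p)) (m - 1 - snd p)" for p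
    have cl: "f p \<in> carrier K" if "p \<in> ?S" for p
      using that \<open>x \<in> carrier B\<close> \<open>y \<in> carrier B\<close> end_in less unfolding f_def
      by (auto simp del: atLeastAtMost_iff intro!: co_closed)
    have "t (y \<otimes>\<^bsub>B\<^esub> x) = finsum K f ?S" using that by (simp only: t_mult f_def[abs_def])
    also have "\<dots> = (\<Oplus>\<^bsub>K\<^esub>p\<in>?S. f (?rev p))"
      by (rule K.finsum_reindex_bij[OF rev, symmetric]) (rule cl)
    also have "\<dots> = t (x \<otimes>\<^bsub>B\<^esub> y)"
      unfolding t_mult[OF that]
    proof (rule K.finsum_cong'[OF refl])
      fix p assume p: "p \<in> ?S"
      obtain i k where ik: "p = (i, k)" "i \<in> {1..s}" "k \<le> m - 1" using p by auto
      then have "cycle_end s i (m - 1) = i" "k + (m - Suc k) = m - 1" "m - Suc (m - Suc k) = k"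
        using cycle_end_self_iff dvd m by auto
      moreover have "co x i k \<in> carrier K" "co y (cycle_end s i k) (m - Suc k) \<in> carrier K"
        using that ik end_in less by (auto intro!: co_closed simp del: atLeastAtMost_iff)
      ultimately show "f (?rev p) = co x (fst p) (snd p) \<otimes>\<^bsub>K\<^esub> co y (cycle_end s (fst p) (snd p)) (m - 1 - snd p)"
        using ik unfolding f_def by (simp add: K.m_comm)
    qed (use that end_in less in \<open>auto simp del: atLeastAtMost_iff intro!: co_closed\<close>)
    finally show ?thesis by simp
  qed
  \<comment> \<open>Pairing with the complement of a path reads off the coefficient of that path,
    since complementation is injective. This yields injectivity of the map below.\<close>
  have t_basis: "t (x \<otimes>\<^bsub>B\<^esub> path_basis (cycle_end s i k) (m - 1 - k)) = co x i k"
    if x: "x \<in> carrier B" and ik: "i \<in> {1..s}" "k < m" for x i k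
  proof -
    let ?f = "\<lambda>p. co x (fst p) (snd p) \<otimes>\<^bsub>K\<^esub>
      co (path_basis (cycle_end s i k) (m - 1 - k)) (cycle_end s (fst p) (snd p)) (m - 1 - snd p)"
    have k: "k \<le> m - 1" using ik by simp
    have "finsum K ?f ?S = ?f (i, k)"
    proof (rule K.finsum_single)
      fix p assume p: "p \<in> ?S" "p \<noteq> (i, k)"
      have "?rev p \<noteq> ?rev (i, k)"
        using rev p ik k unfolding bij_betw_def inj_on_def by blast
      then show "?f p = \<zero>\<^bsub>K\<^esub>"
        using p x end_in less
        by (auto simp del: atLeastAtMost_iff simp: co_path_basis co_closed)
    qed (use x ik k end_in less in \<open>auto simp del: atLeastAtMost_iff intro!: co_closed K.m_closed\<close>)
    then show ?thesis
      using x ik k end_in less by (simp del: atLeastAtMost_iff add: t_mult co_path_basis co_closed)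
  qed
  define \<theta> where "\<theta> x = (\<lambda>y\<in>carrier B. t (x \<otimes>\<^bsub>B\<^esub> y))" for x
  have \<theta>_dual: "\<theta> x \<in> carrier (dual_space K B)" if "x \<in> carrier B" for x
    using that unfolding \<theta>_def dual_space_def
    by (auto simp: t_add t_smult B.r_distr smult_mult_right)
  have \<theta>_hom: "\<theta> \<in> module_hom K B (dual_space K B)"
    using \<theta>_dual unfolding module_hom_def
    by (auto simp: dual_space_def K.func_space_def \<theta>_def fun_eq_iff t_add t_smult B.l_distr smult_mult_left)
  have inj: "inj_on \<theta> (carrier B)"
  proof (rule inj_onI)
    fix x y assume xy: "x \<in> carrier B" "y \<in> carrier B" "\<theta> x = \<theta> y"
    have *: "t (x \<otimes>\<^bsub>B\<^esub> z) = t (y \<otimes>\<^bsub>B\<^esub> z)" if "z \<in> carrier B" for z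
      using fun_cong[OF xy(3), of z] that unfolding \<theta>_def by simp
    show "x = y"
    proof (rule co_inject[OF xy(1,2)])
      fix i k assume "i \<in> {1..s}" "k < m"
      then show "co x i k = co y i k"
        using t_basis[OF xy(1), of i k] t_basis[OF xy(2), of i k] *[OF path_basis_closed] by simp
    qed
  qed
  have surj: "\<phi> \<in> \<theta> ` carrier B" if "\<phi> \<in> carrier (dual_space K B)" for \<phi>
  proof
    have \<phi>: "\<phi> \<in> carrier B \<rightarrow> carrier K" "\<phi> \<in> extensional (carrier B)"
      "\<And>x y. \<lbrakk>x \<in> carrier B; y \<in> carrier B\<rbrakk> \<Longrightarrow> \<phi> (x \<oplus>\<^bsub>B\<^esub> y) = \<phi> x \<oplus>\<^bsub>K\<^esub> \<phi> y"
      "\<And>c x. \<lbrakk>c \<in> carrier K; x \<in> carrier B\<rbrakk> \<Longrightarrow> \<phi> (c \<odot>\<^bsub>B\<^esub> x) = c \<otimes>\<^bsub>K\<^esub> \<phi> x"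
      using that by (auto simp: dual_space_def PiE_def)
    have [simp]: "\<phi> x \<in> carrier K" if "x \<in> carrier B" for x using \<phi>(1) that by auto
    \<comment> \<open>The coefficient of a path in the preimage of \<open>\<phi>\<close> must be the
      value of \<open>\<phi>\<close> on the complementary path.\<close>
    define f where "f i k = \<phi> (path_basis (cycle_end s i k) (m - 1 - k))" for i k
    define x where "x = of_coords f"
    have x: "x \<in> carrier B" "\<lbrakk>i \<in> {1..s}; k < m\<rbrakk> \<Longrightarrow> co x i k = f i k" for i k
      unfolding x_def by (rule of_coords_closed co_of_coords; simp add: f_def)+
    have S: "{1..s} \<times> {..<m} = ?S" using m by auto
    have "\<phi> y = t (x \<otimes>\<^bsub>B\<^esub> y)" if y: "y \<in> carrier B" for y
    proof -
      define g where "g p = co y (fst p) (snd p) \<otimes>\<^bsub>K\<^esub> \<phi> (path_basis (fst p) (snd p))" for p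
      have g: "g p \<in> carrier K" if "p \<in> ?S" for p
        using that y less unfolding g_def by (auto intro!: co_closed simp del: atLeastAtMost_iff)
      have "\<phi> y = \<phi> (\<Oplus>\<^bsub>B\<^esub>p\<in>?S. co y (fst p) (snd p) \<odot>\<^bsub>B\<^esub> path_basis (fst p) (snd p))"
        using expand[OF y] unfolding S by simp
      also have "\<dots> = (\<Oplus>\<^bsub>K\<^esub>p\<in>?S. \<phi> (co y (fst p) (snd p) \<odot>\<^bsub>B\<^esub> path_basis (fst p) (snd p)))"
        by (rule additive_finsum[OF B.is_abelian_group K.is_abelian_group])
          (use \<phi> y less in \<open>auto intro!: smult_closed co_closed simp del: atLeastAtMost_iff\<close>)
      also have "\<dots> = finsum K g ?S"
        by (rule K.finsum_cong'[OF refl])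
          (use \<phi> g y less in \<open>auto simp: g_def co_closed\<close>)
      also have "\<dots> = (\<Oplus>\<^bsub>K\<^esub>p\<in>?S. g (?rev p))"
        by (rule K.finsum_reindex_bij[OF rev, symmetric]) (rule g)
      also have "\<dots> = t (x \<otimes>\<^bsub>B\<^esub> y)"
        unfolding t_mult[OF x(1) y]
        by (rule K.finsum_cong'[OF refl])
          (use x y end_in less in \<open>auto intro!: co_closed K.m_comm simp: f_def g_def simp del: atLeastAtMost_iff\<close>)
      finally show ?thesis .
    qed
    then show "\<phi> = \<theta> x"
      using \<phi>(2) unfolding \<theta>_def by (auto simp: fun_eq_iff extensional_def)
    show "x \<in> carrier B" by (rule x(1))
  qed
  have "\<theta> (a \<otimes>\<^bsub>B\<^esub> x \<otimes>\<^bsub>B\<^esub> b) = dual_lact B a (dual_ract B (\<theta> x) b)"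
    if "a \<in> carrier B" "x \<in> carrier B" "b \<in> carrier B" for a x b
  proof -
    \<comment> \<open>Cyclicity of \<open>t\<close> moves the left factor \<open>a\<close> to the
      far right, which is where the left action on functionals puts it.\<close>
    have "t (a \<otimes>\<^bsub>B\<^esub> x \<otimes>\<^bsub>B\<^esub> b \<otimes>\<^bsub>B\<^esub> c) = t (x \<otimes>\<^bsub>B\<^esub> (b \<otimes>\<^bsub>B\<^esub> (c \<otimes>\<^bsub>B\<^esub> a)))" if "c \<in> carrier B" for c
      using t_comm[of a "x \<otimes>\<^bsub>B\<^esub> b \<otimes>\<^bsub>B\<^esub> c"] that \<open>a \<in> carrier B\<close> \<open>x \<in> carrier B\<close> \<open>b \<in> carrier B\<close>
      by (simp add: B.m_assoc)
    then show ?thesis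
      using that by (auto simp: \<theta>_def dual_lact_def dual_ract_def fun_eq_iff)
  qed
  moreover have "bij_betw \<theta> (carrier B) (carrier (dual_space K B))"
    using inj surj \<theta>_dual unfolding bij_betw_def by blast
  ultimately show ?thesis using \<theta>_hom unfolding symmetric_algebra_def by blast
qed


section \<open>Quotients of modules and algebras\<close>

lemma (in abelian_group) minus_eq_zero_iff:
  "\<lbrakk>x \<in> carrier G; y \<in> carrier G\<rbrakk> \<Longrightarrow> x \<ominus> y = \<zero> \<longleftrightarrow> x = y"
  by (metis a_minus_def l_neg minus_equality minus_minus r_neg a_inv_closed)

lemma submodule_zero: "Module.submodule H R M \<Longrightarrow> \<zero>\<^bsub>M\<^esub> \<in> H"
  using subgroup.one_closed[OF Module.submodule.axioms(1)] by fastforce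

lemma (in module) abelian_subgroup_if_submodule: "Module.submodule W R M \<Longrightarrow> abelian_subgroup W M"
  by (simp add: M.abelian_group_axioms abelian_subgroup.intro additive_subgroup.intro
      abelian_subgroup_axioms.intro abelian_subgroupI3 Module.submodule.axioms(1))

context
  fixes K :: "('k, 'm) ring_scheme" and R :: "('k, 'a) module" and I :: "'a set"
  assumes module: "module K R" and submodule: "Module.submodule I K R"
begin

interpretation module K R by (rule module)
interpretation I: abelian_subgroup I R by (rule abelian_subgroup_if_submodule[OF submodule])

abbreviation "quot \<equiv> quotient_algebra R I"

lemma quotient_carrier: "carrier quot = (\<lambda>x. I +>\<^bsub>R\<^esub> x) ` carrier R"
  by (auto simp: quotient_algebra_def FactRing_def A_RCOSETS_def')

lemma quotient_coset_eq_iff: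
  assumes "x \<in> carrier R" "y \<in> carrier R"
  shows "I +>\<^bsub>R\<^esub> x = I +>\<^bsub>R\<^esub> y \<longleftrightarrow> x \<ominus>\<^bsub>R\<^esub> y \<in> I"
  using assms I.a_rcos_module[of y x] I.a_repr_independence' I.a_rcos_self
  unfolding a_minus_def by metis

lemma quotient_add:
  "\<lbrakk>x \<in> carrier R; y \<in> carrier R\<rbrakk> \<Longrightarrow> (I +>\<^bsub>R\<^esub> x) \<oplus>\<^bsub>quot\<^esub> (I +>\<^bsub>R\<^esub> y) = I +>\<^bsub>R\<^esub> (x \<oplus>\<^bsub>R\<^esub> y)"
  by (simp add: quotient_algebra_def FactRing_def I.a_rcos_sum)

lemma quotient_zero: "\<zero>\<^bsub>quot\<^esub> = I +>\<^bsub>R\<^esub> \<zero>\<^bsub>R\<^esub>"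
  by (simp add: quotient_algebra_def FactRing_def I.a_rcos_const)

text \<open>Scalars act on a coset by a union over all its representatives. These all contribute the
  same coset, because \<open>I\<close> is closed under scalars.\<close>

lemma quotient_smult:
  assumes c: "c \<in> carrier K" and x: "x \<in> carrier R"
  shows "c \<odot>\<^bsub>quot\<^esub> (I +>\<^bsub>R\<^esub> x) = I +>\<^bsub>R\<^esub> (c \<odot>\<^bsub>R\<^esub> x)"
proof -
  have "I +>\<^bsub>R\<^esub> (c \<odot>\<^bsub>R\<^esub> y) = I +>\<^bsub>R\<^esub> (c \<odot>\<^bsub>R\<^esub> x)" if "y \<in> I +>\<^bsub>R\<^esub> x" for y
  proof -
    have y: "y \<in> carrier R" using I.a_elemrcos_carrier[OF x that] .
    then have d: "y \<ominus>\<^bsub>R\<^esub> x \<in> I"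
      using that x I.a_rcos_module unfolding a_minus_def by blast
    have "c \<odot>\<^bsub>R\<^esub> y \<ominus>\<^bsub>R\<^esub> c \<odot>\<^bsub>R\<^esub> x = c \<odot>\<^bsub>R\<^esub> (y \<ominus>\<^bsub>R\<^esub> x)"
      using c x y by (simp add: a_minus_def smult_r_distr smult_r_minus)
    also have "\<dots> \<in> I" using c d by (rule Module.submodule.smult_closed[OF submodule])
    finally show ?thesis using quotient_coset_eq_iff c x y by simp
  qed
  then have "(\<Union>y\<in>I +>\<^bsub>R\<^esub> x. I +>\<^bsub>R\<^esub> (c \<odot>\<^bsub>R\<^esub> y)) = I +>\<^bsub>R\<^esub> (c \<odot>\<^bsub>R\<^esub> x)"
    using I.a_rcos_self[OF x] by blast
  then show ?thesis by (simp add: quotient_algebra_def)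
qed

text \<open>Here \<open>I\<close> is merely a submodule: the quotients of Peirce corners whose
  dimensions count arrows are vector spaces only.\<close>

lemma quotient_module: "module K quot"
proof (rule moduleI[OF R.is_cring])
  show "abelian_group quot"
  proof (rule abelian_groupI)
    show "\<exists>y\<in>carrier quot. y \<oplus>\<^bsub>quot\<^esub> x = \<zero>\<^bsub>quot\<^esub>" if x: "x \<in> carrier quot" for x
    proof -
      obtain a where "a \<in> carrier R" "x = I +>\<^bsub>R\<^esub> a" using x by (auto simp: quotient_carrier)
      then show ?thesis
        by (intro bexI[of _ "I +>\<^bsub>R\<^esub> (\<ominus>\<^bsub>R\<^esub> a)"])
          (auto simp: quotient_carrier quotient_zero quotient_add M.l_neg)
    qed
  qed (auto simp: quotient_carrier quotient_zero quotient_add M.a_ac)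
qed (auto simp: quotient_carrier quotient_add quotient_smult smult_l_distr smult_r_distr smult_assoc1)

end

context
  fixes K :: "('k, 'm) ring_scheme" and R :: "('k, 'a) module" and I :: "'a set"
  assumes algebra: "noncomm_algebra K R" and ideal: "ideal I R"
begin

interpretation noncomm_algebra K R by (rule algebra)
interpretation I: ideal I R by (rule ideal)

text \<open>A scalar \<open>c\<close> acts as left multiplication by \<open>c\<close> times the
  unit, and ideals absorb that.\<close>

lemma submodule_if_ideal: "Module.submodule I K R"
proof (rule submoduleI)
  fix c x assume c: "c \<in> carrier K" and x: "x \<in> I"
  then have "c \<odot>\<^bsub>R\<^esub> x = (c \<odot>\<^bsub>R\<^esub> \<one>\<^bsub>R\<^esub>) \<otimes>\<^bsub>R\<^esub> x" by (simp add: smult_mult_left I.a_Hcarr)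
  then show "c \<odot>\<^bsub>R\<^esub> x \<in> I" using c x I.I_l_closed[of x "c \<odot>\<^bsub>R\<^esub> \<one>\<^bsub>R\<^esub>"] by simp
qed (auto simp: I.a_subset I.zero_closed I.a_inv_closed I.a_closed)

lemmas quotient_ops =
  quotient_carrier[OF module_axioms submodule_if_ideal]
  quotient_zero[OF module_axioms submodule_if_ideal]
  quotient_add[OF module_axioms submodule_if_ideal]
  quotient_smult[OF module_axioms submodule_if_ideal]

lemma quotient_mult:
  "\<lbrakk>x \<in> carrier R; y \<in> carrier R\<rbrakk> \<Longrightarrow>
    (I +>\<^bsub>R\<^esub> x) \<otimes>\<^bsub>quotient_algebra R I\<^esub> (I +>\<^bsub>R\<^esub> y) = I +>\<^bsub>R\<^esub> (x \<otimes>\<^bsub>R\<^esub> y)"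
  by (simp add: quotient_algebra_def FactRing_def I.rcoset_mult_add)

lemma quotient_noncomm_algebra: "noncomm_algebra K (quotient_algebra R I)"
proof -
  have one: "\<one>\<^bsub>quotient_algebra R I\<^esub> = I +>\<^bsub>R\<^esub> \<one>\<^bsub>R\<^esub>"
    by (simp add: quotient_algebra_def FactRing_def)
  note ops = quotient_ops one quotient_mult
  have mod: "module K (quotient_algebra R I)"
    by (rule quotient_module[OF module_axioms submodule_if_ideal])
  then interpret Q: module K "quotient_algebra R I" .
  have ring: "ring (quotient_algebra R I)"
    by (rule ringI[OF Q.M.abelian_group_axioms monoidI]) (auto simp: ops B.m_assoc B.l_distr B.r_distr)
  show ?thesis
    by (rule noncomm_algebra.intro[OF K.field_axioms ring mod])
      (unfold_locales, auto simp: ops smult_mult_left smult_mult_right)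
qed

end


section \<open>The path algebra of the cyclic quiver\<close>

text \<open>Every arrow carries the number of its tail, so the arrow list of a path is the list of
  the vertices that it leaves.\<close>

definition cycle_path :: "nat \<Rightarrow> nat \<Rightarrow> nat \<Rightarrow> nat \<times> nat list" where
  "cycle_path s i k = (i, map (cycle_end s i) [0..<k])"

lemma cycle_path_sel [simp]:
  "fst (cycle_path s i k) = i" "length (snd (cycle_path s i k)) = k"
  by (simp_all add: cycle_path_def)

lemma cycle_path_eq_iff [simp]: "cycle_path s i k = cycle_path s j l \<longleftrightarrow> i = j \<and> k = l"
  by (metis cycle_path_sel)

lemma cycle_path_append:
  "snd (cycle_path s i k) @ snd (cycle_path s (cycle_end s i k) l) = snd (cycle_path s i (k + l))"
  by (auto simp: cycle_path_def intro!: nth_equalityI simp: nth_append)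

lemma cycle_path_Suc:
  "i \<in> {1..s} \<Longrightarrow> snd (cycle_path s i (Suc k)) = i # snd (cycle_path s (cycle_end s i 1) k)"
  using cycle_path_append[of s i 1 k] by (simp add: cycle_path_def[of s i "Suc 0"])

lemma cyclic_quiver_sel:
  "verts (cyclic_quiver s) = {1..s}" "arcs (cyclic_quiver s) = {1..s}" "tail (cyclic_quiver s) i = i"
  "i \<in> {1..s} \<Longrightarrow> head (cyclic_quiver s) i = cycle_end s i 1"
  by (auto simp: cyclic_quiver_def cycle_end_def)

text \<open>Each vertex has exactly one outgoing arrow, so a walk is determined by its start and its
  length.\<close>

lemma cas_cyclic_quiver_iff:
  assumes "u \<in> {1..s}"
  shows "set p \<subseteq> {1..s} \<and> pre_digraph.cas (cyclic_quiver s) u p v \<longleftrightarrow>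
    (u, p) = cycle_path s u (length p) \<and> v = cycle_end s u (length p)"
  using assms
proof (induction p arbitrary: u)
  case Nil
  then show ?case by (auto simp: pre_digraph.cas.simps cycle_path_def)
next
  case (Cons e p)
  have s: "s \<ge> 1" using Cons.prems by simp
  have IH: "set p \<subseteq> {1..s} \<and> pre_digraph.cas (cyclic_quiver s) (cycle_end s u 1) p v \<longleftrightarrow>
      (cycle_end s u 1, p) = cycle_path s (cycle_end s u 1) (length p) \<and>
      v = cycle_end s (cycle_end s u 1) (length p)"
    by (rule Cons.IH) (use s in simp)
  have eq: "(u, e # p) = cycle_path s u (Suc (length p)) \<longleftrightarrow>
      e = u \<and> (cycle_end s u 1, p) = cycle_path s (cycle_end s u 1) (length p)"
    using cycle_path_Suc[OF Cons.prems, of "length p"] by (simp add: prod_eq_iff)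
  show ?case
    using IH eq Cons.prems
    by (auto simp: pre_digraph.cas.simps cyclic_quiver_sel simp del: atLeastAtMost_iff)
qed

lemma quiver_paths_cyclic_quiver:
  "quiver_paths (cyclic_quiver s) = {cycle_path s i k |i k. i \<in> {1..s}}"
proof -
  have "(u, p) \<in> quiver_paths (cyclic_quiver s) \<longleftrightarrow> u \<in> {1..s} \<and> (u, p) = cycle_path s u (length p)" for u p
    using cas_cyclic_quiver_iff[of u s p]
    unfolding quiver_paths_def pre_digraph.awalk_def cyclic_quiver_sel by blast
  then show ?thesis
    by (auto simp del: atLeastAtMost_iff) (metis cycle_path_sel prod.collapse)+
qed

lemma cycle_path_in_quiver_paths [simp]:
  "cycle_path s i k \<in> quiver_paths (cyclic_quiver s) \<longleftrightarrow> i \<in> {1..s}"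
  by (auto simp: quiver_paths_cyclic_quiver)

lemma (in pre_digraph) awlast_eq_if_cas: "cas u p v \<Longrightarrow> awlast u p = v"
  by (induction p arbitrary: u) auto

lemma path_end_cycle_path:
  assumes "i \<in> {1..s}"
  shows "path_end (cyclic_quiver s) (cycle_path s i k) = cycle_end s i k"
proof -
  have "pre_digraph.cas (cyclic_quiver s) i (snd (cycle_path s i k)) (cycle_end s i k)"
    using cas_cyclic_quiver_iff[OF assms, of "snd (cycle_path s i k)"]
    by (metis cycle_path_sel prod.collapse)
  then show ?thesis
    unfolding path_end_def cycle_path_sel by (rule pre_digraph.awlast_eq_if_cas)
qed

lemma path_factorizations_cyclic_quiver:
  "path_factorizations (cyclic_quiver s) r =
    {(cycle_path s j l, cycle_path s (cycle_end s j l) l') |j l l'. j \<in> {1..s} \<and> r = cycle_path s j (l + l')}"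
    (is "?F = ?R")
proof
  show "?R \<subseteq> ?F"
  proof
    fix z assume "z \<in> ?R"
    then obtain j l l' where z: "z = (cycle_path s j l, cycle_path s (cycle_end s j l) l')"
      and j: "j \<in> {1..s}" and r: "r = cycle_path s j (l + l')" by blast
    have "(j, snd (cycle_path s j (l + l'))) = cycle_path s j (l + l')" by (simp add: prod_eq_iff)
    moreover have "cycle_end s j l \<in> {1..s}" using j by (intro cycle_end_in) simp
    ultimately show "z \<in> ?F"
      using j path_end_cycle_path[OF j, of l] unfolding z r path_factorizations_def
      by (simp add: cycle_path_append del: atLeastAtMost_iff)
  qed
  show "?F \<subseteq> ?R"
  proof
    fix z assume "z \<in> ?F"
    then obtain p q where z: "z = (p, q)"
      and p: "p \<in> quiver_paths (cyclic_quiver s)" and q: "q \<in> quiver_paths (cyclic_quiver s)"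
      and e: "path_end (cyclic_quiver s) p = fst q" and r: "(fst p, snd p @ snd q) = r"
      unfolding path_factorizations_def by blast
    obtain j l where p: "p = cycle_path s j l" "j \<in> {1..s}"
      using p unfolding quiver_paths_cyclic_quiver by blast
    obtain j' l' where q: "q = cycle_path s j' l'"
      using q unfolding quiver_paths_cyclic_quiver by blast
    have j': "j' = cycle_end s j l" using e path_end_cycle_path[OF p(2), of l] unfolding p q by simp
    have "r = cycle_path s j (l + l')"
      using r unfolding p q j' cycle_path_append by (auto simp: prod_eq_iff)
    then show "z \<in> ?R" using p(2) unfolding z p(1) q j' by blast
  qed
qed

text \<open>There is one factorization for each position at which the path can be cut; this turns
  the path algebra product into a convolution.\<close>

lemma path_factorizations_cycle_path:
  assumes "i \<in> {1..s}"
  shows "path_factorizations (cyclic_quiver s) (cycle_path s i k)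
    = (\<lambda>l. (cycle_path s i l, cycle_path s (cycle_end s i l) (k - l))) ` {..k}"
proof (intro equalityI subsetI)
  fix z assume "z \<in> (\<lambda>l. (cycle_path s i l, cycle_path s (cycle_end s i l) (k - l))) ` {..k}"
  then obtain l where "l \<le> k" "z = (cycle_path s i l, cycle_path s (cycle_end s i l) (k - l))" by auto
  then show "z \<in> path_factorizations (cyclic_quiver s) (cycle_path s i k)"
    unfolding path_factorizations_cyclic_quiver using assms
    by (intro CollectI exI[of _ i] exI[of _ l] exI[of _ "k - l"]) simp
qed (auto simp: path_factorizations_cyclic_quiver)

lemma path_factorizations_empty:
  "r \<notin> quiver_paths (cyclic_quiver s) \<Longrightarrow> path_factorizations (cyclic_quiver s) r = {}"
  by (auto simp: path_factorizations_cyclic_quiver quiver_paths_cyclic_quiver)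

text \<open>Both sides sum over the ways to cut a path of length \<open>k\<close> into three pieces;
  the pairs of cut positions \<open>l \<le> t\<close> are reindexed by the lengths \<open>l\<close>
  and \<open>t - l\<close> of the first two pieces.\<close>

lemma (in cring) convolution_assoc:
  assumes s: "s \<ge> 1" and i: "i \<in> {1..s}"
    and F: "\<And>i k. F i k \<in> carrier R" and G: "\<And>i k. G i k \<in> carrier R" and H: "\<And>i k. H i k \<in> carrier R"
  shows "(\<Oplus>t\<in>{..k}. (\<Oplus>l\<in>{..t}. F i l \<otimes> G (cycle_end s i l) (t - l)) \<otimes> H (cycle_end s i t) (k - t))
    = (\<Oplus>l\<in>{..k}. F i l \<otimes> (\<Oplus>j\<in>{..k - l}. G (cycle_end s i l) j \<otimes> H (cycle_end s (cycle_end s i l) j) (k - l - j)))"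
    (is "?L = ?R")
proof -
  define X where "X p = (case p of (l, j) \<Rightarrow>
    F i l \<otimes> (G (cycle_end s i l) j \<otimes> H (cycle_end s i (l + j)) (k - l - j)))" for p
  have X: "X p \<in> carrier R" for p by (auto simp: X_def F G H split: prod.splits)
  let ?S = "Sigma {..k} (\<lambda>t. {..t})" and ?T = "Sigma {..k} (\<lambda>l. {..k - l})"
  have bij: "bij_betw (\<lambda>(t, l). (l, t - l)) ?S ?T"
    by (rule bij_betw_byWitness[where f' = "\<lambda>(l, j). (l + j, l)"]) auto
  have "?L = (\<Oplus>t\<in>{..k}. \<Oplus>l\<in>{..t}. X (l, t - l))"
  proof (rule finsum_cong'[OF refl])
    fix t assume t: "t \<in> {..k}"
    have "(\<Oplus>l\<in>{..t}. F i l \<otimes> G (cycle_end s i l) (t - l)) \<otimes> H (cycle_end s i t) (k - t)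
      = (\<Oplus>l\<in>{..t}. F i l \<otimes> G (cycle_end s i l) (t - l) \<otimes> H (cycle_end s i t) (k - t))"
      by (rule finsum_ldistr) (auto simp: F G H)
    also have "\<dots> = (\<Oplus>l\<in>{..t}. X (l, t - l))"
      by (rule finsum_cong'[OF refl]) (use X in \<open>auto simp: X_def F G H m_assoc\<close>)
    finally show "(\<Oplus>l\<in>{..t}. F i l \<otimes> G (cycle_end s i l) (t - l)) \<otimes> H (cycle_end s i t) (k - t)
      = (\<Oplus>l\<in>{..t}. X (l, t - l))" .
  qed (use X in auto)
  also have "\<dots> = (\<Oplus>p\<in>?S. X (snd p, fst p - snd p))"
    by (rule finsum_Sigma) (use X in auto)
  also have "\<dots> = (\<Oplus>p\<in>?S. X ((\<lambda>(t, l). (l, t - l)) p))" by (simp add: case_prod_unfold)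
  also have "\<dots> = finsum R X ?T" by (rule finsum_reindex_bij[OF bij X])
  also have "\<dots> = (\<Oplus>l\<in>{..k}. \<Oplus>j\<in>{..k - l}. X (l, j))"
    using finsum_Sigma[of "{..k}" "\<lambda>l. {..k - l}" "\<lambda>l j. X (l, j)"] X by simp
  also have "\<dots> = ?R"
  proof (rule finsum_cong'[OF refl])
    fix l
    show "(\<Oplus>j\<in>{..k - l}. X (l, j))
      = F i l \<otimes> (\<Oplus>j\<in>{..k - l}. G (cycle_end s i l) j \<otimes> H (cycle_end s (cycle_end s i l) j) (k - l - j))"
      unfolding X_def prod.case cycle_end_cycle_end
      by (rule finsum_rdistr[symmetric]) (auto simp: F G H)
  qed (auto simp: F G H)
  finally show ?thesis .
qed

section \<open>The path algebra of the cyclic quiver is an algebra\<close>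

locale cyclic_path_algebra = K: field K for K :: "('k, 'm) ring_scheme" +
  fixes s :: nat
  assumes s_pos: "s \<ge> 1"
begin

abbreviation "P \<equiv> path_algebra K (cyclic_quiver s)"

lemma carrier_path_algebra:
  "f \<in> carrier P \<longleftrightarrow> (\<forall>p. f p \<in> carrier K) \<and> finite {p. f p \<noteq> \<zero>\<^bsub>K\<^esub>} \<and>
    (\<forall>p. p \<notin> quiver_paths (cyclic_quiver s) \<longrightarrow> f p = \<zero>\<^bsub>K\<^esub>)"
  by (auto simp: path_algebra_def)

lemma path_algebra_memI:
  "\<lbrakk>\<And>p. f p \<in> carrier K; finite {p. f p \<noteq> \<zero>\<^bsub>K\<^esub>};
    \<And>p. p \<notin> quiver_paths (cyclic_quiver s) \<Longrightarrow> f p = \<zero>\<^bsub>K\<^esub>\<rbrakk> \<Longrightarrow> f \<in> carrier P"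
  by (simp add: carrier_path_algebra)

lemma path_algebra_finite: "f \<in> carrier P \<Longrightarrow> finite {p. f p \<noteq> \<zero>\<^bsub>K\<^esub>}"
  by (simp add: carrier_path_algebra)

lemma path_algebra_outside:
  "\<lbrakk>f \<in> carrier P; p \<notin> quiver_paths (cyclic_quiver s)\<rbrakk> \<Longrightarrow> f p = \<zero>\<^bsub>K\<^esub>"
  unfolding carrier_path_algebra by blast

lemma path_algebra_closed [simp]: "f \<in> carrier P \<Longrightarrow> f p \<in> carrier K"
  unfolding carrier_path_algebra by blast

lemma path_algebra_eqI:
  assumes "f \<in> carrier P" "g \<in> carrier P"
    and "\<And>i k. i \<in> {1..s} \<Longrightarrow> f (cycle_path s i k) = g (cycle_path s i k)"
  shows "f = g"
proof
  fix p
  show "f p = g p"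
  proof (cases "p \<in> quiver_paths (cyclic_quiver s)")
    case True
    then show ?thesis unfolding quiver_paths_cyclic_quiver using assms(3) by blast
  next
    case False
    then show ?thesis using assms(1,2) by (simp add: path_algebra_outside)
  qed
qed

lemma path_algebra_add: "(f \<oplus>\<^bsub>P\<^esub> g) p = f p \<oplus>\<^bsub>K\<^esub> g p"
  and path_algebra_smult: "(c \<odot>\<^bsub>P\<^esub> f) p = c \<otimes>\<^bsub>K\<^esub> f p"
  and path_algebra_zero: "\<zero>\<^bsub>P\<^esub> p = \<zero>\<^bsub>K\<^esub>"
  by (simp_all add: path_algebra_def)

lemma path_algebra_one:
  "i \<in> {1..s} \<Longrightarrow> \<one>\<^bsub>P\<^esub> (cycle_path s i k) = (if k = 0 then \<one>\<^bsub>K\<^esub> else \<zero>\<^bsub>K\<^esub>)"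
  by (simp add: path_algebra_def cycle_path_def cyclic_quiver_sel)

lemma path_algebra_mult:
  assumes "f \<in> carrier P" "g \<in> carrier P" "i \<in> {1..s}"
  shows "(f \<otimes>\<^bsub>P\<^esub> g) (cycle_path s i k)
    = (\<Oplus>\<^bsub>K\<^esub>l\<in>{..k}. f (cycle_path s i l) \<otimes>\<^bsub>K\<^esub> g (cycle_path s (cycle_end s i l) (k - l)))"
proof -
  have inj: "inj_on (\<lambda>l. (cycle_path s i l, cycle_path s (cycle_end s i l) (k - l))) {..k}"
    by (auto simp: inj_on_def)
  have "(f \<otimes>\<^bsub>P\<^esub> g) (cycle_path s i k) = finsum K (\<lambda>(p, q). f p \<otimes>\<^bsub>K\<^esub> g q)
      ((\<lambda>l. (cycle_path s i l, cycle_path s (cycle_end s i l) (k - l))) ` {..k})"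
    using assms(3) by (simp only: path_algebra_def monoid.select_convs path_factorizations_cycle_path)
  then show ?thesis
    using assms by (simp add: K.finsum_reindex[OF _ inj] Pi_iff)
qed

text \<open>Finite support is the point: the support of a product lies among the concatenations of
  paths from the two supports.\<close>

lemma path_algebra_mult_closed:
  assumes f: "f \<in> carrier P" and g: "g \<in> carrier P"
  shows "f \<otimes>\<^bsub>P\<^esub> g \<in> carrier P"
proof -
  have val: "(f \<otimes>\<^bsub>P\<^esub> g) r = finsum K (\<lambda>(p, q). f p \<otimes>\<^bsub>K\<^esub> g q) (path_factorizations (cyclic_quiver s) r)" for r
    by (simp add: path_algebra_def)
  let ?F = "{p. f p \<noteq> \<zero>\<^bsub>K\<^esub>}" and ?G = "{p. g p \<noteq> \<zero>\<^bsub>K\<^esub>}"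
  have "r \<in> (\<lambda>(p, q). (fst p, snd p @ snd q)) ` (?F \<times> ?G)" if r: "(f \<otimes>\<^bsub>P\<^esub> g) r \<noteq> \<zero>\<^bsub>K\<^esub>" for r
  proof (rule ccontr)
    assume n: "r \<notin> (\<lambda>(p, q). (fst p, snd p @ snd q)) ` (?F \<times> ?G)"
    have "(\<lambda>(p, q). f p \<otimes>\<^bsub>K\<^esub> g q) z = \<zero>\<^bsub>K\<^esub>" if zr: "z \<in> path_factorizations (cyclic_quiver s) r" for z
    proof -
      obtain p q where z: "z = (p, q)" "(fst p, snd p @ snd q) = r"
        using zr unfolding path_factorizations_def by blast
      then have "f p = \<zero>\<^bsub>K\<^esub> \<or> g q = \<zero>\<^bsub>K\<^esub>" using n by force
      then show ?thesis using f g z by auto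
    qed
    then have "(f \<otimes>\<^bsub>P\<^esub> g) r = \<zero>\<^bsub>K\<^esub>" unfolding val by (rule K.add.finprod_one_eqI)
    with r show False by contradiction
  qed
  then have "{r. (f \<otimes>\<^bsub>P\<^esub> g) r \<noteq> \<zero>\<^bsub>K\<^esub>} \<subseteq> (\<lambda>(p, q). (fst p, snd p @ snd q)) ` (?F \<times> ?G)"
    by blast
  moreover have "finite ((\<lambda>(p, q). (fst p, snd p @ snd q)) ` (?F \<times> ?G))"
    using path_algebra_finite[OF f] path_algebra_finite[OF g] by (intro finite_imageI finite_cartesian_product)
  ultimately have "finite {r. (f \<otimes>\<^bsub>P\<^esub> g) r \<noteq> \<zero>\<^bsub>K\<^esub>}" by (rule finite_subset)
  moreover have "(f \<otimes>\<^bsub>P\<^esub> g) r \<in> carrier K" for r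
    unfolding val using f g by (intro K.finsum_closed) auto
  moreover have "(f \<otimes>\<^bsub>P\<^esub> g) r = \<zero>\<^bsub>K\<^esub>" if "r \<notin> quiver_paths (cyclic_quiver s)" for r
    unfolding val path_factorizations_empty[OF that] by simp
  ultimately show ?thesis by (intro path_algebra_memI)
qed

lemma path_algebra_one_closed: "\<one>\<^bsub>P\<^esub> \<in> carrier P"
proof -
  have "{p. \<one>\<^bsub>P\<^esub> p \<noteq> \<zero>\<^bsub>K\<^esub>} \<subseteq> {1..s} \<times> {[]}"
    by (auto simp: path_algebra_def cyclic_quiver_sel split: if_splits)
  then have "finite {p. \<one>\<^bsub>P\<^esub> p \<noteq> \<zero>\<^bsub>K\<^esub>}" by (rule finite_subset) simp
  moreover have "\<one>\<^bsub>P\<^esub> p = \<zero>\<^bsub>K\<^esub>" if "p \<notin> quiver_paths (cyclic_quiver s)" for p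
    using that cycle_path_in_quiver_paths[of s "fst p" 0]
    by (auto simp: path_algebra_def cyclic_quiver_sel cycle_path_def split: prod.splits)
  moreover have "\<one>\<^bsub>P\<^esub> p \<in> carrier K" for p by (simp add: path_algebra_def split: prod.splits)
  ultimately show ?thesis by (intro path_algebra_memI)
qed

lemma path_algebra_smult_closed:
  assumes c: "c \<in> carrier K" and f: "f \<in> carrier P"
  shows "c \<odot>\<^bsub>P\<^esub> f \<in> carrier P"
proof -
  have "{p. (c \<odot>\<^bsub>P\<^esub> f) p \<noteq> \<zero>\<^bsub>K\<^esub>} \<subseteq> {p. f p \<noteq> \<zero>\<^bsub>K\<^esub>}"
    using c by (auto simp: path_algebra_smult)
  then have "finite {p. (c \<odot>\<^bsub>P\<^esub> f) p \<noteq> \<zero>\<^bsub>K\<^esub>}"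
    by (rule finite_subset) (rule path_algebra_finite[OF f])
  then show ?thesis
    by (intro path_algebra_memI) (use c f in \<open>simp_all add: path_algebra_smult path_algebra_outside\<close>)
qed

lemma path_algebra_add_closed:
  assumes f: "f \<in> carrier P" and g: "g \<in> carrier P"
  shows "f \<oplus>\<^bsub>P\<^esub> g \<in> carrier P"
proof -
  have "{p. (f \<oplus>\<^bsub>P\<^esub> g) p \<noteq> \<zero>\<^bsub>K\<^esub>} \<subseteq> {p. f p \<noteq> \<zero>\<^bsub>K\<^esub>} \<union> {p. g p \<noteq> \<zero>\<^bsub>K\<^esub>}"
    by (auto simp: path_algebra_add)
  then have "finite {p. (f \<oplus>\<^bsub>P\<^esub> g) p \<noteq> \<zero>\<^bsub>K\<^esub>}"
    by (rule finite_subset) (use path_algebra_finite[OF f] path_algebra_finite[OF g] in simp)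
  then show ?thesis
    by (intro path_algebra_memI) (use f g in \<open>simp_all add: path_algebra_add path_algebra_outside\<close>)
qed

lemma path_algebra_noncomm_algebra: "noncomm_algebra K P"
proof -
  have zero: "\<zero>\<^bsub>P\<^esub> \<in> carrier P" by (intro path_algebra_memI) (simp_all add: path_algebra_zero)
  note closed = path_algebra_mult_closed path_algebra_one_closed path_algebra_smult_closed
    path_algebra_add_closed zero
  note ops = path_algebra_add path_algebra_smult path_algebra_zero
  have end_in: "cycle_end s i k \<in> {1..s}" for i k using s_pos by simp
  have ab: "abelian_group P"
  proof (rule abelian_groupI)
    fix f assume f: "f \<in> carrier P"
    have "{p. \<ominus>\<^bsub>K\<^esub> f p \<noteq> \<zero>\<^bsub>K\<^esub>} \<subseteq> {p. f p \<noteq> \<zero>\<^bsub>K\<^esub>}" by auto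
    then have "finite {p. \<ominus>\<^bsub>K\<^esub> f p \<noteq> \<zero>\<^bsub>K\<^esub>}"
      by (rule finite_subset) (rule path_algebra_finite[OF f])
    then have "(\<lambda>p. \<ominus>\<^bsub>K\<^esub> f p) \<in> carrier P"
      by (intro path_algebra_memI) (use f in \<open>simp_all add: path_algebra_outside\<close>)
    then show "\<exists>g\<in>carrier P. g \<oplus>\<^bsub>P\<^esub> f = \<zero>\<^bsub>P\<^esub>"
      using f by (intro bexI) (auto simp: fun_eq_iff ops K.l_neg)
  qed (auto simp: closed ops K.a_ac fun_eq_iff)
  have mon: "monoid P"
  proof (rule monoidI)
    fix f g h assume fgh: "f \<in> carrier P" "g \<in> carrier P" "h \<in> carrier P"
    show "f \<otimes>\<^bsub>P\<^esub> g \<otimes>\<^bsub>P\<^esub> h = f \<otimes>\<^bsub>P\<^esub> (g \<otimes>\<^bsub>P\<^esub> h)"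
    proof (rule path_algebra_eqI)
      fix i k assume i: "i \<in> {1..s}"
      show "(f \<otimes>\<^bsub>P\<^esub> g \<otimes>\<^bsub>P\<^esub> h) (cycle_path s i k) = (f \<otimes>\<^bsub>P\<^esub> (g \<otimes>\<^bsub>P\<^esub> h)) (cycle_path s i k)"
        using K.convolution_assoc[OF s_pos i, of "\<lambda>i k. f (cycle_path s i k)"
            "\<lambda>i k. g (cycle_path s i k)" "\<lambda>i k. h (cycle_path s i k)" k] fgh
        by (simp only: path_algebra_mult closed i end_in path_algebra_closed)
    qed (use fgh closed in auto)
  next
    fix f assume f: "f \<in> carrier P"
    show "\<one>\<^bsub>P\<^esub> \<otimes>\<^bsub>P\<^esub> f = f"
    proof (rule path_algebra_eqI)
      fix i k assume i: "i \<in> {1..s}"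
      have "(\<one>\<^bsub>P\<^esub> \<otimes>\<^bsub>P\<^esub> f) (cycle_path s i k) = (\<Oplus>\<^bsub>K\<^esub>l\<in>{..k}.
          \<one>\<^bsub>P\<^esub> (cycle_path s i l) \<otimes>\<^bsub>K\<^esub> f (cycle_path s (cycle_end s i l) (k - l)))"
        by (rule path_algebra_mult) (use f i closed in auto)
      also have "\<dots> = \<one>\<^bsub>P\<^esub> (cycle_path s i 0) \<otimes>\<^bsub>K\<^esub> f (cycle_path s (cycle_end s i 0) (k - 0))"
        by (rule K.finsum_single) (use f i closed path_algebra_one[OF i] in auto)
      also have "\<dots> = f (cycle_path s i k)"
        using f i by (simp only: path_algebra_one cycle_end_0) simp
      finally show "(\<one>\<^bsub>P\<^esub> \<otimes>\<^bsub>P\<^esub> f) (cycle_path s i k) = f (cycle_path s i k)" .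
    qed (use f closed in auto)
    show "f \<otimes>\<^bsub>P\<^esub> \<one>\<^bsub>P\<^esub> = f"
    proof (rule path_algebra_eqI)
      fix i k assume i: "i \<in> {1..s}"
      have "(f \<otimes>\<^bsub>P\<^esub> \<one>\<^bsub>P\<^esub>) (cycle_path s i k) = (\<Oplus>\<^bsub>K\<^esub>l\<in>{..k}.
          f (cycle_path s i l) \<otimes>\<^bsub>K\<^esub> \<one>\<^bsub>P\<^esub> (cycle_path s (cycle_end s i l) (k - l)))"
        by (rule path_algebra_mult) (use f i closed in auto)
      also have "\<dots> = f (cycle_path s i k) \<otimes>\<^bsub>K\<^esub> \<one>\<^bsub>P\<^esub> (cycle_path s (cycle_end s i k) (k - k))"
        by (rule K.finsum_single) (use f i closed path_algebra_one[OF end_in] in auto)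
      also have "\<dots> = f (cycle_path s i k)"
        using f by (simp only: path_algebra_one[OF end_in]) simp
      finally show "(f \<otimes>\<^bsub>P\<^esub> \<one>\<^bsub>P\<^esub>) (cycle_path s i k) = f (cycle_path s i k)" .
    qed (use f closed in auto)
  qed (use closed in auto)
  have distr: "(f \<oplus>\<^bsub>P\<^esub> g) \<otimes>\<^bsub>P\<^esub> h = f \<otimes>\<^bsub>P\<^esub> h \<oplus>\<^bsub>P\<^esub> g \<otimes>\<^bsub>P\<^esub> h"
    "h \<otimes>\<^bsub>P\<^esub> (f \<oplus>\<^bsub>P\<^esub> g) = h \<otimes>\<^bsub>P\<^esub> f \<oplus>\<^bsub>P\<^esub> h \<otimes>\<^bsub>P\<^esub> g"
    if "f \<in> carrier P" "g \<in> carrier P" "h \<in> carrier P" for f g h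
    using that
    by (auto intro!: path_algebra_eqI K.finsum_cong' simp: closed path_algebra_mult ops K.l_distr K.r_distr
        K.finsum_addf[symmetric] Pi_iff simp del: K.finsum_addf atLeastAtMost_iff)
  have ring: "ring P" by (rule ringI[OF ab mon]) (auto simp: distr)
  have mod: "module K P"
    by (rule moduleI[OF K.is_cring ab])
      (auto simp: closed fun_eq_iff ops K.l_distr K.r_distr K.m_assoc)
  have assoc: "(c \<odot>\<^bsub>P\<^esub> f) \<otimes>\<^bsub>P\<^esub> g = c \<odot>\<^bsub>P\<^esub> (f \<otimes>\<^bsub>P\<^esub> g)" "f \<otimes>\<^bsub>P\<^esub> (c \<odot>\<^bsub>P\<^esub> g) = c \<odot>\<^bsub>P\<^esub> (f \<otimes>\<^bsub>P\<^esub> g)"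
    if "c \<in> carrier K" "f \<in> carrier P" "g \<in> carrier P" for c f g
    using that
    by (auto intro!: path_algebra_eqI K.finsum_cong' simp: closed path_algebra_mult ops K.finsum_rdistr
        K.m_assoc K.m_lcomm Pi_iff simp del: atLeastAtMost_iff)
  show ?thesis
    by (rule noncomm_algebra.intro[OF K.field_axioms ring mod]) (unfold_locales, auto simp: assoc)
qed

end

lemma (in ideal) finsum_closed_ideal:
  "(\<And>a. a \<in> S \<Longrightarrow> f a \<in> I) \<Longrightarrow> finsum R f S \<in> I"
proof (induction S rule: infinite_finite_induct)
  case (insert x F)
  then show ?case
    by (subst finsum_insert) (auto intro!: a_closed simp: a_Hcarr)
qed (auto simp: zero_closed)

section \<open>Powers of the arrow ideal and coordinates on the truncated path algebra\<close>

context cyclic_path_algebra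
begin

sublocale P: noncomm_algebra K P
  by (rule path_algebra_noncomm_algebra)

text \<open>An explicit form of the \<open>m\<close>-th power of the arrow ideal, in which
  membership is tested coefficient by coefficient.\<close>

definition deep :: "nat \<Rightarrow> (nat \<times> nat list \<Rightarrow> 'k) set" where
  "deep m = {f \<in> carrier P. \<forall>i\<in>{1..s}. \<forall>k<m. f (cycle_path s i k) = \<zero>\<^bsub>K\<^esub>}"

lemma path_algebra_minus:
  assumes "f \<in> carrier P" "g \<in> carrier P"
  shows "(f \<ominus>\<^bsub>P\<^esub> g) p = f p \<ominus>\<^bsub>K\<^esub> g p"
proof -
  have "(f \<ominus>\<^bsub>P\<^esub> g) p \<oplus>\<^bsub>K\<^esub> g p = f p"
    using assms path_algebra_add[of "f \<ominus>\<^bsub>P\<^esub> g" g p] by (simp add: P.B.minus_eq P.B.a_assoc P.B.l_neg)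
  then show ?thesis
    using assms by (metis K.add.inv_solve_right K.minus_eq P.B.minus_closed path_algebra_closed)
qed

lemma path_algebra_finsum:
  "(\<And>a. a \<in> S \<Longrightarrow> F a \<in> carrier P) \<Longrightarrow> finsum P F S p = (\<Oplus>\<^bsub>K\<^esub>a\<in>S. F a p)"
  by (rule additive_finsum[OF P.B.is_abelian_group K.is_abelian_group, of "\<lambda>f. f p"])
    (auto simp: path_algebra_add)

lemma deep_ideal: "ideal (deep m) P"
proof (rule idealI[OF P.B.ring_axioms])
  have end_in: "cycle_end s i k \<in> {1..s}" for i k using s_pos by simp
  show "subgroup (deep m) (add_monoid P)"
  proof (rule P.B.add.subgroupI)
    show "\<ominus>\<^bsub>P\<^esub> f \<in> deep m" if "f \<in> deep m" for f
      using that path_algebra_minus[of "\<zero>\<^bsub>P\<^esub>" f]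
      by (auto simp: deep_def P.B.minus_eq path_algebra_zero K.minus_eq)
    have "\<zero>\<^bsub>P\<^esub> \<in> deep m" by (simp add: deep_def path_algebra_zero)
    then show "deep m \<noteq> {}" by blast
  qed (auto simp: deep_def path_algebra_add)
  fix f g assume f: "f \<in> deep m" and g: "g \<in> carrier P"
  then have fP: "f \<in> carrier P" by (simp add: deep_def)
  have f0: "f (cycle_path s i k) = \<zero>\<^bsub>K\<^esub>" if "i \<in> {1..s}" "k < m" for i k
    using f that by (simp add: deep_def)
  have "(g \<otimes>\<^bsub>P\<^esub> f) (cycle_path s i k) = \<zero>\<^bsub>K\<^esub>" if "i \<in> {1..s}" "k < m" for i k
    unfolding path_algebra_mult[OF g fP that(1)]
    by (rule K.add.finprod_one_eqI) (use that g f0[OF end_in] in auto)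
  then show "g \<otimes>\<^bsub>P\<^esub> f \<in> deep m" using fP g by (simp add: deep_def)
  have "(f \<otimes>\<^bsub>P\<^esub> g) (cycle_path s i k) = \<zero>\<^bsub>K\<^esub>" if "i \<in> {1..s}" "k < m" for i k
    unfolding path_algebra_mult[OF fP g that(1)]
    by (rule K.add.finprod_one_eqI) (use that g f0[OF that(1)] in auto)
  then show "f \<otimes>\<^bsub>P\<^esub> g \<in> deep m" using fP g by (simp add: deep_def)
qed

lemma path_elem_closed: "i \<in> {1..s} \<Longrightarrow> path_elem K (cycle_path s i k) \<in> carrier P"
  by (intro path_algebra_memI) (auto simp: path_elem_def)

lemma path_elem_mult:
  assumes "i \<in> {1..s}" "j \<in> {1..s}" "g \<in> carrier P"
  shows "(path_elem K (cycle_path s i m) \<otimes>\<^bsub>P\<^esub> g) (cycle_path s j k)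
    = (if j = i \<and> m \<le> k then g (cycle_path s (cycle_end s i m) (k - m)) else \<zero>\<^bsub>K\<^esub>)"
    (is "?L = _")
proof -
  have L: "?L = (\<Oplus>\<^bsub>K\<^esub>l\<in>{..k}. path_elem K (cycle_path s i m) (cycle_path s j l)
      \<otimes>\<^bsub>K\<^esub> g (cycle_path s (cycle_end s j l) (k - l)))"
    by (rule path_algebra_mult[OF path_elem_closed[OF assms(1)] assms(3,2)])
  show ?thesis
  proof (cases "j = i \<and> m \<le> k")
    case True
    have "?L = path_elem K (cycle_path s i m) (cycle_path s j m)
      \<otimes>\<^bsub>K\<^esub> g (cycle_path s (cycle_end s j m) (k - m))"
      unfolding L by (rule K.finsum_single) (use True assms in \<open>auto simp: path_elem_def\<close>)
    then show ?thesis using True assms by (simp add: path_elem_def)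
  next
    case False
    have "?L = \<zero>\<^bsub>K\<^esub>"
      unfolding L by (rule K.add.finprod_one_eqI) (use False assms in \<open>auto simp: path_elem_def\<close>)
    with False show ?thesis by auto
  qed
qed

text \<open>
  An element without coefficients on short paths is the sum over the vertices \<open>i\<close> of the path of
  length \<open>m\<close> from \<open>i\<close> times the element obtained by removing that path.
\<close>

lemma arrow_ideal_power_eq_deep: "arrow_ideal_power K (cyclic_quiver s) m = deep m"
proof
  let ?S = "path_elem K ` {p \<in> quiver_paths (cyclic_quiver s). length (snd p) = m}"
  let ?I = "arrow_ideal_power K (cyclic_quiver s) m"
  have S: "?S = (\<lambda>i. path_elem K (cycle_path s i m)) ` {1..s}"
    unfolding quiver_paths_cyclic_quiver by auto
  have SP: "?S \<subseteq> carrier P" unfolding S using path_elem_closed by blast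
  have "?S \<subseteq> deep m"
    unfolding S using path_elem_closed by (auto simp: deep_def path_elem_def)
  then show "?I \<subseteq> deep m"
    unfolding arrow_ideal_power_def by (intro P.B.genideal_minimal[OF deep_ideal])
  have ideal: "ideal ?I P" unfolding arrow_ideal_power_def by (rule P.B.genideal_ideal[OF SP])
  have SI: "?S \<subseteq> ?I" unfolding arrow_ideal_power_def by (rule P.B.genideal_self[OF SP])
  show "deep m \<subseteq> ?I"
  proof
    fix f assume "f \<in> deep m"
    then have f: "f \<in> carrier P" and f0: "\<And>i k. \<lbrakk>i \<in> {1..s}; k < m\<rbrakk> \<Longrightarrow> f (cycle_path s i k) = \<zero>\<^bsub>K\<^esub>"
      by (auto simp: deep_def)
    define g where "g i p = (if p \<in> quiver_paths (cyclic_quiver s) \<and> fst p = cycle_end s i m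
      then f (cycle_path s i (m + length (snd p))) else \<zero>\<^bsub>K\<^esub>)" for i p
    have g: "g i \<in> carrier P" for i
    proof -
      \<comment> \<open>Distinct remainders come from distinct paths in the finite support of
        \<open>f\<close>, so \<open>g i\<close> has finite support as well.\<close>
      have "inj (\<lambda>r. cycle_path s i (m + r))" by (auto simp: inj_on_def)
      then have "finite ((\<lambda>r. cycle_path s i (m + r)) -` {p. f p \<noteq> \<zero>\<^bsub>K\<^esub>})"
        by (intro finite_vimageI path_algebra_finite[OF f])
      moreover have "{p. g i p \<noteq> \<zero>\<^bsub>K\<^esub>} \<subseteq> (\<lambda>r. cycle_path s (cycle_end s i m) r) `
          ((\<lambda>r. cycle_path s i (m + r)) -` {p. f p \<noteq> \<zero>\<^bsub>K\<^esub>})"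
        unfolding g_def quiver_paths_cyclic_quiver by (auto split: if_splits)
      ultimately have "finite {p. g i p \<noteq> \<zero>\<^bsub>K\<^esub>}" by (meson finite_imageI finite_subset)
      then show ?thesis by (intro path_algebra_memI) (use f in \<open>auto simp: g_def\<close>)
    qed
    define F where "F i = path_elem K (cycle_path s i m) \<otimes>\<^bsub>P\<^esub> g i" for i
    have FP: "F i \<in> carrier P" if "i \<in> {1..s}" for i
      unfolding F_def using g path_elem_closed[OF that] by (intro P.B.m_closed)
    have "f = finsum P F {1..s}"
    proof (rule path_algebra_eqI[OF f])
      show "finsum P F {1..s} \<in> carrier P" using FP by (intro P.B.finsum_closed) blast
      fix j k assume j: "j \<in> {1..s}"
      have "finsum P F {1..s} (cycle_path s j k) = (\<Oplus>\<^bsub>K\<^esub>i\<in>{1..s}. F i (cycle_path s j k))"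
        by (rule path_algebra_finsum) (rule FP)
      also have "\<dots> = F j (cycle_path s j k)"
        by (rule K.finsum_single) (use j FP g in \<open>auto simp: F_def path_elem_mult\<close>)
      also have "\<dots> = f (cycle_path s j k)"
        using j f0[OF j, of k] g s_pos unfolding F_def path_elem_mult[OF j j g]
        by (auto simp: g_def)
      finally show "f (cycle_path s j k) = finsum P F {1..s} (cycle_path s j k)" by simp
    qed
    moreover have "F i \<in> ?I" if "i \<in> {1..s}" for i
      unfolding F_def using SI that g unfolding S by (intro ideal.I_r_closed[OF ideal]) auto
    ultimately show "f \<in> ?I" using ideal.finsum_closed_ideal[OF ideal, of "{1..s}" F] by simp
  qed
qed

text \<open>The truncation length does not occur, so the same function gives coordinates on the
  quotients for \<open>n\<close> and for \<open>2 * n\<close>.\<close>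

definition coset_coord :: "(nat \<times> nat list \<Rightarrow> 'k) set \<Rightarrow> nat \<Rightarrow> nat \<Rightarrow> 'k" where
  "coset_coord X i k = (SOME f. f \<in> X) (cycle_path s i k)"

text \<open>Two representatives differ by an element of \<open>deep m\<close>, which vanishes on
  paths shorter than \<open>m\<close>; so the chosen one does not matter.\<close>

lemma coset_coord:
  assumes "f \<in> carrier P" "i \<in> {1..s}" "k < m"
  shows "coset_coord (deep m +>\<^bsub>P\<^esub> f) i k = f (cycle_path s i k)"
proof -
  interpret I: ideal "deep m" P by (rule deep_ideal)
  define g where "g = (SOME g. g \<in> deep m +>\<^bsub>P\<^esub> f)"
  have g: "g \<in> deep m +>\<^bsub>P\<^esub> f"
    unfolding g_def by (rule someI[of _ f]) (rule I.a_rcos_self[OF assms(1)])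
  then have gP: "g \<in> carrier P" by (rule I.a_elemrcos_carrier[OF assms(1)])
  have "g \<ominus>\<^bsub>P\<^esub> f \<in> deep m"
    using I.a_rcos_module_minus[OF P.B.ring_axioms assms(1) gP] g by simp
  then have "(g \<ominus>\<^bsub>P\<^esub> f) (cycle_path s i k) = \<zero>\<^bsub>K\<^esub>"
    using assms(2,3) unfolding deep_def by blast
  then have "g (cycle_path s i k) = f (cycle_path s i k)"
    using path_algebra_minus[OF gP assms(1)] gP assms(1) by (simp add: K.minus_eq_zero_iff)
  then show ?thesis unfolding coset_coord_def g_def .
qed

theorem truncated_path_algebra_truncated_cycle:
  "truncated_cycle K (truncated_path_algebra K (cyclic_quiver s) m) s m coset_coord"
proof -
  have Q: "truncated_path_algebra K (cyclic_quiver s) m = quotient_algebra P (deep m)"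
    by (simp add: truncated_path_algebra_def arrow_ideal_power_eq_deep)
  note quot = quotient_ops[OF P.noncomm_algebra_axioms deep_ideal]
    quotient_mult[OF P.noncomm_algebra_axioms deep_ideal]
  let ?Q = "quotient_algebra P (deep m)"
  have end_in: "cycle_end s i k \<in> {1..s}" for i k using s_pos by simp
  show ?thesis
    unfolding Q
  proof (rule truncated_cycle.intro[OF quotient_noncomm_algebra[OF P.noncomm_algebra_axioms deep_ideal]],
      rule truncated_cycle_axioms.intro)
    show "coset_coord (x \<otimes>\<^bsub>?Q\<^esub> y) i k =
        (\<Oplus>\<^bsub>K\<^esub>l\<in>{..k}. coset_coord x i l \<otimes>\<^bsub>K\<^esub> coset_coord y (cycle_end s i l) (k - l))"
      if xy: "x \<in> carrier ?Q" "y \<in> carrier ?Q"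
        and ik: "i \<in> {1..s}" "k < m" for x y i k
    proof -
      obtain f g where fg: "f \<in> carrier P" "x = deep m +>\<^bsub>P\<^esub> f" "g \<in> carrier P" "y = deep m +>\<^bsub>P\<^esub> g"
        using xy unfolding quot by blast
      have "coset_coord (x \<otimes>\<^bsub>?Q\<^esub> y) i k = (f \<otimes>\<^bsub>P\<^esub> g) (cycle_path s i k)"
        using fg ik by (simp add: quot coset_coord del: atLeastAtMost_iff)
      also have "\<dots> = (\<Oplus>\<^bsub>K\<^esub>l\<in>{..k}. f (cycle_path s i l) \<otimes>\<^bsub>K\<^esub> g (cycle_path s (cycle_end s i l) (k - l)))"
        by (rule path_algebra_mult) (use fg ik in auto)
      also have "\<dots> = (\<Oplus>\<^bsub>K\<^esub>l\<in>{..k}. coset_coord x i l \<otimes>\<^bsub>K\<^esub> coset_coord y (cycle_end s i l) (k - l))"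
        by (rule K.finsum_cong'[OF refl])
          (use fg ik end_in in \<open>auto simp: coset_coord[of _ _ _ m] simp del: atLeastAtMost_iff\<close>)
      finally show ?thesis .
    qed
    show "x = y"
      if xy: "x \<in> carrier ?Q" "y \<in> carrier ?Q"
        and eq: "\<And>i k. \<lbrakk>i \<in> {1..s}; k < m\<rbrakk> \<Longrightarrow> coset_coord x i k = coset_coord y i k" for x y
    proof -
      obtain f g where fg: "f \<in> carrier P" "x = deep m +>\<^bsub>P\<^esub> f" "g \<in> carrier P" "y = deep m +>\<^bsub>P\<^esub> g"
        using xy unfolding quot by blast
      have "f (cycle_path s i k) = g (cycle_path s i k)" if "i \<in> {1..s}" "k < m" for i k
        using eq[OF that] that fg by (simp add: coset_coord del: atLeastAtMost_iff)
      then have "f \<ominus>\<^bsub>P\<^esub> g \<in> deep m"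
        using fg by (simp add: deep_def path_algebra_minus K.minus_eq_zero_iff)
      then show ?thesis
        using fg quotient_coset_eq_iff[OF P.module_axioms submodule_if_ideal[OF P.noncomm_algebra_axioms deep_ideal]] by simp
    qed
    show "\<exists>x\<in>carrier ?Q. \<forall>i\<in>{1..s}. \<forall>k<m. coset_coord x i k = f i k"
      if f: "\<And>i k. \<lbrakk>i \<in> {1..s}; k < m\<rbrakk> \<Longrightarrow> f i k \<in> carrier K" for f
    proof -
      define g where "g p = (if p \<in> (\<lambda>(i, k). cycle_path s i k) ` ({1..s} \<times> {..<m})
        then f (fst p) (length (snd p)) else \<zero>\<^bsub>K\<^esub>)" for p
      have "finite {p. g p \<noteq> \<zero>\<^bsub>K\<^esub>}"
        by (rule finite_subset[of _ "(\<lambda>(i, k). cycle_path s i k) ` ({1..s} \<times> {..<m})"])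
          (auto simp: g_def)
      then have g: "g \<in> carrier P"
        by (rule path_algebra_memI[rotated]) (use f in \<open>auto simp: g_def simp del: atLeastAtMost_iff\<close>)
      moreover have "coset_coord (deep m +>\<^bsub>P\<^esub> g) i k = f i k" if "i \<in> {1..s}" "k < m" for i k
        using that g by (auto simp: coset_coord g_def image_iff simp del: atLeastAtMost_iff)
      ultimately show ?thesis unfolding quot by blast
    qed
  qed (use s_pos in \<open>auto simp: quot coset_coord path_algebra_add path_algebra_smult simp del: atLeastAtMost_iff\<close>)
qed

lemma trivial_path_coord:
  assumes "v \<in> {1..s}" "i \<in> {1..s}" "k < m"
  shows "coset_coord (trivial_path K (cyclic_quiver s) m v) i k = (if i = v \<and> k = 0 then \<one>\<^bsub>K\<^esub> else \<zero>\<^bsub>K\<^esub>)"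
proof -
  have v: "(v, []) = cycle_path s v 0" by (simp add: cycle_path_def)
  show ?thesis
    using assms path_elem_closed[OF assms(1), of 0]
    unfolding trivial_path_def arrow_ideal_power_eq_deep v
    by (simp add: coset_coord path_elem_def del: atLeastAtMost_iff)
qed

lemma trivial_path_closed:
  assumes "v \<in> {1..s}"
  shows "trivial_path K (cyclic_quiver s) m v \<in> carrier (truncated_path_algebra K (cyclic_quiver s) m)"
proof -
  have v: "(v, []) = cycle_path s v 0" by (simp add: cycle_path_def)
  show ?thesis
    using path_elem_closed[OF assms, of 0] quotient_ops(1)[OF P.noncomm_algebra_axioms deep_ideal]
    unfolding trivial_path_def truncated_path_algebra_def arrow_ideal_power_eq_deep v by blast
qed

end


section \<open>Hochschild extensions\<close>

context noncomm_algebra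
begin

abbreviation "D \<equiv> dual_space K B"

lemma dual_memI:
  assumes "\<And>x. x \<in> carrier B \<Longrightarrow> \<phi> x \<in> carrier K" "\<phi> \<in> extensional (carrier B)"
    and "\<And>x y. \<lbrakk>x \<in> carrier B; y \<in> carrier B\<rbrakk> \<Longrightarrow> \<phi> (x \<oplus>\<^bsub>B\<^esub> y) = \<phi> x \<oplus>\<^bsub>K\<^esub> \<phi> y"
    and "\<And>c x. \<lbrakk>c \<in> carrier K; x \<in> carrier B\<rbrakk> \<Longrightarrow> \<phi> (c \<odot>\<^bsub>B\<^esub> x) = c \<otimes>\<^bsub>K\<^esub> \<phi> x"
  shows "\<phi> \<in> carrier D"
  using assms by (auto simp: dual_space_def PiE_def)

lemma
  assumes "\<phi> \<in> carrier D"
  shows dual_closed: "x \<in> carrier B \<Longrightarrow> \<phi> x \<in> carrier K"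
    and dual_extensional: "\<phi> \<in> extensional (carrier B)"
    and dual_add: "\<lbrakk>x \<in> carrier B; y \<in> carrier B\<rbrakk> \<Longrightarrow> \<phi> (x \<oplus>\<^bsub>B\<^esub> y) = \<phi> x \<oplus>\<^bsub>K\<^esub> \<phi> y"
    and dual_smult: "\<lbrakk>c \<in> carrier K; x \<in> carrier B\<rbrakk> \<Longrightarrow> \<phi> (c \<odot>\<^bsub>B\<^esub> x) = c \<otimes>\<^bsub>K\<^esub> \<phi> x"
  using assms by (auto simp: dual_space_def PiE_def)

lemma dual_eqI:
  "\<lbrakk>\<phi> \<in> carrier D; \<psi> \<in> carrier D; \<And>x. x \<in> carrier B \<Longrightarrow> \<phi> x = \<psi> x\<rbrakk> \<Longrightarrow> \<phi> = \<psi>"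
  by (rule extensionalityI[OF dual_extensional dual_extensional])

lemma add_dual_apply: "x \<in> carrier B \<Longrightarrow> (\<phi> \<oplus>\<^bsub>D\<^esub> \<psi>) x = \<phi> x \<oplus>\<^bsub>K\<^esub> \<psi> x"
  and zero_dual_apply: "x \<in> carrier B \<Longrightarrow> \<zero>\<^bsub>D\<^esub> x = \<zero>\<^bsub>K\<^esub>"
  and smult_dual_apply: "x \<in> carrier B \<Longrightarrow> (c \<odot>\<^bsub>D\<^esub> \<phi>) x = c \<otimes>\<^bsub>K\<^esub> \<phi> x"
  and lact_apply: "x \<in> carrier B \<Longrightarrow> dual_lact B a \<phi> x = \<phi> (x \<otimes>\<^bsub>B\<^esub> a)"
  and ract_apply: "x \<in> carrier B \<Longrightarrow> dual_ract B \<phi> a x = \<phi> (a \<otimes>\<^bsub>B\<^esub> x)"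
  by (simp_all add: dual_space_def K.func_space_def dual_lact_def dual_ract_def)

lemma dual_ext:
  "\<phi> \<oplus>\<^bsub>D\<^esub> \<psi> \<in> extensional (carrier B)" "\<zero>\<^bsub>D\<^esub> \<in> extensional (carrier B)"
  "c \<odot>\<^bsub>D\<^esub> \<phi> \<in> extensional (carrier B)" "dual_lact B a \<phi> \<in> extensional (carrier B)"
  "dual_ract B \<phi> a \<in> extensional (carrier B)"
  by (simp_all add: dual_space_def K.func_space_def dual_lact_def dual_ract_def)

lemmas dual_apply = dual_closed add_dual_apply zero_dual_apply smult_dual_apply lact_apply ract_apply

lemma dual_add_closed [simp]: "\<lbrakk>\<phi> \<in> carrier D; \<psi> \<in> carrier D\<rbrakk> \<Longrightarrow> \<phi> \<oplus>\<^bsub>D\<^esub> \<psi> \<in> carrier D"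
  by (rule dual_memI) (simp_all add: dual_apply dual_ext dual_add dual_smult K.a_ac K.r_distr)

lemma dual_zero_closed [simp]: "\<zero>\<^bsub>D\<^esub> \<in> carrier D"
  by (rule dual_memI) (simp_all add: dual_apply dual_ext)

lemma dual_smult_closed [simp]: "\<lbrakk>c \<in> carrier K; \<phi> \<in> carrier D\<rbrakk> \<Longrightarrow> c \<odot>\<^bsub>D\<^esub> \<phi> \<in> carrier D"
  by (rule dual_memI) (simp_all add: dual_apply dual_ext dual_add dual_smult K.r_distr K.m_lcomm)

lemma lact_closed [simp]: "\<lbrakk>a \<in> carrier B; \<phi> \<in> carrier D\<rbrakk> \<Longrightarrow> dual_lact B a \<phi> \<in> carrier D"
  by (rule dual_memI) (simp_all add: dual_apply dual_ext dual_add dual_smult B.l_distr smult_mult_left)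

lemma ract_closed [simp]: "\<lbrakk>a \<in> carrier B; \<phi> \<in> carrier D\<rbrakk> \<Longrightarrow> dual_ract B \<phi> a \<in> carrier D"
  by (rule dual_memI) (simp_all add: dual_apply dual_ext dual_add dual_smult B.r_distr smult_mult_right)

lemma dual_module: "module K D"
proof (rule moduleI[OF K.is_cring])
  show "abelian_group D"
  proof (rule abelian_groupI)
    fix \<phi> assume \<phi>: "\<phi> \<in> carrier D"
    have "(\<ominus>\<^bsub>K\<^esub> \<one>\<^bsub>K\<^esub>) \<odot>\<^bsub>D\<^esub> \<phi> \<oplus>\<^bsub>D\<^esub> \<phi> = \<zero>\<^bsub>D\<^esub>"
      by (rule dual_eqI) (use \<phi> in \<open>simp_all add: dual_apply K.l_minus K.l_neg\<close>)
    then show "\<exists>\<psi>\<in>carrier D. \<psi> \<oplus>\<^bsub>D\<^esub> \<phi> = \<zero>\<^bsub>D\<^esub>" using \<phi> by (intro bexI[of _ "(\<ominus>\<^bsub>K\<^esub> \<one>\<^bsub>K\<^esub>) \<odot>\<^bsub>D\<^esub> \<phi>"]) auto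
  qed (auto intro!: dual_eqI simp: dual_apply K.a_ac)
qed (auto intro!: dual_eqI simp: dual_apply K.l_distr K.r_distr K.m_assoc)

interpretation D: module K D by (rule dual_module)

lemma uminus_dual_apply: "\<lbrakk>\<phi> \<in> carrier D; x \<in> carrier B\<rbrakk> \<Longrightarrow> (\<ominus>\<^bsub>D\<^esub> \<phi>) x = \<ominus>\<^bsub>K\<^esub> \<phi> x"
  using add_dual_apply[of x "\<ominus>\<^bsub>D\<^esub> \<phi>" \<phi>]
  by (simp add: D.M.l_neg zero_dual_apply) (metis D.M.a_inv_closed K.minus_equality dual_closed)

end

locale hochschild = noncomm_algebra K B
  for K :: "('k, 'm) ring_scheme" and B :: "('k, 'a) module" +
  fixes \<alpha> :: "'a \<Rightarrow> 'a \<Rightarrow> ('a \<Rightarrow> 'k)"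
  assumes cocycle: "two_cocycle K B \<alpha>"
begin

interpretation D: module K D by (rule dual_module)

abbreviation "T \<equiv> hochschild_extension K B \<alpha>"

lemma
  assumes "a \<in> carrier B"
  shows cocycle_closed [simp]: "b \<in> carrier B \<Longrightarrow> \<alpha> a b \<in> carrier D"
    and cocycle_add_right: "\<lbrakk>b \<in> carrier B; c \<in> carrier B\<rbrakk> \<Longrightarrow> \<alpha> a (b \<oplus>\<^bsub>B\<^esub> c) = \<alpha> a b \<oplus>\<^bsub>D\<^esub> \<alpha> a c"
    and cocycle_add_left: "\<lbrakk>b \<in> carrier B; c \<in> carrier B\<rbrakk> \<Longrightarrow> \<alpha> (b \<oplus>\<^bsub>B\<^esub> c) a = \<alpha> b a \<oplus>\<^bsub>D\<^esub> \<alpha> c a"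
    and cocycle_smult_right: "\<lbrakk>r \<in> carrier K; b \<in> carrier B\<rbrakk> \<Longrightarrow> \<alpha> a (r \<odot>\<^bsub>B\<^esub> b) = r \<odot>\<^bsub>D\<^esub> \<alpha> a b"
    and cocycle_smult_left: "\<lbrakk>r \<in> carrier K; b \<in> carrier B\<rbrakk> \<Longrightarrow> \<alpha> (r \<odot>\<^bsub>B\<^esub> b) a = r \<odot>\<^bsub>D\<^esub> \<alpha> b a"
proof -
  have hom: "\<alpha> a \<in> module_hom K B D" "(\<lambda>b. \<alpha> b a) \<in> module_hom K B D"
    using cocycle assms unfolding two_cocycle_def by simp_all
  show "b \<in> carrier B \<Longrightarrow> \<alpha> a b \<in> carrier D"
    using module_hom_closed[OF hom(1)] by blast
  show "\<lbrakk>b \<in> carrier B; c \<in> carrier B\<rbrakk> \<Longrightarrow> \<alpha> a (b \<oplus>\<^bsub>B\<^esub> c) = \<alpha> a b \<oplus>\<^bsub>D\<^esub> \<alpha> a c"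
    by (rule module_hom_add[OF hom(1)])
  show "\<lbrakk>b \<in> carrier B; c \<in> carrier B\<rbrakk> \<Longrightarrow> \<alpha> (b \<oplus>\<^bsub>B\<^esub> c) a = \<alpha> b a \<oplus>\<^bsub>D\<^esub> \<alpha> c a"
    by (rule module_hom_add[OF hom(2)])
  show "\<lbrakk>r \<in> carrier K; b \<in> carrier B\<rbrakk> \<Longrightarrow> \<alpha> a (r \<odot>\<^bsub>B\<^esub> b) = r \<odot>\<^bsub>D\<^esub> \<alpha> a b"
    by (rule module_hom_smult[OF hom(1)])
  show "\<lbrakk>r \<in> carrier K; b \<in> carrier B\<rbrakk> \<Longrightarrow> \<alpha> (r \<odot>\<^bsub>B\<^esub> b) a = r \<odot>\<^bsub>D\<^esub> \<alpha> b a"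
    by (rule module_hom_smult[OF hom(2)])
qed

text \<open>The cocycle identity evaluated at \<open>x\<close>, with the negative terms moved
  across, which is the form in which associativity and the unit laws use it.\<close>

lemma cocycle_apply:
  assumes "a \<in> carrier B" "b \<in> carrier B" "c \<in> carrier B" "x \<in> carrier B"
  shows "\<alpha> (a \<otimes>\<^bsub>B\<^esub> b) c x \<oplus>\<^bsub>K\<^esub> \<alpha> a b (c \<otimes>\<^bsub>B\<^esub> x) = \<alpha> b c (x \<otimes>\<^bsub>B\<^esub> a) \<oplus>\<^bsub>K\<^esub> \<alpha> a (b \<otimes>\<^bsub>B\<^esub> c) x"
proof -
  define p where "p = \<alpha> b c (x \<otimes>\<^bsub>B\<^esub> a)"
  define q where "q = \<alpha> (a \<otimes>\<^bsub>B\<^esub> b) c x"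
  define r where "r = \<alpha> a (b \<otimes>\<^bsub>B\<^esub> c) x"
  define t where "t = \<alpha> a b (c \<otimes>\<^bsub>B\<^esub> x)"
  have closed: "p \<in> carrier K" "q \<in> carrier K" "r \<in> carrier K" "t \<in> carrier K"
    unfolding p_def q_def r_def t_def using assms by (simp_all add: dual_closed)
  have "dual_lact B a (\<alpha> b c) \<ominus>\<^bsub>D\<^esub> \<alpha> (a \<otimes>\<^bsub>B\<^esub> b) c
          \<oplus>\<^bsub>D\<^esub> \<alpha> a (b \<otimes>\<^bsub>B\<^esub> c) \<ominus>\<^bsub>D\<^esub> dual_ract B (\<alpha> a b) c = \<zero>\<^bsub>D\<^esub>"
    using cocycle assms unfolding two_cocycle_def by blast
  then have "(dual_lact B a (\<alpha> b c) \<ominus>\<^bsub>D\<^esub> \<alpha> (a \<otimes>\<^bsub>B\<^esub> b) c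
          \<oplus>\<^bsub>D\<^esub> \<alpha> a (b \<otimes>\<^bsub>B\<^esub> c) \<ominus>\<^bsub>D\<^esub> dual_ract B (\<alpha> a b) c) x = \<zero>\<^bsub>D\<^esub> x"
    by (rule fun_cong)
  then have "p \<oplus>\<^bsub>K\<^esub> \<ominus>\<^bsub>K\<^esub> q \<oplus>\<^bsub>K\<^esub> r \<oplus>\<^bsub>K\<^esub> \<ominus>\<^bsub>K\<^esub> t = \<zero>\<^bsub>K\<^esub>"
    using assms unfolding p_def q_def r_def t_def
    by (simp add: a_minus_def dual_apply uminus_dual_apply)
  then have "(p \<oplus>\<^bsub>K\<^esub> r) \<ominus>\<^bsub>K\<^esub> (q \<oplus>\<^bsub>K\<^esub> t) = \<zero>\<^bsub>K\<^esub>"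
    using closed by (simp add: K.minus_eq K.minus_add K.a_ac)
  then have "p \<oplus>\<^bsub>K\<^esub> r = q \<oplus>\<^bsub>K\<^esub> t"
    using closed by (simp add: K.minus_eq_zero_iff)
  then show ?thesis unfolding p_def q_def r_def t_def by simp
qed

lemma hochschild_carrier: "carrier T = carrier B \<times> carrier D"
  and hochschild_add: "(a, \<phi>) \<oplus>\<^bsub>T\<^esub> (b, \<psi>) = (a \<oplus>\<^bsub>B\<^esub> b, \<phi> \<oplus>\<^bsub>D\<^esub> \<psi>)"
  and hochschild_zero: "\<zero>\<^bsub>T\<^esub> = (\<zero>\<^bsub>B\<^esub>, \<zero>\<^bsub>D\<^esub>)"
  and hochschild_smult: "c \<odot>\<^bsub>T\<^esub> (a, \<phi>) = (c \<odot>\<^bsub>B\<^esub> a, c \<odot>\<^bsub>D\<^esub> \<phi>)"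
  and hochschild_one: "\<one>\<^bsub>T\<^esub> = (\<one>\<^bsub>B\<^esub>, \<ominus>\<^bsub>D\<^esub> \<alpha> \<one>\<^bsub>B\<^esub> \<one>\<^bsub>B\<^esub>)"
  and hochschild_mult: "(a, \<phi>) \<otimes>\<^bsub>T\<^esub> (b, \<psi>) =
    (a \<otimes>\<^bsub>B\<^esub> b, dual_lact B a \<psi> \<oplus>\<^bsub>D\<^esub> dual_ract B \<phi> b \<oplus>\<^bsub>D\<^esub> \<alpha> a b)"
  by (simp_all add: hochschild_extension_def direct_sum_def)

lemmas hochschild_ops = hochschild_carrier hochschild_add hochschild_zero hochschild_smult
  hochschild_one hochschild_mult

theorem hochschild_noncomm_algebra: "noncomm_algebra K T"
proof -
  have ab: "abelian_group T"
  proof (rule abelian_groupI)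
    fix t assume "t \<in> carrier T"
    then obtain a \<phi> where t: "t = (a, \<phi>)" "a \<in> carrier B" "\<phi> \<in> carrier D"
      by (auto simp: hochschild_carrier)
    then show "\<exists>u\<in>carrier T. u \<oplus>\<^bsub>T\<^esub> t = \<zero>\<^bsub>T\<^esub>"
      by (intro bexI[of _ "(\<ominus>\<^bsub>B\<^esub> a, \<ominus>\<^bsub>D\<^esub> \<phi>)"]) (auto simp: hochschild_ops B.l_neg D.M.l_neg)
  qed (auto simp: hochschild_ops B.a_ac D.M.a_ac)
  have mon: "monoid T"
  proof (rule monoidI)
    fix t u v assume "t \<in> carrier T" "u \<in> carrier T" "v \<in> carrier T"
    then obtain a \<phi> b \<psi> c \<chi> where *: "t = (a, \<phi>)" "u = (b, \<psi>)" "v = (c, \<chi>)"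
      and cl: "a \<in> carrier B" "\<phi> \<in> carrier D" "b \<in> carrier B" "\<psi> \<in> carrier D" "c \<in> carrier B" "\<chi> \<in> carrier D"
      by (auto simp: hochschild_carrier)
    \<comment> \<open>The terms without the cocycle agree by the bimodule laws; the two cocycle
      terms left on each side are matched by \<open>cocycle_apply\<close>.\<close>
    have "dual_lact B (a \<otimes>\<^bsub>B\<^esub> b) \<chi> \<oplus>\<^bsub>D\<^esub>
        dual_ract B (dual_lact B a \<psi> \<oplus>\<^bsub>D\<^esub> dual_ract B \<phi> b \<oplus>\<^bsub>D\<^esub> \<alpha> a b) c \<oplus>\<^bsub>D\<^esub> \<alpha> (a \<otimes>\<^bsub>B\<^esub> b) c
      = dual_lact B a (dual_lact B b \<chi> \<oplus>\<^bsub>D\<^esub> dual_ract B \<psi> c \<oplus>\<^bsub>D\<^esub> \<alpha> b c) \<oplus>\<^bsub>D\<^esub>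
        dual_ract B \<phi> (b \<otimes>\<^bsub>B\<^esub> c) \<oplus>\<^bsub>D\<^esub> \<alpha> a (b \<otimes>\<^bsub>B\<^esub> c)"
      (is "?l = ?r")
    proof (rule dual_eqI)
      fix x assume x: "x \<in> carrier B"
      have l: "?l x = (\<chi> (x \<otimes>\<^bsub>B\<^esub> (a \<otimes>\<^bsub>B\<^esub> b)) \<oplus>\<^bsub>K\<^esub> \<psi> (c \<otimes>\<^bsub>B\<^esub> x \<otimes>\<^bsub>B\<^esub> a) \<oplus>\<^bsub>K\<^esub> \<phi> (b \<otimes>\<^bsub>B\<^esub> (c \<otimes>\<^bsub>B\<^esub> x))) \<oplus>\<^bsub>K\<^esub>
          (\<alpha> (a \<otimes>\<^bsub>B\<^esub> b) c x \<oplus>\<^bsub>K\<^esub> \<alpha> a b (c \<otimes>\<^bsub>B\<^esub> x))"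
        using x cl by (simp add: dual_apply K.a_ac)
      show "?l x = ?r x"
        unfolding l cocycle_apply[OF cl(1,3,5) x]
        using x cl by (simp add: dual_apply K.a_ac B.m_assoc)
    qed (use cl in simp_all)
    then show "t \<otimes>\<^bsub>T\<^esub> u \<otimes>\<^bsub>T\<^esub> v = t \<otimes>\<^bsub>T\<^esub> (u \<otimes>\<^bsub>T\<^esub> v)"
      using cl by (simp add: * hochschild_mult B.m_assoc)
  next
    fix t assume "t \<in> carrier T"
    then obtain a \<phi> where t: "t = (a, \<phi>)" and cl: "a \<in> carrier B" "\<phi> \<in> carrier D"
      by (auto simp: hochschild_carrier)
    \<comment> \<open>The cocycle identity for \<open>1, 1, a\<close> gives
      \<open>\<alpha>(1, 1) a = \<alpha>(1, a)\<close>, and for \<open>a, 1, 1\<close> it gives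
      \<open>a \<alpha>(1, 1) = \<alpha>(a, 1)\<close>. So the correction in the unit cancels the
      cocycle term on either side.\<close>
    have l: "\<alpha> \<one>\<^bsub>B\<^esub> \<one>\<^bsub>B\<^esub> (a \<otimes>\<^bsub>B\<^esub> x) = \<alpha> \<one>\<^bsub>B\<^esub> a x" if "x \<in> carrier B" for x
    proof -
      have closed: "\<alpha> \<one>\<^bsub>B\<^esub> \<one>\<^bsub>B\<^esub> (a \<otimes>\<^bsub>B\<^esub> x) \<in> carrier K" "\<alpha> \<one>\<^bsub>B\<^esub> a x \<in> carrier K"
        using cl that by (simp_all add: dual_closed)
      then have "\<alpha> \<one>\<^bsub>B\<^esub> \<one>\<^bsub>B\<^esub> (a \<otimes>\<^bsub>B\<^esub> x) \<oplus>\<^bsub>K\<^esub> \<alpha> \<one>\<^bsub>B\<^esub> a x = \<alpha> \<one>\<^bsub>B\<^esub> a x \<oplus>\<^bsub>K\<^esub> \<alpha> \<one>\<^bsub>B\<^esub> a x"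
        using cocycle_apply[of "\<one>\<^bsub>B\<^esub>" "\<one>\<^bsub>B\<^esub>" a x] cl that by (simp add: K.a_comm)
      then show ?thesis using closed by (simp only: K.add.right_cancel)
    qed
    have r: "\<alpha> \<one>\<^bsub>B\<^esub> \<one>\<^bsub>B\<^esub> (x \<otimes>\<^bsub>B\<^esub> a) = \<alpha> a \<one>\<^bsub>B\<^esub> x" if "x \<in> carrier B" for x
    proof -
      have "\<alpha> \<one>\<^bsub>B\<^esub> \<one>\<^bsub>B\<^esub> (x \<otimes>\<^bsub>B\<^esub> a) \<in> carrier K" "\<alpha> a \<one>\<^bsub>B\<^esub> x \<in> carrier K"
        using cl that by (simp_all add: dual_closed)
      moreover have "\<alpha> a \<one>\<^bsub>B\<^esub> x \<oplus>\<^bsub>K\<^esub> \<alpha> a \<one>\<^bsub>B\<^esub> x = \<alpha> \<one>\<^bsub>B\<^esub> \<one>\<^bsub>B\<^esub> (x \<otimes>\<^bsub>B\<^esub> a) \<oplus>\<^bsub>K\<^esub> \<alpha> a \<one>\<^bsub>B\<^esub> x"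
        using cocycle_apply[of a "\<one>\<^bsub>B\<^esub>" "\<one>\<^bsub>B\<^esub>" x] cl that by simp
      ultimately show ?thesis by (simp only: K.add.right_cancel)
    qed
    have "dual_lact B \<one>\<^bsub>B\<^esub> \<phi> \<oplus>\<^bsub>D\<^esub> dual_ract B (\<ominus>\<^bsub>D\<^esub> \<alpha> \<one>\<^bsub>B\<^esub> \<one>\<^bsub>B\<^esub>) a \<oplus>\<^bsub>D\<^esub> \<alpha> \<one>\<^bsub>B\<^esub> a = \<phi>"
      by (rule dual_eqI) (use cl in \<open>simp_all add: dual_apply uminus_dual_apply l K.a_assoc K.l_neg\<close>)
    then show "\<one>\<^bsub>T\<^esub> \<otimes>\<^bsub>T\<^esub> t = t" using cl by (simp add: t hochschild_ops)
    have "dual_lact B a (\<ominus>\<^bsub>D\<^esub> \<alpha> \<one>\<^bsub>B\<^esub> \<one>\<^bsub>B\<^esub>) \<oplus>\<^bsub>D\<^esub> dual_ract B \<phi> \<one>\<^bsub>B\<^esub> \<oplus>\<^bsub>D\<^esub> \<alpha> a \<one>\<^bsub>B\<^esub> = \<phi>"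
      by (rule dual_eqI) (use cl in \<open>simp_all add: dual_apply uminus_dual_apply r K.a_ac K.r_neg K.r_neg1 K.r_neg2\<close>)
    then show "t \<otimes>\<^bsub>T\<^esub> \<one>\<^bsub>T\<^esub> = t" using cl by (simp add: t hochschild_ops)
  qed (auto simp: hochschild_ops)
  have ring: "ring T"
    by (rule ringI[OF ab mon])
      (auto simp: hochschild_ops B.l_distr B.r_distr cocycle_add_left cocycle_add_right
        dual_apply dual_add K.a_ac intro!: dual_eqI)
  have mod: "module K T"
    by (rule moduleI[OF K.is_cring ab])
      (auto simp: hochschild_ops smult_l_distr smult_r_distr smult_assoc1
        D.smult_l_distr D.smult_r_distr D.smult_assoc1)
  show ?thesis
    by (rule noncomm_algebra.intro[OF K.field_axioms ring mod])
      (unfold_locales, auto simp: hochschild_ops smult_mult_left smult_mult_right cocycle_smult_left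
        cocycle_smult_right dual_apply dual_smult K.r_distr intro!: dual_eqI)
qed

end


section \<open>Algebras spanned by the paths of a cycle\<close>

text \<open>\<open>b i k\<close> plays the role of the path of length \<open>k\<close> that starts at \<open>i\<close>.\<close>

locale cycle_path_system = noncomm_algebra K B
  for K :: "('k, 'm) ring_scheme" and B :: "('k, 'a) module" +
  fixes s N :: nat and b :: "nat \<Rightarrow> nat \<Rightarrow> 'a"
  assumes s_pos: "s \<ge> 1"
    and b_closed [simp]: "i \<in> {1..s} \<Longrightarrow> b i k \<in> carrier B"
    and b_mult: "\<lbrakk>i \<in> {1..s}; j \<in> {1..s}\<rbrakk> \<Longrightarrow>
      b i k \<otimes>\<^bsub>B\<^esub> b j l = (if j = cycle_end s i k then b i (k + l) else \<zero>\<^bsub>B\<^esub>)"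
    and b_vanish: "\<lbrakk>i \<in> {1..s}; k \<ge> N\<rbrakk> \<Longrightarrow> b i k = \<zero>\<^bsub>B\<^esub>"
    and b_top: "i \<in> {1..s} \<Longrightarrow> b i (N - 1) \<noteq> \<zero>\<^bsub>B\<^esub>"
    and b_one: "(\<Oplus>\<^bsub>B\<^esub>i\<in>{1..s}. b i 0) = \<one>\<^bsub>B\<^esub>"
    and b_span: "\<lbrakk>t \<in> carrier B; i \<in> {1..s}\<rbrakk> \<Longrightarrow>
      \<exists>c. (\<forall>k. c k \<in> carrier K) \<and> b i 0 \<otimes>\<^bsub>B\<^esub> t = (\<Oplus>\<^bsub>B\<^esub>k\<in>{..<N}. c k \<odot>\<^bsub>B\<^esub> b i k)"
begin

definition comb :: "nat \<Rightarrow> (nat \<Rightarrow> 'k) \<Rightarrow> 'a" where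
  "comb i c = (\<Oplus>\<^bsub>B\<^esub>k\<in>{..<N}. c k \<odot>\<^bsub>B\<^esub> b i k)"

lemma end_in: "cycle_end s i k \<in> {1..s}"
  using s_pos by (rule cycle_end_in)

lemma comb_closed [simp]:
  "\<lbrakk>i \<in> {1..s}; \<And>k. k < N \<Longrightarrow> c k \<in> carrier K\<rbrakk> \<Longrightarrow> comb i c \<in> carrier B"
  unfolding comb_def by (intro B.finsum_closed) auto

lemma comb_add:
  assumes "i \<in> {1..s}" "\<And>k. k < N \<Longrightarrow> c k \<in> carrier K" "\<And>k. k < N \<Longrightarrow> d k \<in> carrier K"
  shows "comb i c \<oplus>\<^bsub>B\<^esub> comb i d = comb i (\<lambda>k. c k \<oplus>\<^bsub>K\<^esub> d k)"
proof -
  have "comb i (\<lambda>k. c k \<oplus>\<^bsub>K\<^esub> d k) = (\<Oplus>\<^bsub>B\<^esub>k\<in>{..<N}. c k \<odot>\<^bsub>B\<^esub> b i k \<oplus>\<^bsub>B\<^esub> d k \<odot>\<^bsub>B\<^esub> b i k)"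
    unfolding comb_def by (rule B.finsum_cong'[OF refl]) (use assms in \<open>auto simp: smult_l_distr\<close>)
  also have "\<dots> = comb i c \<oplus>\<^bsub>B\<^esub> comb i d"
    unfolding comb_def by (rule B.finsum_addf) (use assms in auto)
  finally show ?thesis by simp
qed

lemma comb_smult:
  assumes "i \<in> {1..s}" "\<And>k. k < N \<Longrightarrow> c k \<in> carrier K" "r \<in> carrier K"
  shows "r \<odot>\<^bsub>B\<^esub> comb i c = comb i (\<lambda>k. r \<otimes>\<^bsub>K\<^esub> c k)"
proof -
  have "r \<odot>\<^bsub>B\<^esub> comb i c = (\<Oplus>\<^bsub>B\<^esub>k\<in>{..<N}. r \<odot>\<^bsub>B\<^esub> (c k \<odot>\<^bsub>B\<^esub> b i k))"
    unfolding comb_def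
    by (rule additive_finsum[OF B.is_abelian_group B.is_abelian_group])
      (use assms in \<open>auto simp: smult_r_distr\<close>)
  also have "\<dots> = comb i (\<lambda>k. r \<otimes>\<^bsub>K\<^esub> c k)"
    unfolding comb_def by (rule B.finsum_cong'[OF refl]) (use assms in \<open>auto simp: smult_assoc1\<close>)
  finally show ?thesis .
qed

lemma comb_cong: "(\<And>k. k < N \<Longrightarrow> c k = d k) \<Longrightarrow> i \<in> {1..s} \<Longrightarrow>
    (\<And>k. k < N \<Longrightarrow> d k \<in> carrier K) \<Longrightarrow> comb i c = comb i d"
  unfolding comb_def by (rule B.finsum_cong'[OF refl]) auto

lemma mult_comb:
  assumes x: "x \<in> carrier B" and i: "i \<in> {1..s}" and c: "\<And>k. k < N \<Longrightarrow> c k \<in> carrier K"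
  shows "x \<otimes>\<^bsub>B\<^esub> comb i c = (\<Oplus>\<^bsub>B\<^esub>k\<in>{..<N}. c k \<odot>\<^bsub>B\<^esub> (x \<otimes>\<^bsub>B\<^esub> b i k))"
    and "comb i c \<otimes>\<^bsub>B\<^esub> x = (\<Oplus>\<^bsub>B\<^esub>k\<in>{..<N}. c k \<odot>\<^bsub>B\<^esub> (b i k \<otimes>\<^bsub>B\<^esub> x))"
proof -
  have "x \<otimes>\<^bsub>B\<^esub> comb i c = (\<Oplus>\<^bsub>B\<^esub>k\<in>{..<N}. x \<otimes>\<^bsub>B\<^esub> (c k \<odot>\<^bsub>B\<^esub> b i k))"
    unfolding comb_def using assms by (intro B.finsum_rdistr) auto
  also have "\<dots> = (\<Oplus>\<^bsub>B\<^esub>k\<in>{..<N}. c k \<odot>\<^bsub>B\<^esub> (x \<otimes>\<^bsub>B\<^esub> b i k))"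
    by (rule B.finsum_cong'[OF refl]) (use assms in \<open>auto simp: smult_mult_right\<close>)
  finally show "x \<otimes>\<^bsub>B\<^esub> comb i c = (\<Oplus>\<^bsub>B\<^esub>k\<in>{..<N}. c k \<odot>\<^bsub>B\<^esub> (x \<otimes>\<^bsub>B\<^esub> b i k))" .
  have "comb i c \<otimes>\<^bsub>B\<^esub> x = (\<Oplus>\<^bsub>B\<^esub>k\<in>{..<N}. (c k \<odot>\<^bsub>B\<^esub> b i k) \<otimes>\<^bsub>B\<^esub> x)"
    unfolding comb_def using assms by (intro B.finsum_ldistr) auto
  also have "\<dots> = (\<Oplus>\<^bsub>B\<^esub>k\<in>{..<N}. c k \<odot>\<^bsub>B\<^esub> (b i k \<otimes>\<^bsub>B\<^esub> x))"
    by (rule B.finsum_cong'[OF refl]) (use assms in \<open>auto simp: smult_mult_left\<close>)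
  finally show "comb i c \<otimes>\<^bsub>B\<^esub> x = (\<Oplus>\<^bsub>B\<^esub>k\<in>{..<N}. c k \<odot>\<^bsub>B\<^esub> (b i k \<otimes>\<^bsub>B\<^esub> x))" .
qed

lemma smult_eq_zeroD:
  assumes "c \<in> carrier K" "x \<in> carrier B" "c \<odot>\<^bsub>B\<^esub> x = \<zero>\<^bsub>B\<^esub>" "x \<noteq> \<zero>\<^bsub>B\<^esub>"
  shows "c = \<zero>\<^bsub>K\<^esub>"
proof (rule ccontr)
  assume "c \<noteq> \<zero>\<^bsub>K\<^esub>"
  then have "c \<in> Units K" using assms(1) by (simp add: K.field_Units)
  then have "x = inv\<^bsub>K\<^esub> c \<odot>\<^bsub>B\<^esub> (c \<odot>\<^bsub>B\<^esub> x)"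
    using assms(1,2) by (simp add: smult_assoc1[symmetric])
  then show False using assms \<open>c \<in> Units K\<close> by simp
qed

text \<open>Multiplying by the path that completes length \<open>k\<close> to \<open>N - 1\<close>
  isolates \<open>c k\<close>: shorter terms vanish by induction, and longer ones exceed length
  \<open>N - 1\<close>. What remains is \<open>c k\<close> times a nonzero longest path.\<close>

lemma comb_zeroD:
  assumes i: "i \<in> {1..s}" and c: "\<And>k. k < N \<Longrightarrow> c k \<in> carrier K" and z: "comb i c = \<zero>\<^bsub>B\<^esub>"
    and k: "k < N"
  shows "c k = \<zero>\<^bsub>K\<^esub>"
  using k
proof (induction k rule: less_induct)
  case (less k)
  let ?j = "cycle_end s i k"
  let ?y = "b ?j (N - 1 - k)"
  have y: "?y \<in> carrier B" using end_in by simp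
  have "\<zero>\<^bsub>B\<^esub> = comb i c \<otimes>\<^bsub>B\<^esub> ?y" using y by (simp add: z)
  also have "\<dots> = (\<Oplus>\<^bsub>B\<^esub>l\<in>{..<N}. c l \<odot>\<^bsub>B\<^esub> (b i l \<otimes>\<^bsub>B\<^esub> ?y))"
    by (rule mult_comb[OF y i c])
  also have "\<dots> = c k \<odot>\<^bsub>B\<^esub> (b i k \<otimes>\<^bsub>B\<^esub> ?y)"
  proof (rule B.finsum_single)
    fix l assume l: "l \<in> {..<N}" "l \<noteq> k"
    show "c l \<odot>\<^bsub>B\<^esub> (b i l \<otimes>\<^bsub>B\<^esub> ?y) = \<zero>\<^bsub>B\<^esub>"
    proof (cases "l < k")
      case True
      then show ?thesis using less.IH[OF True] l i y by simp
    next
      case False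
      then have "b i (l + (N - 1 - k)) = \<zero>\<^bsub>B\<^esub>" using l by (intro b_vanish[OF i]) auto
      then have "b i l \<otimes>\<^bsub>B\<^esub> ?y = \<zero>\<^bsub>B\<^esub>" unfolding b_mult[OF i end_in] by simp
      then show ?thesis using l c by simp
    qed
  qed (use less.prems i y c in auto)
  also have "b i k \<otimes>\<^bsub>B\<^esub> ?y = b i (N - 1)" using less.prems unfolding b_mult[OF i end_in] by simp
  finally have "c k \<odot>\<^bsub>B\<^esub> b i (N - 1) = \<zero>\<^bsub>B\<^esub>" by simp
  then show ?case by (rule smult_eq_zeroD[rotated 2]) (use b_top c less.prems i in auto)
qed

lemma comb_inject:
  assumes i: "i \<in> {1..s}" and c: "\<And>k. k < N \<Longrightarrow> c k \<in> carrier K" and d: "\<And>k. k < N \<Longrightarrow> d k \<in> carrier K"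
    and eq: "comb i c = comb i d" and k: "k < N"
  shows "c k = d k"
proof -
  have "comb i (\<lambda>k. \<ominus>\<^bsub>K\<^esub> \<one>\<^bsub>K\<^esub> \<otimes>\<^bsub>K\<^esub> d k) = \<ominus>\<^bsub>B\<^esub> comb i c"
    using comb_smult[OF i d, where r = "\<ominus>\<^bsub>K\<^esub> \<one>\<^bsub>K\<^esub>"] i d eq by (simp add: smult_l_minus)
  moreover have "comb i c \<oplus>\<^bsub>B\<^esub> comb i (\<lambda>k. \<ominus>\<^bsub>K\<^esub> \<one>\<^bsub>K\<^esub> \<otimes>\<^bsub>K\<^esub> d k)
      = comb i (\<lambda>k. c k \<oplus>\<^bsub>K\<^esub> \<ominus>\<^bsub>K\<^esub> \<one>\<^bsub>K\<^esub> \<otimes>\<^bsub>K\<^esub> d k)"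
    by (rule comb_add[OF i c]) (use d in auto)
  ultimately have "comb i (\<lambda>k. c k \<oplus>\<^bsub>K\<^esub> \<ominus>\<^bsub>K\<^esub> \<one>\<^bsub>K\<^esub> \<otimes>\<^bsub>K\<^esub> d k) = \<zero>\<^bsub>B\<^esub>"
    using i c by (simp add: B.r_neg)
  then have "c k \<oplus>\<^bsub>K\<^esub> \<ominus>\<^bsub>K\<^esub> \<one>\<^bsub>K\<^esub> \<otimes>\<^bsub>K\<^esub> d k = \<zero>\<^bsub>K\<^esub>"
    by (rule comb_zeroD[OF i, rotated]) (use c d k in auto)
  then have "c k \<ominus>\<^bsub>K\<^esub> d k = \<zero>\<^bsub>K\<^esub>" using c d k by (simp add: K.l_minus K.minus_eq)
  then show ?thesis using c d k by (simp add: K.minus_eq_zero_iff)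
qed

text \<open>Only the values below \<open>N\<close> are determined, by \<open>comb_inject\<close>;
  the others are arbitrary scalars.\<close>

definition coord :: "'a \<Rightarrow> nat \<Rightarrow> nat \<Rightarrow> 'k" where
  "coord t i = (SOME c. (\<forall>k. c k \<in> carrier K) \<and> b i 0 \<otimes>\<^bsub>B\<^esub> t = comb i c)"

lemma coord:
  assumes "t \<in> carrier B" "i \<in> {1..s}"
  shows coord_closed [simp]: "coord t i k \<in> carrier K"
    and comb_coord: "comb i (coord t i) = b i 0 \<otimes>\<^bsub>B\<^esub> t"
  using someI_ex[OF b_span[OF assms, folded comb_def]] unfolding coord_def by simp_all

lemma coord_eqI:
  assumes "t \<in> carrier B" "i \<in> {1..s}" "\<And>k. k < N \<Longrightarrow> c k \<in> carrier K" "b i 0 \<otimes>\<^bsub>B\<^esub> t = comb i c" "k < N"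
  shows "coord t i k = c k"
  by (rule comb_inject[of i "coord t i" c]) (use assms in \<open>auto simp: comb_coord\<close>)

lemma idempotent_mult: "i \<in> {1..s} \<Longrightarrow> j \<in> {1..s} \<Longrightarrow>
    b i 0 \<otimes>\<^bsub>B\<^esub> b j k = (if i = j then b j k else \<zero>\<^bsub>B\<^esub>)"
  by (auto simp: b_mult)

text \<open>The product is a double sum over the lengths of the two factors. Terms of total length
  at least \<open>N\<close> drop out, and the rest is collected by total length, which produces the
  convolution.\<close>

lemma comb_mult:
  assumes c: "\<And>k. k < N \<Longrightarrow> c k \<in> carrier K" and u: "u \<in> carrier B" and i: "i \<in> {1..s}"
  shows "comb i c \<otimes>\<^bsub>B\<^esub> u = comb i (\<lambda>k. \<Oplus>\<^bsub>K\<^esub>l\<in>{..k}. c l \<otimes>\<^bsub>K\<^esub> coord u (cycle_end s i l) (k - l))"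
proof -
  define X where "X l r = (c l \<otimes>\<^bsub>K\<^esub> coord u (cycle_end s i l) r) \<odot>\<^bsub>B\<^esub> b i (l + r)" for l r
  have X: "X l r \<in> carrier B" if "l < N" for l r
    unfolding X_def using c[OF that] coord_closed[OF u end_in] i by simp
  have summand: "c l \<odot>\<^bsub>B\<^esub> (b i l \<otimes>\<^bsub>B\<^esub> u) = (\<Oplus>\<^bsub>B\<^esub>r\<in>{..<N}. X l r)" if l: "l < N" for l
  proof -
    let ?j = "cycle_end s i l" and ?d = "coord u (cycle_end s i l)"
    have d: "?d k \<in> carrier K" for k by (rule coord_closed[OF u end_in])
    \<comment> \<open>Inserting the idempotent at the end of the path makes the coordinates of
      \<open>u\<close> at that vertex available.\<close>
    have "b i l \<otimes>\<^bsub>B\<^esub> u = (b i l \<otimes>\<^bsub>B\<^esub> b ?j 0) \<otimes>\<^bsub>B\<^esub> u" unfolding b_mult[OF i end_in] by simp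
    also have "\<dots> = b i l \<otimes>\<^bsub>B\<^esub> comb ?j ?d"
      using i u b_closed[OF end_in] by (simp add: comb_coord[OF u end_in] B.m_assoc)
    also have "\<dots> = (\<Oplus>\<^bsub>B\<^esub>r\<in>{..<N}. ?d r \<odot>\<^bsub>B\<^esub> (b i l \<otimes>\<^bsub>B\<^esub> b ?j r))"
      by (rule mult_comb) (use i d end_in in simp_all)
    finally have eq: "b i l \<otimes>\<^bsub>B\<^esub> u = (\<Oplus>\<^bsub>B\<^esub>r\<in>{..<N}. ?d r \<odot>\<^bsub>B\<^esub> b i (l + r))"
      unfolding b_mult[OF i end_in] by simp
    have "c l \<odot>\<^bsub>B\<^esub> (b i l \<otimes>\<^bsub>B\<^esub> u) = (\<Oplus>\<^bsub>B\<^esub>r\<in>{..<N}. c l \<odot>\<^bsub>B\<^esub> (?d r \<odot>\<^bsub>B\<^esub> b i (l + r)))"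
      unfolding eq by (rule additive_finsum[OF B.is_abelian_group B.is_abelian_group])
        (use c[OF l] d i in \<open>auto simp: smult_r_distr\<close>)
    also have "\<dots> = (\<Oplus>\<^bsub>B\<^esub>r\<in>{..<N}. X l r)"
      by (rule B.finsum_cong'[OF refl]) (use c[OF l] d i X[OF l] in \<open>auto simp: X_def smult_assoc1\<close>)
    finally show ?thesis .
  qed
  let ?S = "{..<N} \<times> {..<N}" and ?S' = "Sigma {..<N} (\<lambda>l. {..<N - l})" and ?T = "Sigma {..<N} (\<lambda>k. {..k})"
  have bij: "bij_betw (\<lambda>(k, l). (l, k - l)) ?T ?S'"
    by (rule bij_betw_byWitness[where f' = "\<lambda>(l, r). (l + r, l)"]) auto
  have "comb i c \<otimes>\<^bsub>B\<^esub> u = (\<Oplus>\<^bsub>B\<^esub>l\<in>{..<N}. c l \<odot>\<^bsub>B\<^esub> (b i l \<otimes>\<^bsub>B\<^esub> u))"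
    by (rule mult_comb[OF u i c])
  also have "\<dots> = (\<Oplus>\<^bsub>B\<^esub>l\<in>{..<N}. \<Oplus>\<^bsub>B\<^esub>r\<in>{..<N}. X l r)"
    by (rule B.finsum_cong'[OF refl]) (use summand X in auto)
  also have "\<dots> = (\<Oplus>\<^bsub>B\<^esub>l\<in>{..<N}. \<Oplus>\<^bsub>B\<^esub>r\<in>{..<N - l}. X l r)"
  proof (rule B.finsum_cong'[OF refl])
    fix l assume l: "l \<in> {..<N}"
    \<comment> \<open>Here the total length \<open>l + r\<close> is at least \<open>N\<close>, so
      the path vanishes and the square of index pairs shrinks to a triangle.\<close>
    have "X l r = \<zero>\<^bsub>B\<^esub>" if "r \<notin> {..<N - l}" for r
      using that l c coord_closed[OF u end_in] b_vanish[OF i, of "l + r"] by (simp add: X_def)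
    then show "(\<Oplus>\<^bsub>B\<^esub>r\<in>{..<N}. X l r) = (\<Oplus>\<^bsub>B\<^esub>r\<in>{..<N - l}. X l r)"
      by (intro B.add.finprod_mono_neutral_cong_right) (use l X in auto)
  qed (use X in auto)
  also have "\<dots> = (\<Oplus>\<^bsub>B\<^esub>p\<in>?S'. X (fst p) (snd p))"
    by (rule B.finsum_Sigma) (use X in auto)
  also have "\<dots> = (\<Oplus>\<^bsub>B\<^esub>p\<in>?T. X (fst ((\<lambda>(k, l). (l, k - l)) p)) (snd ((\<lambda>(k, l). (l, k - l)) p)))"
    by (rule B.finsum_reindex_bij[OF bij, symmetric]) (use X in auto)
  also have "\<dots> = (\<Oplus>\<^bsub>B\<^esub>p\<in>?T. X (snd p) (fst p - snd p))" by (simp add: case_prod_unfold)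
  also have "\<dots> = (\<Oplus>\<^bsub>B\<^esub>k\<in>{..<N}. \<Oplus>\<^bsub>B\<^esub>l\<in>{..k}. X l (k - l))"
    by (rule B.finsum_Sigma[symmetric]) (use X in auto)
  also have "\<dots> = comb i (\<lambda>k. \<Oplus>\<^bsub>K\<^esub>l\<in>{..k}. c l \<otimes>\<^bsub>K\<^esub> coord u (cycle_end s i l) (k - l))"
    unfolding comb_def
  proof (rule B.finsum_cong'[OF refl])
    fix k assume k: "k \<in> {..<N}"
    have cl: "c l \<otimes>\<^bsub>K\<^esub> coord u (cycle_end s i l) (k - l) \<in> carrier K" if "l \<le> k" for l
      using that k c coord_closed[OF u end_in] by simp
    have "(\<Oplus>\<^bsub>K\<^esub>l\<in>{..k}. c l \<otimes>\<^bsub>K\<^esub> coord u (cycle_end s i l) (k - l)) \<odot>\<^bsub>B\<^esub> b i k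
      = (\<Oplus>\<^bsub>B\<^esub>l\<in>{..k}. (c l \<otimes>\<^bsub>K\<^esub> coord u (cycle_end s i l) (k - l)) \<odot>\<^bsub>B\<^esub> b i k)"
      by (rule additive_finsum[OF K.is_abelian_group B.is_abelian_group, of "\<lambda>r. r \<odot>\<^bsub>B\<^esub> b i k"])
        (use i cl in \<open>auto simp: smult_l_distr\<close>)
    also have "\<dots> = (\<Oplus>\<^bsub>B\<^esub>l\<in>{..k}. X l (k - l))"
      by (rule B.finsum_cong'[OF refl]) (use k i cl in \<open>auto simp: X_def\<close>)
    finally show "(\<Oplus>\<^bsub>B\<^esub>l\<in>{..k}. X l (k - l))
      = (\<Oplus>\<^bsub>K\<^esub>l\<in>{..k}. c l \<otimes>\<^bsub>K\<^esub> coord u (cycle_end s i l) (k - l)) \<odot>\<^bsub>B\<^esub> b i k" by simp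
  qed (use i c coord_closed[OF u end_in] in \<open>auto intro!: K.finsum_closed smult_closed\<close>)
  finally show ?thesis .
qed

lemma sum_idempotents:
  assumes "t \<in> carrier B"
  shows "t = (\<Oplus>\<^bsub>B\<^esub>i\<in>{1..s}. b i 0 \<otimes>\<^bsub>B\<^esub> t)"
proof -
  have "t = (\<Oplus>\<^bsub>B\<^esub>i\<in>{1..s}. b i 0) \<otimes>\<^bsub>B\<^esub> t" using assms by (simp only: b_one B.l_one)
  also have "\<dots> = (\<Oplus>\<^bsub>B\<^esub>i\<in>{1..s}. b i 0 \<otimes>\<^bsub>B\<^esub> t)"
    using assms by (intro B.finsum_ldistr) auto
  finally show ?thesis .
qed

theorem truncated_cycle_coord: "truncated_cycle K B s N coord"
proof (intro truncated_cycle.intro[OF noncomm_algebra_axioms] truncated_cycle_axioms.intro)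
  fix x y i k assume x: "x \<in> carrier B" and y: "y \<in> carrier B" and i: "i \<in> {1..s}" and k: "k < N"
  note cl = coord_closed[OF x i] coord_closed[OF y i]
  have "comb i (coord x i) \<oplus>\<^bsub>B\<^esub> comb i (coord y i) = comb i (\<lambda>k. coord x i k \<oplus>\<^bsub>K\<^esub> coord y i k)"
    by (rule comb_add[OF i cl])
  then show "coord (x \<oplus>\<^bsub>B\<^esub> y) i k = coord x i k \<oplus>\<^bsub>K\<^esub> coord y i k"
    by (intro coord_eqI)
      (use x y i k cl in \<open>simp_all add: B.r_distr comb_coord\<close>)
  have conv: "(\<Oplus>\<^bsub>K\<^esub>l\<in>{..k}. coord x i l \<otimes>\<^bsub>K\<^esub> coord y (cycle_end s i l) (k - l)) \<in> carrier K" for k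
    using cl coord_closed[OF y end_in] by (intro K.finsum_closed) auto
  show "coord (x \<otimes>\<^bsub>B\<^esub> y) i k = (\<Oplus>\<^bsub>K\<^esub>l\<in>{..k}. coord x i l \<otimes>\<^bsub>K\<^esub> coord y (cycle_end s i l) (k - l))"
  proof (rule coord_eqI)
    show "b i 0 \<otimes>\<^bsub>B\<^esub> (x \<otimes>\<^bsub>B\<^esub> y)
      = comb i (\<lambda>k. \<Oplus>\<^bsub>K\<^esub>l\<in>{..k}. coord x i l \<otimes>\<^bsub>K\<^esub> coord y (cycle_end s i l) (k - l))"
      using comb_mult[of "coord x i", OF cl(1) y i] x y i by (simp add: comb_coord B.m_assoc)
  qed (use x y i k conv in auto)
next
  fix c x i k assume c: "c \<in> carrier K" and x: "x \<in> carrier B" and i: "i \<in> {1..s}" and k: "k < N"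
  note cl = coord_closed[OF x i]
  have "c \<odot>\<^bsub>B\<^esub> comb i (coord x i) = comb i (\<lambda>k. c \<otimes>\<^bsub>K\<^esub> coord x i k)"
    by (rule comb_smult[OF i cl c])
  then show "coord (c \<odot>\<^bsub>B\<^esub> x) i k = c \<otimes>\<^bsub>K\<^esub> coord x i k"
    by (intro coord_eqI)
      (use c x i k cl in \<open>simp_all add: smult_mult_right comb_coord\<close>)
next
  fix x y assume x: "x \<in> carrier B" and y: "y \<in> carrier B"
    and eq: "\<And>i k. \<lbrakk>i \<in> {1..s}; k < N\<rbrakk> \<Longrightarrow> coord x i k = coord y i k"
  have "b i 0 \<otimes>\<^bsub>B\<^esub> x = b i 0 \<otimes>\<^bsub>B\<^esub> y" if i: "i \<in> {1..s}" for i
  proof -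
    have "comb i (coord x i) = comb i (coord y i)"
      by (rule comb_cong[OF eq[OF i] i coord_closed[OF y i]])
    then show ?thesis by (simp only: comb_coord[OF x i] comb_coord[OF y i])
  qed
  then have "(\<Oplus>\<^bsub>B\<^esub>i\<in>{1..s}. b i 0 \<otimes>\<^bsub>B\<^esub> x) = (\<Oplus>\<^bsub>B\<^esub>i\<in>{1..s}. b i 0 \<otimes>\<^bsub>B\<^esub> y)"
    by (intro B.finsum_cong'[OF refl]) (use y in auto)
  then show "x = y" using sum_idempotents[OF x] sum_idempotents[OF y] by simp
next
  fix f :: "nat \<Rightarrow> nat \<Rightarrow> 'k" assume f: "\<And>i k. \<lbrakk>i \<in> {1..s}; k < N\<rbrakk> \<Longrightarrow> f i k \<in> carrier K"
  define x where "x = (\<Oplus>\<^bsub>B\<^esub>i\<in>{1..s}. comb i (f i))"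
  have x: "x \<in> carrier B" unfolding x_def using f by (intro B.finsum_closed) auto
  have "coord x i k = f i k" if i: "i \<in> {1..s}" and k: "k < N" for i k
  proof (rule coord_eqI[OF x i f[OF i] _ k])
    have e: "b i 0 \<otimes>\<^bsub>B\<^esub> comb j (f j) = (if i = j then comb j (f j) else \<zero>\<^bsub>B\<^esub>)" if j: "j \<in> {1..s}" for j
    proof -
      have "b i 0 \<otimes>\<^bsub>B\<^esub> comb j (f j) = (\<Oplus>\<^bsub>B\<^esub>k\<in>{..<N}. f j k \<odot>\<^bsub>B\<^esub> (b i 0 \<otimes>\<^bsub>B\<^esub> b j k))"
        by (rule mult_comb[OF b_closed[OF i] j f[OF j]])
      also have "\<dots> = (if i = j then comb j (f j) else \<zero>\<^bsub>B\<^esub>)"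
        unfolding idempotent_mult[OF i j] comb_def
        by (auto intro!: B.add.finprod_one_eqI simp: f[OF j])
      finally show ?thesis .
    qed
    have "b i 0 \<otimes>\<^bsub>B\<^esub> x = (\<Oplus>\<^bsub>B\<^esub>j\<in>{1..s}. b i 0 \<otimes>\<^bsub>B\<^esub> comb j (f j))"
      unfolding x_def using i f by (intro B.finsum_rdistr) auto
    also have "\<dots> = b i 0 \<otimes>\<^bsub>B\<^esub> comb i (f i)"
      by (rule B.finsum_single) (use i f e in auto)
    also have "\<dots> = comb i (f i)" using e[OF i] by simp
    finally show "b i 0 \<otimes>\<^bsub>B\<^esub> x = comb i (f i)" .
  qed
  then show "\<exists>x\<in>carrier B. \<forall>i\<in>{1..s}. \<forall>k<N. coord x i k = f i k" using x by blast
qed (use s_pos coord_closed in auto)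

end


section \<open>Dimensions of subquotients\<close>

lemma (in module) submodule_criterion:
  assumes "H \<subseteq> carrier M" "\<zero>\<^bsub>M\<^esub> \<in> H" "\<And>x y. \<lbrakk>x \<in> H; y \<in> H\<rbrakk> \<Longrightarrow> x \<oplus>\<^bsub>M\<^esub> y \<in> H"
    and "\<And>c x. \<lbrakk>c \<in> carrier R; x \<in> H\<rbrakk> \<Longrightarrow> c \<odot>\<^bsub>M\<^esub> x \<in> H"
  shows "Module.submodule H R M"
proof (rule submoduleI)
  show "\<ominus>\<^bsub>M\<^esub> x \<in> H" if "x \<in> H" for x
    using assms(4)[of "\<ominus> \<one>" x] assms(1) that by (auto simp: smult_l_minus)
qed (use assms in auto)

lemma (in module) finsum_in_submodule:
  assumes "Module.submodule X R M"
  shows "(\<And>a. a \<in> S \<Longrightarrow> f a \<in> X) \<Longrightarrow> finsum M f S \<in> X"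
proof (induction S rule: infinite_finite_induct)
  case (insert x F)
  then show ?case
    using submoduleE(1,5)[OF assms] by (subst M.finsum_insert) auto
qed (use submodule_zero[OF assms] in auto)

text \<open>The dimension is defined as the least size of a finite generating set; finite
  dimensionality guarantees that this minimum is attained.\<close>

lemma (in vectorspace) generating_set_of_card_dim:
  assumes "fin_dim"
  obtains S where "finite S" "card S = dim" "S \<subseteq> carrier V" "carrier V = {lincomb a S |a. a \<in> S \<rightarrow> carrier K}"
proof -
  have "\<exists>n S. finite S \<and> card S = n \<and> S \<subseteq> carrier V \<and> gen_set S" using assms unfolding fin_dim_def by blast
  from LeastI_ex[OF this] obtain S where S: "finite S" "card S = dim" "S \<subseteq> carrier V" and gen: "gen_set S"
    unfolding dim_def by blast
  show ?thesis by (rule that[OF S trans[OF gen[symmetric] finite_span[OF S(1,3)]]])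
qed

lemma (in vectorspace) carrier_if_dim_0:
  assumes "fin_dim" "dim = 0"
  shows "carrier V = {\<zero>\<^bsub>V\<^esub>}"
proof -
  obtain S where "finite S" "card S = dim" "carrier V = {lincomb a S |a. a \<in> S \<rightarrow> carrier K}"
    using generating_set_of_card_dim[OF assms(1)] .
  then show ?thesis using assms(2) by (auto simp: lincomb_def)
qed

lemma (in vectorspace) dim_1E:
  assumes "fin_dim" "dim = 1"
  obtains v where "v \<in> carrier V" "\<And>x. x \<in> carrier V \<Longrightarrow> \<exists>c\<in>carrier K. x = c \<odot>\<^bsub>V\<^esub> v"
proof -
  obtain S where S: "finite S" "card S = dim" "S \<subseteq> carrier V" "carrier V = {lincomb a S |a. a \<in> S \<rightarrow> carrier K}"
    using generating_set_of_card_dim[OF assms(1)] .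
  then obtain v where v: "S = {v}" using assms(2) by (metis card_1_singletonE)
  show ?thesis
  proof (rule that)
    show "v \<in> carrier V" using S v by simp
    fix x assume "x \<in> carrier V"
    then obtain a where "x = lincomb a {v}" "a \<in> {v} \<rightarrow> carrier K" using S v by auto
    then show "\<exists>c\<in>carrier K. x = c \<odot>\<^bsub>V\<^esub> v"
      using S(3) v by (intro bexI[of _ "a v"]) (auto simp: lincomb_def)
  qed
qed

text \<open>The finite set \<open>Z\<close> makes the quotient of \<open>U\<close> by
  \<open>W\<close> finite dimensional, without which its dimension would say nothing. That
  \<open>Z\<close> spans \<open>U\<close> is phrased through submodules, so that it can be applied
  to any submodule defined by a property.\<close>

locale subquotient = K: field K + module K M
  for K :: "('k, 'm) ring_scheme" and M :: "('k, 'a) module" +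
  fixes U W Z :: "'a set"
  assumes U: "Module.submodule U K M" and W: "Module.submodule W K M" and WU: "W \<subseteq> U"
    and Z: "finite Z" "Z \<subseteq> U"
    and span: "\<And>X. \<lbrakk>Module.submodule X K M; Z \<subseteq> X\<rbrakk> \<Longrightarrow> U \<subseteq> X"
begin

abbreviation "M' \<equiv> M\<lparr>carrier := U\<rparr>"
abbreviation "V \<equiv> quotient_algebra M' W"
abbreviation "cls u \<equiv> W +>\<^bsub>M'\<^esub> u"

interpretation M': module K M'
  by (rule Module.submodule.submodule_is_module[OF U module_axioms])

lemma W_submodule: "Module.submodule W K M'"
proof (rule M'.submodule_criterion)
  show "\<zero>\<^bsub>M'\<^esub> \<in> W" using submodule_zero[OF W] by simp
qed (use WU submoduleE[OF W] in auto)

interpretation V: vectorspace K V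
  by (rule vectorspace.intro[OF quotient_module[OF M'.module_axioms W_submodule] K.field_axioms])

lemma carrier_V: "carrier V = cls ` U"
  using quotient_carrier[OF M'.module_axioms W_submodule] by simp

lemma cls_add: "\<lbrakk>u \<in> U; v \<in> U\<rbrakk> \<Longrightarrow> cls (u \<oplus>\<^bsub>M\<^esub> v) = cls u \<oplus>\<^bsub>V\<^esub> cls v"
  using quotient_add[OF M'.module_axioms W_submodule, of u v] by simp

lemma cls_smult: "\<lbrakk>c \<in> carrier K; u \<in> U\<rbrakk> \<Longrightarrow> cls (c \<odot>\<^bsub>M\<^esub> u) = c \<odot>\<^bsub>V\<^esub> cls u"
  using quotient_smult[OF M'.module_axioms W_submodule, of c u] by simp

lemma cls_zero: "cls \<zero>\<^bsub>M\<^esub> = \<zero>\<^bsub>V\<^esub>"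
  using quotient_zero[OF M'.module_axioms W_submodule] by simp

lemma U_closed:
  shows "u \<in> U \<Longrightarrow> u \<in> carrier M" "\<zero>\<^bsub>M\<^esub> \<in> U"
    "\<lbrakk>u \<in> U; v \<in> U\<rbrakk> \<Longrightarrow> u \<oplus>\<^bsub>M\<^esub> v \<in> U" "\<lbrakk>c \<in> carrier K; u \<in> U\<rbrakk> \<Longrightarrow> c \<odot>\<^bsub>M\<^esub> u \<in> U"
  using submoduleE[OF U] submodule_zero[OF U] by auto

text \<open>Subtraction in \<open>M'\<close> depends on the carrier \<open>U\<close>, whereas
  addition is literally that of \<open>M\<close>; the additive form therefore makes sense in
  \<open>M\<close>.\<close>

lemma cls_eq_iff:
  assumes "u \<in> U" "v \<in> U"
  shows "cls u = cls v \<longleftrightarrow> (\<exists>w\<in>W. u = w \<oplus>\<^bsub>M\<^esub> v)"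
proof -
  have "cls u = cls v \<longleftrightarrow> u \<ominus>\<^bsub>M'\<^esub> v \<in> W"
    using quotient_coset_eq_iff[OF M'.module_axioms W_submodule, of u v] assms by simp
  also have "\<dots> \<longleftrightarrow> (\<exists>w\<in>W. u = w \<oplus>\<^bsub>M'\<^esub> v)"
  proof
    assume "u \<ominus>\<^bsub>M'\<^esub> v \<in> W"
    moreover have "u = (u \<ominus>\<^bsub>M'\<^esub> v) \<oplus>\<^bsub>M'\<^esub> v"
      using M'.M.a_assoc[of u "\<ominus>\<^bsub>M'\<^esub> v" v] M'.M.l_neg[of v] M'.M.a_inv_closed[of v] M'.M.r_zero[of u] assms
      by (simp add: a_minus_def)
    ultimately show "\<exists>w\<in>W. u = w \<oplus>\<^bsub>M'\<^esub> v" by blast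
  next
    assume "\<exists>w\<in>W. u = w \<oplus>\<^bsub>M'\<^esub> v"
    then obtain w where w: "w \<in> W" "u = w \<oplus>\<^bsub>M'\<^esub> v" by blast
    then have "u \<ominus>\<^bsub>M'\<^esub> v = w"
      using M'.M.a_assoc[of w v "\<ominus>\<^bsub>M'\<^esub> v"] M'.M.r_neg[of v] M'.M.a_inv_closed[of v] M'.M.r_zero[of w] assms WU
      by (auto simp: a_minus_def)
    then show "u \<ominus>\<^bsub>M'\<^esub> v \<in> W" using w by simp
  qed
  finally show ?thesis by simp
qed

text \<open>The elements of \<open>U\<close> whose class lies in the span of the classes of
  \<open>Z\<close> form a submodule that contains \<open>Z\<close>, hence they are all of
  \<open>U\<close>.\<close>

lemma fin_dim_V: "V.fin_dim"
proof -
  let ?S = "cls ` Z"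
  have S: "?S \<subseteq> carrier V" using Z carrier_V by auto
  interpret S: LinearCombinations.submodule K "V.span ?S" V by (rule V.span_is_submodule[OF S])
  have "U \<subseteq> {u \<in> U. cls u \<in> V.span ?S}"
  proof (rule span)
    show "Module.submodule {u \<in> U. cls u \<in> V.span ?S} K M"
      by (rule submodule_criterion)
        (auto simp: U_closed cls_add cls_smult cls_zero intro: S.m_closed S.smult_closed S.zero_closed)
    show "Z \<subseteq> {u \<in> U. cls u \<in> V.span ?S}" using Z V.in_own_span[OF S] by blast
  qed
  then have "V.gen_set ?S" using V.span_is_subset2[OF S] carrier_V by auto
  then show ?thesis unfolding V.fin_dim_def using Z S by blast
qed

lemma subset_if_dim_0:
  assumes "vectorspace.dim K V = 0"
  shows "U \<subseteq> W"
proof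
  fix u assume u: "u \<in> U"
  then have "cls u = cls \<zero>\<^bsub>M\<^esub>"
    using V.carrier_if_dim_0[OF fin_dim_V assms] carrier_V cls_zero by auto
  then show "u \<in> W" using u WU U_closed by (auto simp: cls_eq_iff)
qed

text \<open>As \<open>u0\<close> lies outside \<open>W\<close>, its class is a nonzero multiple of a
  generator of the line and can be used as the generator itself.\<close>

lemma decompose_if_dim_1:
  assumes dim: "vectorspace.dim K V = 1" and u0: "u0 \<in> U" "u0 \<notin> W" and u: "u \<in> U"
  shows "\<exists>c\<in>carrier K. \<exists>w\<in>W. u = w \<oplus>\<^bsub>M\<^esub> c \<odot>\<^bsub>M\<^esub> u0"
proof -
  obtain v where v: "v \<in> carrier V" and gen: "\<And>x. x \<in> carrier V \<Longrightarrow> \<exists>c\<in>carrier K. x = c \<odot>\<^bsub>V\<^esub> v"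
    using V.dim_1E[OF fin_dim_V dim] by blast
  obtain c0 where c0: "c0 \<in> carrier K" "cls u0 = c0 \<odot>\<^bsub>V\<^esub> v" using gen[of "cls u0"] u0 carrier_V by auto
  obtain c where c: "c \<in> carrier K" "cls u = c \<odot>\<^bsub>V\<^esub> v" using gen[of "cls u"] u carrier_V by auto
  have "c0 \<noteq> \<zero>\<^bsub>K\<^esub>"
  proof
    assume "c0 = \<zero>\<^bsub>K\<^esub>"
    then have "cls u0 = cls \<zero>\<^bsub>M\<^esub>" using c0 v by (simp add: cls_zero)
    then show False using u0 WU U_closed by (auto simp: cls_eq_iff)
  qed
  then have unit: "c0 \<in> Units K" using c0 K.field_Units by simp
  define d where "d = c \<otimes>\<^bsub>K\<^esub> inv\<^bsub>K\<^esub> c0"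
  have d: "d \<in> carrier K" unfolding d_def using unit c by simp
  have "d \<odot>\<^bsub>V\<^esub> cls u0 = (d \<otimes>\<^bsub>K\<^esub> c0) \<odot>\<^bsub>V\<^esub> v" using c0 d v by (simp add: V.smult_assoc1)
  also have "d \<otimes>\<^bsub>K\<^esub> c0 = c" unfolding d_def using unit c c0(1)
    by (simp add: K.m_assoc K.Units_l_inv K.Units_inv_closed)
  finally have "cls u = cls (d \<odot>\<^bsub>M\<^esub> u0)" using c d u0 by (simp add: cls_smult)
  then show ?thesis using cls_eq_iff[OF u, of "d \<odot>\<^bsub>M\<^esub> u0"] d u0 U_closed by blast
qed

end


section \<open>Hochschild extensions of truncated cycle algebras\<close>

locale cycle_hochschild = truncated_cycle K B s n co + hochschild K B \<alpha>
  for K :: "('k, 'm) ring_scheme" and B :: "('k, 'a) module" and s n co \<alpha> +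
  assumes n: "n \<ge> 2"
begin

sublocale T: noncomm_algebra K T by (rule hochschild_noncomm_algebra)

interpretation D: module K D by (rule dual_module)

lemma end_in: "cycle_end s i k \<in> {1..s}"
  using s_pos by (rule cycle_end_in)

lemma fst_closed [simp]: "t \<in> carrier T \<Longrightarrow> fst t \<in> carrier B"
  and snd_closed [simp]: "t \<in> carrier T \<Longrightarrow> snd t \<in> carrier D"
  by (auto simp: hochschild_carrier)

lemma fst_add: "fst (t \<oplus>\<^bsub>T\<^esub> u) = fst t \<oplus>\<^bsub>B\<^esub> fst u"
  and snd_add: "snd (t \<oplus>\<^bsub>T\<^esub> u) = snd t \<oplus>\<^bsub>D\<^esub> snd u"
  and fst_smult: "fst (c \<odot>\<^bsub>T\<^esub> t) = c \<odot>\<^bsub>B\<^esub> fst t"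
  and fst_mult: "fst (t \<otimes>\<^bsub>T\<^esub> u) = fst t \<otimes>\<^bsub>B\<^esub> fst u"
  and snd_mult: "snd (t \<otimes>\<^bsub>T\<^esub> u) = dual_lact B (fst t) (snd u) \<oplus>\<^bsub>D\<^esub> dual_ract B (snd t) (fst u) \<oplus>\<^bsub>D\<^esub> \<alpha> (fst t) (fst u)"
  and fst_zero: "fst \<zero>\<^bsub>T\<^esub> = \<zero>\<^bsub>B\<^esub>" and snd_zero: "snd \<zero>\<^bsub>T\<^esub> = \<zero>\<^bsub>D\<^esub>"
  and fst_one: "fst \<one>\<^bsub>T\<^esub> = \<one>\<^bsub>B\<^esub>"
  by (cases t; cases u; simp add: hochschild_ops)+

text \<open>The coordinates of the unit are not given. The sum \<open>u\<close> of the trivial paths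
  acts as a left unit by the convolution rule, so \<open>u\<close> times the unit equals the unit,
  and hence \<open>u\<close> is the unit.\<close>

lemma co_one: "\<lbrakk>i \<in> {1..s}; k < n\<rbrakk> \<Longrightarrow> co \<one>\<^bsub>B\<^esub> i k = (if k = 0 then \<one>\<^bsub>K\<^esub> else \<zero>\<^bsub>K\<^esub>)"
proof -
  assume ik: "i \<in> {1..s}" "k < n"
  define u where "u = of_coords (\<lambda>i k. if k = 0 then \<one>\<^bsub>K\<^esub> else \<zero>\<^bsub>K\<^esub>)"
  have u: "u \<in> carrier B" and co_u: "\<And>i k. \<lbrakk>i \<in> {1..s}; k < n\<rbrakk> \<Longrightarrow> co u i k = (if k = 0 then \<one>\<^bsub>K\<^esub> else \<zero>\<^bsub>K\<^esub>)"
    unfolding u_def by (rule of_coords_closed co_of_coords; simp)+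
  have "u \<otimes>\<^bsub>B\<^esub> \<one>\<^bsub>B\<^esub> = \<one>\<^bsub>B\<^esub>"
  proof (rule co_inject)
    fix i k assume ik: "i \<in> {1..s}" "k < n"
    have "co (u \<otimes>\<^bsub>B\<^esub> \<one>\<^bsub>B\<^esub>) i k
        = (\<Oplus>\<^bsub>K\<^esub>l\<in>{..k}. co u i l \<otimes>\<^bsub>K\<^esub> co \<one>\<^bsub>B\<^esub> (cycle_end s i l) (k - l))"
      using u ik by (intro co_mult) auto
    also have "\<dots> = co u i 0 \<otimes>\<^bsub>K\<^esub> co \<one>\<^bsub>B\<^esub> (cycle_end s i 0) (k - 0)"
      by (rule K.finsum_single) (use ik u co_u co_closed[OF B.one_closed end_in] co_closed[OF B.one_closed] in auto)
    also have "\<dots> = co \<one>\<^bsub>B\<^esub> i k"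
      using ik co_u[OF ik(1)] co_closed[OF B.one_closed ik] by simp
    finally show "co (u \<otimes>\<^bsub>B\<^esub> \<one>\<^bsub>B\<^esub>) i k = co \<one>\<^bsub>B\<^esub> i k" .
  qed (use u in auto)
  then show ?thesis using co_u ik u by simp
qed

text \<open>
  The radical filtration: the layers below \<open>n\<close> are the preimages of the powers of the arrow ideal
  of \<open>B\<close>, and the layers \<open>n + k\<close> consist of the functionals that kill the paths of length at least
  \<open>n - k\<close>.
\<close>

definition low :: "nat \<Rightarrow> 'a \<Rightarrow> bool" where
  "low k x \<longleftrightarrow> (\<forall>i\<in>{1..s}. \<forall>l<n. l < k \<longrightarrow> co x i l = \<zero>\<^bsub>K\<^esub>)"

definition layer :: "nat \<Rightarrow> ('a \<times> ('a \<Rightarrow> 'k)) set" where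
  "layer k = {t \<in> carrier T. low k (fst t) \<and>
    (n \<le> k \<longrightarrow> (\<forall>c\<in>carrier B. low (2 * n - k) c \<longrightarrow> snd t c = \<zero>\<^bsub>K\<^esub>))}"

definition rad :: "('a \<times> ('a \<Rightarrow> 'k)) set" where
  "rad = layer 1"

lemma low_mult:
  assumes x: "x \<in> carrier B" "low k x" and y: "y \<in> carrier B" "low l y"
  shows "low (k + l) (x \<otimes>\<^bsub>B\<^esub> y)"
  unfolding low_def
proof (intro ballI allI impI)
  fix i m assume i: "i \<in> {1..s}" and m: "m < n" "m < k + l"
  have "co x i r \<otimes>\<^bsub>K\<^esub> co y (cycle_end s i r) (m - r) = \<zero>\<^bsub>K\<^esub>" if r: "r \<in> {..m}" for r
  proof (cases "r < k")
    case True
    then have "co x i r = \<zero>\<^bsub>K\<^esub>" using x(2) i r m unfolding low_def by auto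
    moreover have "co y (cycle_end s i r) (m - r) \<in> carrier K"
      by (rule co_closed[OF y(1) end_in]) (use m in auto)
    ultimately show ?thesis by simp
  next
    case False
    then have "m - r < l" "m - r < n" using m r by auto
    then have "co y (cycle_end s i r) (m - r) = \<zero>\<^bsub>K\<^esub>" using y(2) end_in unfolding low_def by blast
    moreover have "co x i r \<in> carrier K" by (rule co_closed[OF x(1) i]) (use m r in auto)
    ultimately show ?thesis by simp
  qed
  then show "co (x \<otimes>\<^bsub>B\<^esub> y) i m = \<zero>\<^bsub>K\<^esub>"
    unfolding co_mult[OF x(1) y(1) i m(1)] by (rule K.add.finprod_one_eqI)
qed

lemma low_zero_iff: "x \<in> carrier B \<Longrightarrow> n \<le> k \<Longrightarrow> low k x \<longleftrightarrow> x = \<zero>\<^bsub>B\<^esub>"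
  unfolding low_def by (auto simp: co_zero intro!: co_inject)

lemma low_0 [simp]: "low 0 x" by (simp add: low_def)

lemma dual_zero: "\<phi> \<in> carrier D \<Longrightarrow> \<phi> \<zero>\<^bsub>B\<^esub> = \<zero>\<^bsub>K\<^esub>"
  by (rule additive_zero[OF B.is_abelian_group K.is_abelian_group]) (auto simp: dual_closed dual_add)

lemma cocycle_zero_left: "b \<in> carrier B \<Longrightarrow> \<alpha> \<zero>\<^bsub>B\<^esub> b = \<zero>\<^bsub>D\<^esub>"
  by (rule additive_zero[OF B.is_abelian_group D.M.abelian_group_axioms, of "\<lambda>a. \<alpha> a b"])
    (auto simp: cocycle_add_left)

lemma cocycle_zero_right: "a \<in> carrier B \<Longrightarrow> \<alpha> a \<zero>\<^bsub>B\<^esub> = \<zero>\<^bsub>D\<^esub>"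
  by (rule additive_zero[OF B.is_abelian_group D.M.abelian_group_axioms, of "\<alpha> a"])
    (auto simp: cocycle_add_right)

lemma layer_closed: "t \<in> layer k \<Longrightarrow> t \<in> carrier T"
  by (simp add: layer_def)

text \<open>From layer \<open>n\<close> on the first component of \<open>t\<close> is zero. So the
  cocycle term vanishes, and the functional is precomposed with left multiplication by
  \<open>fst u\<close>, which lengthens paths by at least one. The step from layer
  \<open>n - 1\<close> to layer \<open>n\<close> demands nothing of the functional, because
  \<open>low n c\<close> forces \<open>c\<close> to be zero. This is why the filtration works for
  every cocycle.\<close>

lemma layer_mult:
  assumes t: "t \<in> layer k" and u: "u \<in> rad"
  shows "t \<otimes>\<^bsub>T\<^esub> u \<in> layer (Suc k)"
proof -
  have tT: "t \<in> carrier T" and uT: "u \<in> carrier T" using t u by (auto simp: layer_def rad_def)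
  have lt: "low k (fst t)" and lu: "low 1 (fst u)" using t u by (auto simp: layer_def rad_def)
  have "low (Suc k) (fst (t \<otimes>\<^bsub>T\<^esub> u))"
    using low_mult[OF _ lt _ lu] tT uT by (simp add: fst_mult)
  moreover have "snd (t \<otimes>\<^bsub>T\<^esub> u) c = \<zero>\<^bsub>K\<^esub>"
    if k: "n \<le> Suc k" and c: "c \<in> carrier B" "low (2 * n - Suc k) c" for c
  proof (cases "n \<le> k")
    case True
    then have t0: "fst t = \<zero>\<^bsub>B\<^esub>" using lt tT by (simp add: low_zero_iff)
    have "low (2 * n - k) (fst u \<otimes>\<^bsub>B\<^esub> c)"
    proof (cases "k < 2 * n")
      case True
      then show ?thesis using low_mult[OF _ lu c] uT by (simp add: Suc_diff_Suc)
    qed simp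
    then have "snd t (fst u \<otimes>\<^bsub>B\<^esub> c) = \<zero>\<^bsub>K\<^esub>"
      using t True c uT by (simp add: layer_def)
    then show ?thesis
      using t0 c tT uT by (simp add: snd_mult dual_apply cocycle_zero_left dual_zero)
  next
    case False
    then have "c = \<zero>\<^bsub>B\<^esub>" using k c low_zero_iff[of c "2 * n - Suc k"] by simp
    then show ?thesis using dual_zero tT uT by simp
  qed
  ultimately show ?thesis using tT uT by (simp add: layer_def)
qed

lemma layer_add: "\<lbrakk>t \<in> layer k; u \<in> layer k\<rbrakk> \<Longrightarrow> t \<oplus>\<^bsub>T\<^esub> u \<in> layer k"
  by (auto simp: layer_def low_def fst_add snd_add co_add dual_apply)

lemma layer_top: "layer (2 * n) = {\<zero>\<^bsub>T\<^esub>}"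
proof
  show "layer (2 * n) \<subseteq> {\<zero>\<^bsub>T\<^esub>}"
  proof
    fix t assume t: "t \<in> layer (2 * n)"
    then have tT: "t \<in> carrier T" by (rule layer_closed)
    have "fst t = \<zero>\<^bsub>B\<^esub>" using t tT low_zero_iff[of "fst t" "2 * n"] by (simp add: layer_def)
    moreover have "snd t = \<zero>\<^bsub>D\<^esub>"
      by (rule dual_eqI) (use t tT in \<open>auto simp: layer_def dual_apply\<close>)
    ultimately show "t \<in> {\<zero>\<^bsub>T\<^esub>}" by (simp add: prod_eq_iff fst_zero snd_zero)
  qed
  show "{\<zero>\<^bsub>T\<^esub>} \<subseteq> layer (2 * n)"
    by (auto simp: layer_def fst_zero snd_zero low_def co_zero dual_apply)
qed

text \<open>The condition on functionals in \<open>layer 1\<close> is void because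
  \<open>n \<ge> 2\<close>; in particular all of \<open>D(B)\<close> lies in
  \<open>rad\<close>.\<close>

lemma rad_iff: "t \<in> rad \<longleftrightarrow> t \<in> carrier T \<and> (\<forall>i\<in>{1..s}. co (fst t) i 0 = \<zero>\<^bsub>K\<^esub>)"
  using n by (auto simp: rad_def layer_def low_def)

lemma rad_closed: "t \<in> rad \<Longrightarrow> t \<in> carrier T"
  by (simp add: rad_iff)

lemma co_mult_0:
  "\<lbrakk>x \<in> carrier B; y \<in> carrier B; i \<in> {1..s}\<rbrakk> \<Longrightarrow> co (x \<otimes>\<^bsub>B\<^esub> y) i 0 = co x i 0 \<otimes>\<^bsub>K\<^esub> co y i 0"
  using n by (simp add: co_mult co_closed)

lemma co0_closed: "\<lbrakk>x \<in> carrier B; i \<in> {1..s}\<rbrakk> \<Longrightarrow> co x i 0 \<in> carrier K"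
  using n by (simp add: co_closed)

lemma rad_submodule: "Module.submodule rad K T"
  by (rule T.submodule_criterion)
    (use n in \<open>auto simp: rad_iff fst_add fst_smult fst_zero co_add co_smult co_zero simp del: atLeastAtMost_iff\<close>)

lemma rad_ideal: "ideal rad T"
proof (rule idealI[OF T.B.ring_axioms Module.submodule.axioms(1)[OF rad_submodule]])
  show "x \<otimes>\<^bsub>T\<^esub> t \<in> rad" "t \<otimes>\<^bsub>T\<^esub> x \<in> rad" if "t \<in> rad" "x \<in> carrier T" for t x
    using that by (auto simp: rad_iff fst_mult co_mult_0 co0_closed simp del: atLeastAtMost_iff)
qed

lemma rad_pow: "t \<in> rad \<Longrightarrow> t [^]\<^bsub>T\<^esub> k \<in> (if k = 0 then carrier T else layer k)"
proof (induction k)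
  case (Suc k)
  then show ?case
  proof (cases "k = 0")
    case True
    then show ?thesis using Suc.prems by (simp add: rad_def layer_closed)
  next
    case False
    then show ?thesis using Suc layer_mult by simp
  qed
qed (simp add: T.B.one_closed)

text \<open>The set is the kernel of the algebra homomorphism from \<open>T\<close> onto
  \<open>K\<close> that reads off the coefficient of the trivial path at \<open>i\<close>.\<close>

lemma maximal_right_ideal_vertex:
  assumes i: "i \<in> {1..s}"
  shows "maximal_right_ideal {t \<in> carrier T. co (fst t) i 0 = \<zero>\<^bsub>K\<^esub>} T" (is "maximal_right_ideal ?M T")
proof -
  have "Module.submodule ?M K T"
    by (rule T.submodule_criterion)
      (use n i in \<open>auto simp: fst_add fst_smult fst_zero co_add co_smult co_zero simp del: atLeastAtMost_iff\<close>)
  then have "additive_subgroup ?M T"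
    by (intro additive_subgroup.intro Module.submodule.axioms(1))
  then have "right_ideal ?M T"
    using i by (auto simp: right_ideal_def fst_mult co_mult_0 co0_closed simp del: atLeastAtMost_iff)
  moreover have "?M \<noteq> carrier T"
  proof
    assume "?M = carrier T"
    then have "\<one>\<^bsub>T\<^esub> \<in> ?M" by simp
    then show False using i n by (simp add: fst_one co_one del: atLeastAtMost_iff)
  qed
  moreover have "J = carrier T" if J: "right_ideal J T" "?M \<subseteq> J" "J \<noteq> ?M" for J
  proof -
    interpret J: additive_subgroup J T using J(1) by (simp add: right_ideal_def)
    obtain t where t: "t \<in> J" "t \<notin> ?M" using J by blast
    then have tT: "t \<in> carrier T" by (simp add: J.a_Hcarr)
    let ?c = "co (fst t) i 0"
    have c: "?c \<in> carrier K" using i tT by (simp add: co0_closed del: atLeastAtMost_iff)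
    then have unit: "?c \<in> Units K" using t tT by (simp add: K.field_Units)
    have "u \<in> J" if u: "u \<in> carrier T" for u
    proof -
      \<comment> \<open>The scalar gives \<open>t\<close> the same coefficient at the trivial path
        as \<open>u\<close>, so that their difference falls into the kernel and thus into
        \<open>J\<close>.\<close>
      let ?d = "co (fst u) i 0 \<otimes>\<^bsub>K\<^esub> inv\<^bsub>K\<^esub> ?c"
      let ?w = "t \<otimes>\<^bsub>T\<^esub> (?d \<odot>\<^bsub>T\<^esub> \<one>\<^bsub>T\<^esub>)"
      have d: "?d \<in> carrier K" using unit u i by (simp add: co0_closed del: atLeastAtMost_iff)
      have w: "?w \<in> J" using J(1) t d by (simp add: right_ideal_def)
      then have wT: "?w \<in> carrier T" by (rule J.a_Hcarr)
      have fw: "fst ?w = ?d \<odot>\<^bsub>B\<^esub> fst t" using tT d by (simp add: fst_mult fst_smult fst_one smult_mult_right)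
      have "co (fst ?w) i 0 = ?d \<otimes>\<^bsub>K\<^esub> ?c"
        unfolding fw by (rule co_smult) (use tT d i n in auto)
      also have "\<dots> = co (fst u) i 0"
        using unit u i c by (simp add: co0_closed K.m_assoc K.Units_l_inv del: atLeastAtMost_iff)
      finally have "co (fst u) i 0 = co (fst ?w) i 0" by simp
      define v where "v = u \<ominus>\<^bsub>T\<^esub> ?w"
      have v: "v \<in> carrier T" unfolding v_def using u wT by simp
      have uv: "u = v \<oplus>\<^bsub>T\<^esub> ?w" unfolding v_def using u wT by (simp add: T.B.minus_eq T.B.a_assoc T.B.l_neg)
      have "co (fst u) i 0 = co (fst v) i 0 \<oplus>\<^bsub>K\<^esub> co (fst ?w) i 0"
        using v wT i n arg_cong[OF uv, of "\<lambda>u. co (fst u) i 0"] by (simp add: fst_add co_add del: atLeastAtMost_iff)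
      then have "co (fst u) i 0 = co (fst v) i 0 \<oplus>\<^bsub>K\<^esub> co (fst u) i 0"
        unfolding \<open>co (fst u) i 0 = co (fst ?w) i 0\<close>[symmetric] .
      then have "co (fst v) i 0 = \<zero>\<^bsub>K\<^esub>"
        using K.add.r_cancel_one'[of "co (fst u) i 0" "co (fst v) i 0"] co0_closed[OF _ i] u v by simp
      then have "v \<in> J" using v J(2) by blast
      then show ?thesis using w by (subst uv) (rule J.a_closed)
    qed
    moreover have "J \<subseteq> carrier T" by (rule J.a_subset)
    ultimately show ?thesis by blast
  qed
  ultimately show ?thesis unfolding maximal_right_ideal_def by blast
qed

text \<open>One inclusion holds because \<open>rad\<close> is the intersection of the kernels at the
  vertices. The other holds because elements of \<open>rad\<close> are nilpotent, and such an ideal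
  lies in every maximal right ideal.\<close>

lemma jacobson_radical_eq: "jacobson_radical T = rad"
proof
  show "jacobson_radical T \<subseteq> rad"
  proof
    fix t assume t: "t \<in> jacobson_radical T"
    have "co (fst t) i 0 = \<zero>\<^bsub>K\<^esub>" if "i \<in> {1..s}" for i
      using t maximal_right_ideal_vertex[OF that] unfolding jacobson_radical_def by blast
    then show "t \<in> rad" using t unfolding rad_iff jacobson_radical_def by blast
  qed
  show "rad \<subseteq> jacobson_radical T"
  proof
    fix p assume p: "p \<in> rad"
    then have pT: "p \<in> carrier T" by (rule rad_closed)
    have "p \<in> M" if M: "maximal_right_ideal M T" for M
    proof (rule ccontr)
      assume pM: "p \<notin> M"
      have rM: "right_ideal M T" and proper: "M \<noteq> carrier T" using M by (auto simp: maximal_right_ideal_def)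
      interpret M: additive_subgroup M T using rM by (simp add: right_ideal_def)
      \<comment> \<open>This is the right ideal generated by \<open>M\<close> and \<open>p\<close>,
        which is everything by maximality; so the unit is an element of \<open>M\<close> plus an
        element of \<open>rad\<close>.\<close>
      define J where "J = {m \<oplus>\<^bsub>T\<^esub> p \<otimes>\<^bsub>T\<^esub> x |m x. m \<in> M \<and> x \<in> carrier T}"
      have JI: "m \<oplus>\<^bsub>T\<^esub> p \<otimes>\<^bsub>T\<^esub> x \<in> J" if "m \<in> M" "x \<in> carrier T" for m x
        unfolding J_def using that by blast
      have "right_ideal J T"
        unfolding right_ideal_def
      proof (intro conjI ballI)
        show "additive_subgroup J T"
        proof (rule additive_subgroup.intro, rule T.B.add.subgroupI)
          show "J \<subseteq> carrier T" unfolding J_def using pT M.a_Hcarr by auto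
          show "J \<noteq> {}" using JI[OF M.zero_closed T.B.zero_closed] by blast
          fix a assume "a \<in> J"
          then obtain m x where a: "a = m \<oplus>\<^bsub>T\<^esub> p \<otimes>\<^bsub>T\<^esub> x" "m \<in> M" "x \<in> carrier T" unfolding J_def by blast
          have "\<ominus>\<^bsub>T\<^esub> m \<oplus>\<^bsub>T\<^esub> p \<otimes>\<^bsub>T\<^esub> (\<ominus>\<^bsub>T\<^esub> x) \<in> J" using a by (intro JI) auto
          then show "\<ominus>\<^bsub>T\<^esub> a \<in> J"
            using a pT M.a_Hcarr by (simp add: T.B.minus_add T.B.r_minus T.B.a_comm)
          fix b assume "b \<in> J"
          then obtain m' x' where b: "b = m' \<oplus>\<^bsub>T\<^esub> p \<otimes>\<^bsub>T\<^esub> x'" "m' \<in> M" "x' \<in> carrier T" unfolding J_def by blast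
          have "(m \<oplus>\<^bsub>T\<^esub> m') \<oplus>\<^bsub>T\<^esub> p \<otimes>\<^bsub>T\<^esub> (x \<oplus>\<^bsub>T\<^esub> x') \<in> J" using a b by (intro JI) auto
          then show "a \<oplus>\<^bsub>T\<^esub> b \<in> J"
            using a b pT M.a_Hcarr by (simp add: T.B.r_distr T.B.a_ac)
        qed
        fix a x assume "a \<in> J" and x: "x \<in> carrier T"
        then obtain m y where a: "a = m \<oplus>\<^bsub>T\<^esub> p \<otimes>\<^bsub>T\<^esub> y" "m \<in> M" "y \<in> carrier T" unfolding J_def by blast
        have "m \<otimes>\<^bsub>T\<^esub> x \<in> M" using rM a x by (simp add: right_ideal_def)
        then have "m \<otimes>\<^bsub>T\<^esub> x \<oplus>\<^bsub>T\<^esub> p \<otimes>\<^bsub>T\<^esub> (y \<otimes>\<^bsub>T\<^esub> x) \<in> J" using a x by (intro JI) auto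
        then show "a \<otimes>\<^bsub>T\<^esub> x \<in> J" using a x pT M.a_Hcarr by (simp add: T.B.l_distr T.B.m_assoc)
      qed
      moreover have "M \<subseteq> J"
      proof
        fix m assume m: "m \<in> M"
        then show "m \<in> J" using JI[OF m T.B.zero_closed] pT M.a_Hcarr[OF m] by simp
      qed
      moreover have "p \<in> J" using JI[OF M.zero_closed T.B.one_closed] pT by simp
      ultimately have "J = carrier T" using M pM unfolding maximal_right_ideal_def by blast
      then obtain m x where m: "m \<in> M" and x: "x \<in> carrier T" and one: "\<one>\<^bsub>T\<^esub> = m \<oplus>\<^bsub>T\<^esub> p \<otimes>\<^bsub>T\<^esub> x"
        using T.B.one_closed unfolding J_def by blast
      define q where "q = p \<otimes>\<^bsub>T\<^esub> x"
      have q: "q \<in> rad" unfolding q_def using p x by (rule ideal.I_r_closed[OF rad_ideal])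
      have qT: "q \<in> carrier T" using q by (rule rad_closed)
      have mT: "m \<in> carrier T" using m by (rule M.a_Hcarr)
      \<comment> \<open>Writing the last power as \<open>(m + q)\<close> times itself moves one
        summand into \<open>M\<close> and raises the exponent by one. At exponent
        \<open>2 * n\<close> the power vanishes and the unit lies in \<open>M\<close>.\<close>
      have "\<exists>y\<in>M. \<one>\<^bsub>T\<^esub> = y \<oplus>\<^bsub>T\<^esub> q [^]\<^bsub>T\<^esub> k" for k :: nat
      proof (induction k)
        case 0
        show ?case using M.zero_closed by (intro bexI[of _ "\<zero>\<^bsub>T\<^esub>"]) auto
      next
        case (Suc k)
        then obtain y where y: "y \<in> M" "\<one>\<^bsub>T\<^esub> = y \<oplus>\<^bsub>T\<^esub> q [^]\<^bsub>T\<^esub> k" by blast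
        have "q [^]\<^bsub>T\<^esub> k = (m \<oplus>\<^bsub>T\<^esub> q) \<otimes>\<^bsub>T\<^esub> q [^]\<^bsub>T\<^esub> k" 
          unfolding one[folded q_def, symmetric] using qT by simp
        also have "\<dots> = m \<otimes>\<^bsub>T\<^esub> q [^]\<^bsub>T\<^esub> k \<oplus>\<^bsub>T\<^esub> q [^]\<^bsub>T\<^esub> Suc k"
          using mT qT T.B.nat_pow_Suc2[OF qT, of k] by (simp add: T.B.l_distr)
        finally have e: "q [^]\<^bsub>T\<^esub> k = m \<otimes>\<^bsub>T\<^esub> q [^]\<^bsub>T\<^esub> k \<oplus>\<^bsub>T\<^esub> q [^]\<^bsub>T\<^esub> Suc k" .
        have z: "m \<otimes>\<^bsub>T\<^esub> q [^]\<^bsub>T\<^esub> k \<in> M" using rM m qT by (simp add: right_ideal_def)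
        have "\<one>\<^bsub>T\<^esub> = y \<oplus>\<^bsub>T\<^esub> (m \<otimes>\<^bsub>T\<^esub> q [^]\<^bsub>T\<^esub> k \<oplus>\<^bsub>T\<^esub> q [^]\<^bsub>T\<^esub> Suc k)"
          using y(2) e by simp
        also have "\<dots> = (y \<oplus>\<^bsub>T\<^esub> m \<otimes>\<^bsub>T\<^esub> q [^]\<^bsub>T\<^esub> k) \<oplus>\<^bsub>T\<^esub> q [^]\<^bsub>T\<^esub> Suc k"
          by (rule T.B.a_assoc[symmetric]) (use y z M.a_Hcarr qT in auto)
        finally show ?case using M.a_closed[OF y(1) z] by blast
      qed
      from this[of "2 * n"] have "\<one>\<^bsub>T\<^esub> \<in> M"
        using rad_pow[OF q, of "2 * n"] n layer_top M.a_Hcarr by auto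
      then have "x \<in> M" if "x \<in> carrier T" for x
        using rM that T.B.l_one[OF that] unfolding right_ideal_def by metis
      then show False using proper M.a_subset by blast
    qed
    then show "p \<in> jacobson_radical T" using pT unfolding jacobson_radical_def by blast
  qed
qed

end

section \<open>Products of basis paths\<close>

context truncated_cycle
begin

lemma co_path_basis_mult:
  assumes y: "y \<in> carrier B" and i: "i \<in> {1..s}" and a: "a \<in> {1..s}" and k: "k < m" and l: "l < m"
  shows "co (path_basis i k \<otimes>\<^bsub>B\<^esub> y) a l
    = (if a = i \<and> k \<le> l then co y (cycle_end s i k) (l - k) else \<zero>\<^bsub>K\<^esub>)" (is "?L = _")
proof -
  have L: "?L = (\<Oplus>\<^bsub>K\<^esub>r\<in>{..l}. co (path_basis i k) a r \<otimes>\<^bsub>K\<^esub> co y (cycle_end s a r) (l - r))"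
    by (rule co_mult) (use y a l in auto)
  have cl: "co y (cycle_end s a r) (l - r) \<in> carrier K" for r
    by (rule co_closed[OF y cycle_end_in[OF s_pos]]) (use l in simp)
  have z: "co (path_basis i k) a r \<otimes>\<^bsub>K\<^esub> co y (cycle_end s a r) (l - r)
      = (if a = i \<and> r = k then co y (cycle_end s a r) (l - r) else \<zero>\<^bsub>K\<^esub>)" if "r \<in> {..l}" for r
    using that a l cl[of r] by (auto simp: co_path_basis simp del: atLeastAtMost_iff)
  show ?thesis
  proof (cases "a = i \<and> k \<le> l")
    case True
    have "?L = co (path_basis i k) a k \<otimes>\<^bsub>K\<^esub> co y (cycle_end s a k) (l - k)"
      unfolding L by (rule K.finsum_single) (use True z cl in auto)
    then show ?thesis using True z[of k] by simp
  next
    case False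
    have "?L = \<zero>\<^bsub>K\<^esub>"
      unfolding L by (rule K.add.finprod_one_eqI) (use False z in auto)
    with False show ?thesis by auto
  qed
qed

lemma co_mult_vertex:
  assumes y: "y \<in> carrier B" and j: "j \<in> {1..s}" and a: "a \<in> {1..s}" and l: "l < m"
  shows "co (y \<otimes>\<^bsub>B\<^esub> path_basis j 0) a l = (if cycle_end s a l = j then co y a l else \<zero>\<^bsub>K\<^esub>)"
proof -
  have z: "co (path_basis j 0) (cycle_end s a r) (l - r)
      = (if cycle_end s a r = j \<and> l - r = 0 then \<one>\<^bsub>K\<^esub> else \<zero>\<^bsub>K\<^esub>)" for r
    by (rule co_path_basis[OF cycle_end_in[OF s_pos]]) (use l in simp)
  have cl: "co y a r \<in> carrier K" if "r \<le> l" for r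
    by (rule co_closed[OF y a]) (use l that in simp)
  have "co (y \<otimes>\<^bsub>B\<^esub> path_basis j 0) a l
      = (\<Oplus>\<^bsub>K\<^esub>r\<in>{..l}. co y a r \<otimes>\<^bsub>K\<^esub> co (path_basis j 0) (cycle_end s a r) (l - r))"
    by (rule co_mult) (use y a l in auto)
  also have "\<dots> = co y a l \<otimes>\<^bsub>K\<^esub> co (path_basis j 0) (cycle_end s a l) (l - l)"
    by (rule K.finsum_single) (use cl z[of l] in \<open>auto simp: z\<close>)
  also have "\<dots> = (if cycle_end s a l = j then co y a l else \<zero>\<^bsub>K\<^esub>)"
    using cl[of l] z[of l] by auto
  finally show ?thesis .
qed

lemma path_basis_vanish: "k \<ge> m \<Longrightarrow> path_basis i k = \<zero>\<^bsub>B\<^esub>"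
  by (rule co_inject) (auto simp: co_path_basis co_zero)

lemma path_basis_mult:
  assumes i: "i \<in> {1..s}" and j: "j \<in> {1..s}"
  shows "path_basis i k \<otimes>\<^bsub>B\<^esub> path_basis j l
    = (if j = cycle_end s i k then path_basis i (k + l) else \<zero>\<^bsub>B\<^esub>)"
proof (cases "k < m")
  case True
  show ?thesis
  proof (rule co_inject)
    fix a r assume a: "a \<in> {1..s}" and r: "r < m"
    show "co (path_basis i k \<otimes>\<^bsub>B\<^esub> path_basis j l) a r
        = co (if j = cycle_end s i k then path_basis i (k + l) else \<zero>\<^bsub>B\<^esub>) a r"
      using a r True co_path_basis_mult[OF path_basis_closed i a True r]
        co_path_basis[OF cycle_end_in[OF s_pos], of "r - k" j l i k]
      by (auto simp: co_path_basis co_zero simp del: atLeastAtMost_iff)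
  qed auto
qed (simp add: path_basis_vanish)

end

text \<open>Describing the corner by fixed points instead of an image makes it a subset of
  \<open>I\<close> cut out by a linear condition, hence visibly a submodule.\<close>

lemma (in ring) peirce_corner_ideal:
  assumes I: "ideal I R" and e: "idempotent_elem R e" "idempotent_elem R f"
  shows "peirce_corner R e I f = {x \<in> I. e \<otimes> x \<otimes> f = x}"
proof -
  interpret I: ideal I R by fact
  have ef: "e \<in> carrier R" "f \<in> carrier R" "e \<otimes> e = e" "f \<otimes> f = f"
    using e by (auto simp: idempotent_elem_def)
  have "e \<otimes> x \<otimes> f \<in> I" "e \<otimes> (e \<otimes> x \<otimes> f) \<otimes> f = e \<otimes> x \<otimes> f" if x: "x \<in> I" for x
  proof -
    show "e \<otimes> x \<otimes> f \<in> I" using x ef by (simp add: I.I_l_closed I.I_r_closed)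
    have xR: "x \<in> carrier R" using x by (rule I.a_Hcarr)
    have "e \<otimes> (e \<otimes> x \<otimes> f) \<otimes> f = (e \<otimes> e) \<otimes> x \<otimes> (f \<otimes> f)"
      using ef(1,2) xR by (simp only: m_assoc m_closed)
    then show "e \<otimes> (e \<otimes> x \<otimes> f) \<otimes> f = e \<otimes> x \<otimes> f" using ef by simp
  qed
  then show ?thesis unfolding peirce_corner_def by (auto intro: rev_image_eqI)
qed

section \<open>A spanning set of the radical and its powers\<close>

context cycle_hochschild
begin

interpretation D: module K D by (rule dual_module)

definition dual_path :: "nat \<Rightarrow> nat \<Rightarrow> 'a \<Rightarrow> 'k" where
  "dual_path i k = (\<lambda>x\<in>carrier B. co x i k)"

lemma dual_path_closed: "\<lbrakk>i \<in> {1..s}; k < n\<rbrakk> \<Longrightarrow> dual_path i k \<in> carrier D"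
  by (rule dual_memI) (auto simp: dual_path_def co_closed co_add co_smult)

text \<open>The paths of positive length together with the dual basis of \<open>D(B)\<close>. This
  is a linear spanning set, not a set of algebra generators; it serves to make the corners finite
  dimensional.\<close>

definition rad_gens :: "('a \<times> ('a \<Rightarrow> 'k)) set" where
  "rad_gens = (\<lambda>(i, k). (path_basis i k, \<zero>\<^bsub>D\<^esub>)) ` ({1..s} \<times> {1..<n}) \<union>
    (\<lambda>(i, k). (\<zero>\<^bsub>B\<^esub>, dual_path i k)) ` ({1..s} \<times> {..<n})"

lemma rad_gens: "finite rad_gens" "rad_gens \<subseteq> rad"
proof -
  show "finite rad_gens" by (simp add: rad_gens_def)
  have "(path_basis i k, \<zero>\<^bsub>D\<^esub>) \<in> rad" if "i \<in> {1..s}" "k \<in> {1..<n}" for i k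
    using that n by (auto simp: rad_iff hochschild_carrier co_path_basis)
  moreover have "(\<zero>\<^bsub>B\<^esub>, dual_path i k) \<in> rad" if "i \<in> {1..s}" "k < n" for i k
    using that n dual_path_closed[OF that] by (auto simp: rad_iff hochschild_carrier co_zero)
  ultimately show "rad_gens \<subseteq> rad" unfolding rad_gens_def by auto
qed

lemma rad_span:
  assumes X: "Module.submodule X K T" and gens: "rad_gens \<subseteq> X"
  shows "rad \<subseteq> X"
proof
  fix t assume t: "t \<in> rad"
  define a where "a = fst t"
  define \<phi> where "\<phi> = snd t"
  have a: "a \<in> carrier B" and \<phi>: "\<phi> \<in> carrier D" using t rad_closed by (auto simp: a_def \<phi>_def)
  have a0: "co a i 0 = \<zero>\<^bsub>K\<^esub>" if "i \<in> {1..s}" for i using t that by (simp add: rad_iff a_def)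
  let ?S = "{1..s} \<times> {..<n}"
  have S: "fst p \<in> {1..s}" "snd p < n" if "p \<in> ?S" for p using that by auto
  have "(a, \<zero>\<^bsub>D\<^esub>) \<in> X"
  proof -
    let ?f = "\<lambda>p. co a (fst p) (snd p) \<odot>\<^bsub>B\<^esub> path_basis (fst p) (snd p)"
    have fB: "?f p \<in> carrier B" if "p \<in> ?S" for p
      by (rule smult_closed[OF co_closed[OF a S[OF that]] path_basis_closed])
    have "(a, \<zero>\<^bsub>D\<^esub>) = (\<Oplus>\<^bsub>T\<^esub>p\<in>?S. (?f p, \<zero>\<^bsub>D\<^esub>))"
      by (subst expand[OF a], rule additive_finsum[OF B.is_abelian_group T.B.is_abelian_group])
        (use fB in \<open>auto simp: hochschild_ops\<close>)
    also have "\<dots> \<in> X"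
    proof (rule T.finsum_in_submodule[OF X])
      fix p assume p: "p \<in> ?S"
      have eq: "(?f p, \<zero>\<^bsub>D\<^esub>) = co a (fst p) (snd p) \<odot>\<^bsub>T\<^esub> (path_basis (fst p) (snd p), \<zero>\<^bsub>D\<^esub>)"
        using co_closed[OF a S[OF p]] by (simp add: hochschild_smult)
      show "(?f p, \<zero>\<^bsub>D\<^esub>) \<in> X"
      proof (cases "snd p = 0")
        case True
        then have "(?f p, \<zero>\<^bsub>D\<^esub>) = \<zero>\<^bsub>T\<^esub>" using a0[OF S(1)[OF p]] by (simp add: hochschild_zero)
        then show ?thesis using submodule_zero[OF X] by simp
      next
        case False
        then have "p \<in> {1..s} \<times> {1..<n}" using p by auto
        then have "(path_basis (fst p) (snd p), \<zero>\<^bsub>D\<^esub>) \<in> X"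
          using gens unfolding rad_gens_def by (auto simp: image_iff case_prod_unfold)
        then show ?thesis unfolding eq
          by (rule Module.submodule.smult_closed[OF X co_closed[OF a S[OF p]]])
      qed
    qed
    finally show ?thesis .
  qed
  moreover have "(\<zero>\<^bsub>B\<^esub>, \<phi>) \<in> X"
  proof -
    let ?f = "\<lambda>p. \<phi> (path_basis (fst p) (snd p)) \<odot>\<^bsub>D\<^esub> dual_path (fst p) (snd p)"
    have \<phi>K: "\<phi> (path_basis (fst p) (snd p)) \<in> carrier K" for p
      by (rule dual_closed[OF \<phi> path_basis_closed])
    have fD: "?f p \<in> carrier D" if "p \<in> ?S" for p
      by (rule dual_smult_closed[OF \<phi>K dual_path_closed[OF S[OF that]]])
    have \<phi>_eq: "\<phi> = finsum D ?f ?S"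
    proof (rule dual_eqI[OF \<phi>])
      show "finsum D ?f ?S \<in> carrier D" by (rule D.M.finsum_closed) (use fD in auto)
      fix x assume x: "x \<in> carrier B"
      have cK: "co x (fst p) (snd p) \<in> carrier K" if "p \<in> ?S" for p by (rule co_closed[OF x S[OF that]])
      have "\<phi> x = (\<Oplus>\<^bsub>K\<^esub>p\<in>?S. \<phi> (co x (fst p) (snd p) \<odot>\<^bsub>B\<^esub> path_basis (fst p) (snd p)))"
        by (subst (1) expand[OF x], rule additive_finsum[OF B.is_abelian_group K.is_abelian_group])
          (use \<phi> cK in \<open>auto simp: dual_closed dual_add\<close>)
      also have "\<dots> = (\<Oplus>\<^bsub>K\<^esub>p\<in>?S. ?f p x)"
        by (rule K.finsum_cong'[OF refl])
          (use \<phi> cK \<phi>K x in \<open>auto simp: dual_smult smult_dual_apply dual_path_def K.m_comm\<close>)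
      also have "\<dots> = finsum D ?f ?S x"
        by (rule additive_finsum[OF D.M.abelian_group_axioms K.is_abelian_group, of "\<lambda>\<psi>. \<psi> x", symmetric])
          (use fD x in \<open>auto simp: dual_closed add_dual_apply\<close>)
      finally show "\<phi> x = finsum D ?f ?S x" .
    qed
    have "(\<zero>\<^bsub>B\<^esub>, \<phi>) = (\<Oplus>\<^bsub>T\<^esub>p\<in>?S. (\<zero>\<^bsub>B\<^esub>, ?f p))"
      by (subst \<phi>_eq, rule additive_finsum[OF D.M.abelian_group_axioms T.B.is_abelian_group])
        (use fD in \<open>auto simp: hochschild_ops\<close>)
    also have "\<dots> \<in> X"
    proof (rule T.finsum_in_submodule[OF X])
      fix p assume p: "p \<in> ?S"
      have "(\<zero>\<^bsub>B\<^esub>, ?f p) = \<phi> (path_basis (fst p) (snd p)) \<odot>\<^bsub>T\<^esub> (\<zero>\<^bsub>B\<^esub>, dual_path (fst p) (snd p))"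
        using \<phi>K by (simp add: hochschild_smult)
      also have "\<dots> \<in> X"
        by (rule Module.submodule.smult_closed[OF X \<phi>K])
          (use p gens in \<open>auto simp: rad_gens_def image_iff case_prod_unfold\<close>)
      finally show "(\<zero>\<^bsub>B\<^esub>, ?f p) \<in> X" .
    qed
    finally show ?thesis .
  qed
  ultimately have "(a, \<zero>\<^bsub>D\<^esub>) \<oplus>\<^bsub>T\<^esub> (\<zero>\<^bsub>B\<^esub>, \<phi>) \<in> X"
    by (rule T.submoduleE(5)[OF X])
  then show "t \<in> X" using a \<phi> by (simp add: hochschild_add a_def \<phi>_def)
qed

text \<open>The recursion starts at \<open>rad\<close>, so \<open>rad_power k\<close> is the power
  with exponent \<open>k + 1\<close>.\<close>

primrec rad_power :: "nat \<Rightarrow> ('a \<times> ('a \<Rightarrow> 'k)) set" where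
  "rad_power 0 = rad"
| "rad_power (Suc k) = ideal_prod T (rad_power k) rad"

lemma rad_power_ideal: "ideal (rad_power k) T"
  by (induction k) (simp_all add: rad_ideal T.B.ideal_prod_is_ideal)

lemma rad_power_closed: "t \<in> rad_power k \<Longrightarrow> t \<in> carrier T"
  using ideal.Icarr[OF rad_power_ideal] .

text \<open>This bound serves twice: it makes the power with exponent \<open>2 * n\<close> vanish,
  and it keeps the lifted arrows out of the square of the radical.\<close>

lemma rad_power_layer: "rad_power k \<subseteq> layer (Suc k)"
proof (induction k)
  case (Suc k)
  have "t \<in> layer (Suc (Suc k))" if "t \<in> ideal_prod T (rad_power k) rad" for t
    using that
  proof (induction rule: ideal_prod.induct)
    case (prod i j)
    then show ?case using layer_mult Suc.IH by blast
  qed (rule layer_add)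
  then show ?case by auto
qed (simp add: rad_def)

text \<open>The powers are built by right multiplication with \<open>rad\<close>, so a factor from
  its square has to be split and absorbed in two steps by associativity.\<close>

lemma rad_power_mult:
  assumes a: "a \<in> rad_power k" and q: "q \<in> rad_power 1"
  shows "a \<otimes>\<^bsub>T\<^esub> q \<in> rad_power (Suc (Suc k))"
proof -
  have "q \<in> ideal_prod T rad rad" using q by simp
  then have "q \<in> carrier T \<and> a \<otimes>\<^bsub>T\<^esub> q \<in> rad_power (Suc (Suc k))"
  proof (induction rule: ideal_prod.induct)
    case (prod r r')
    have "a \<otimes>\<^bsub>T\<^esub> r \<in> rad_power (Suc k)" using a prod by (auto intro: ideal_prod.prod)
    then have "a \<otimes>\<^bsub>T\<^esub> r \<otimes>\<^bsub>T\<^esub> r' \<in> rad_power (Suc (Suc k))"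
      using prod by (subst rad_power.simps(2)) (rule ideal_prod.prod)
    then show ?case using prod rad_closed rad_power_closed[OF a] by (simp add: T.B.m_assoc)
  next
    case (sum q q')
    then have "a \<otimes>\<^bsub>T\<^esub> q \<oplus>\<^bsub>T\<^esub> a \<otimes>\<^bsub>T\<^esub> q' \<in> rad_power (Suc (Suc k))"
      by (subst rad_power.simps(2), intro ideal_prod.sum) simp_all
    then show ?case using sum rad_power_closed[OF a] by (simp add: T.B.r_distr)
  qed
  then show ?thesis ..
qed

end

section \<open>Lifted arrows and their products\<close>

locale cycle_hochschild_quiver = cycle_hochschild K B s n co \<alpha>
  for K :: "('k, 'm) ring_scheme" and B :: "('k, 'a) module" and s n co \<alpha> +
  fixes e :: "nat \<Rightarrow> 'a \<times> ('a \<Rightarrow> 'k)"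
  assumes e_closed [simp]: "i \<in> {1..s} \<Longrightarrow> e i \<in> carrier T"
    and e_mult: "\<lbrakk>i \<in> {1..s}; j \<in> {1..s}\<rbrakk> \<Longrightarrow> e i \<otimes>\<^bsub>T\<^esub> e j = (if i = j then e i else \<zero>\<^bsub>T\<^esub>)"
    and e_sum: "(\<Oplus>\<^bsub>T\<^esub>i\<in>{1..s}. e i) = \<one>\<^bsub>T\<^esub>"
    and fst_e: "i \<in> {1..s} \<Longrightarrow> fst (e i) = path_basis i 0"
    and quiver: "\<lbrakk>i \<in> {1..s}; j \<in> {1..s}\<rbrakk> \<Longrightarrow>
      num_quiver_arrows K T (e i) (e j) = (if j = cycle_end s i 1 then 1 else 0)"
begin

interpretation D: module K D by (rule dual_module)

text \<open>The lift with zero functional need not lie in the right corner, so it is cut down by the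
  idempotents of \<open>T\<close>. The functional this creates depends on the cocycle and is never
  computed.\<close>

definition arrow :: "nat \<Rightarrow> 'a \<times> ('a \<Rightarrow> 'k)" where
  "arrow i = e i \<otimes>\<^bsub>T\<^esub> (path_basis i 1, \<zero>\<^bsub>D\<^esub>) \<otimes>\<^bsub>T\<^esub> e (cycle_end s i 1)"

lemma e_end_closed [simp]: "e (cycle_end s i k) \<in> carrier T"
  by (rule e_closed[OF end_in])

lemma arrow_closed [simp]: "i \<in> {1..s} \<Longrightarrow> arrow i \<in> carrier T"
  unfolding arrow_def by (intro T.B.m_closed e_closed e_end_closed) (simp_all add: hochschild_carrier)

lemma fst_arrow: "i \<in> {1..s} \<Longrightarrow> fst (arrow i) = path_basis i 1"
  unfolding arrow_def
  by (simp add: fst_mult fst_e fst_e[OF end_in] path_basis_mult path_basis_mult[OF _ end_in] del: atLeastAtMost_iff)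

lemma e_arrow: "i \<in> {1..s} \<Longrightarrow> e i \<otimes>\<^bsub>T\<^esub> arrow i = arrow i"
  and arrow_e: "\<lbrakk>i \<in> {1..s}; j \<in> {1..s}\<rbrakk> \<Longrightarrow>
    arrow i \<otimes>\<^bsub>T\<^esub> e j = (if j = cycle_end s i 1 then arrow i else \<zero>\<^bsub>T\<^esub>)"
proof -
  assume i: "i \<in> {1..s}"
  have v: "(path_basis i 1, \<zero>\<^bsub>D\<^esub>) \<in> carrier T" by (simp add: hochschild_carrier)
  have "e i \<otimes>\<^bsub>T\<^esub> arrow i = (e i \<otimes>\<^bsub>T\<^esub> e i) \<otimes>\<^bsub>T\<^esub> (path_basis i 1, \<zero>\<^bsub>D\<^esub>) \<otimes>\<^bsub>T\<^esub> e (cycle_end s i 1)"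
    unfolding arrow_def using i v by (simp only: T.B.m_assoc T.B.m_closed e_closed e_end_closed)
  then show "e i \<otimes>\<^bsub>T\<^esub> arrow i = arrow i" using e_mult[OF i i] by (simp add: arrow_def)
  assume j: "j \<in> {1..s}"
  have "arrow i \<otimes>\<^bsub>T\<^esub> e j = (e i \<otimes>\<^bsub>T\<^esub> (path_basis i 1, \<zero>\<^bsub>D\<^esub>)) \<otimes>\<^bsub>T\<^esub> (e (cycle_end s i 1) \<otimes>\<^bsub>T\<^esub> e j)"
    unfolding arrow_def using i j v by (simp only: T.B.m_assoc T.B.m_closed e_closed e_end_closed)
  then show "arrow i \<otimes>\<^bsub>T\<^esub> e j = (if j = cycle_end s i 1 then arrow i else \<zero>\<^bsub>T\<^esub>)"
    using e_mult[OF end_in j, of i 1] i v by (auto simp: arrow_def)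
qed

lemma arrow_rad: "i \<in> {1..s} \<Longrightarrow> arrow i \<in> rad"
  unfolding rad_iff using n by (simp add: fst_arrow co_path_basis del: atLeastAtMost_iff)

text \<open>The first component of an element of the square of the radical has no coefficient on
  paths of length one, while that of the lifted arrow is such a path, which is nonzero since
  \<open>n \<ge> 2\<close>.\<close>

lemma arrow_notin: "i \<in> {1..s} \<Longrightarrow> arrow i \<notin> ideal_prod T rad rad"
proof
  assume i: "i \<in> {1..s}" and "arrow i \<in> ideal_prod T rad rad"
  then have "arrow i \<in> layer (Suc 1)" using rad_power_layer[of 1] by auto
  then have "co (path_basis i 1) i 1 = \<zero>\<^bsub>K\<^esub>"
    using fst_arrow[OF i] i n by (auto simp: layer_def low_def)
  then show False using i n by (simp add: co_path_basis)
qed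

text \<open>This is what the hypothesis on the quiver provides. Where there is an arrow, the corner
  modulo the square is a line, spanned by the class of the lifted arrow; elsewhere it is zero. The
  factor \<open>e j\<close> covers both cases, as it kills the arrow unless \<open>j\<close> is its
  end.\<close>

lemma corner_decomposition:
  assumes i: "i \<in> {1..s}" and j: "j \<in> {1..s}" and p: "p \<in> rad"
  shows "\<exists>c\<in>carrier K. \<exists>q\<in>ideal_prod T rad rad.
    e i \<otimes>\<^bsub>T\<^esub> p \<otimes>\<^bsub>T\<^esub> e j = q \<oplus>\<^bsub>T\<^esub> c \<odot>\<^bsub>T\<^esub> (arrow i \<otimes>\<^bsub>T\<^esub> e j)"
proof -
  let ?c = "\<lambda>x. e i \<otimes>\<^bsub>T\<^esub> x \<otimes>\<^bsub>T\<^esub> e j"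
  define U where "U = {x \<in> rad. ?c x = x}"
  define W where "W = {x \<in> ideal_prod T rad rad. ?c x = x}"
  have idem: "idempotent_elem T (e i)" "idempotent_elem T (e j)"
    using i j e_mult by (simp_all add: idempotent_elem_def del: atLeastAtMost_iff)
  have rad2: "ideal (ideal_prod T rad rad) T" using rad_power_ideal[of 1] by simp
  have peirce: "peirce_corner T (e i) rad (e j) = U" "peirce_corner T (e i) (ideal_prod T rad rad) (e j) = W"
    unfolding U_def W_def
    by (rule T.B.peirce_corner_ideal[OF rad_ideal idem] T.B.peirce_corner_ideal[OF rad2 idem])+
  have c_add: "?c (x \<oplus>\<^bsub>T\<^esub> y) = ?c x \<oplus>\<^bsub>T\<^esub> ?c y" if "x \<in> carrier T" "y \<in> carrier T" for x y
    using that i j by (simp add: T.B.r_distr T.B.l_distr del: atLeastAtMost_iff)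
  have c_smult: "?c (r \<odot>\<^bsub>T\<^esub> x) = r \<odot>\<^bsub>T\<^esub> ?c x" if "r \<in> carrier K" "x \<in> carrier T" for r x
    using that i j by (simp add: T.smult_mult_left T.smult_mult_right del: atLeastAtMost_iff)
  have c_zero: "?c \<zero>\<^bsub>T\<^esub> = \<zero>\<^bsub>T\<^esub>" using i j by (simp del: atLeastAtMost_iff)
  have fixed: "Module.submodule {x \<in> I. ?c x = x} K T" if I: "ideal I T" for I
  proof -
    have sub: "Module.submodule I K T" by (rule submodule_if_ideal[OF T.noncomm_algebra_axioms I])
    show ?thesis
      by (rule T.submodule_criterion)
        (use T.submoduleE[OF sub] submodule_zero[OF sub]
          in \<open>auto simp: c_add c_smult c_zero subset_iff\<close>)
  qed
  have c_rad: "?c x \<in> U" if "x \<in> rad" for x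
    using that unfolding peirce(1)[symmetric] peirce_corner_def by blast
  interpret subquotient K T U W "?c ` rad_gens"
  proof (intro subquotient.intro subquotient_axioms.intro)
    show "Module.submodule U K T" unfolding U_def by (rule fixed[OF rad_ideal])
    show "Module.submodule W K T" unfolding W_def by (rule fixed[OF rad2])
    show "W \<subseteq> U"
      unfolding U_def W_def using T.B.ideal_prod_inter[OF rad_ideal rad_ideal] by auto
    show "?c ` rad_gens \<subseteq> U" using rad_gens(2) c_rad by blast
    show "finite (?c ` rad_gens)" using rad_gens(1) by (rule finite_imageI)
    fix X assume X: "Module.submodule X K T" and gens: "?c ` rad_gens \<subseteq> X"
    \<comment> \<open>The spanning property of \<open>rad_gens\<close> passes to the corner: the
      elements whose compression lies in \<open>X\<close> form a submodule.\<close>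
    have "rad \<subseteq> {x \<in> rad. ?c x \<in> X}"
    proof (rule rad_span)
      show "Module.submodule {x \<in> rad. ?c x \<in> X} K T"
        by (rule T.submodule_criterion)
          (use T.submoduleE[OF X] T.submoduleE[OF rad_submodule] rad_closed
            submodule_zero[OF X]
            submodule_zero[OF rad_submodule]
            in \<open>auto simp: c_add c_smult c_zero\<close>)
    qed (use gens rad_gens(2) in auto)
    then show "U \<subseteq> X" unfolding U_def by force
  qed (unfold_locales)
  have dim: "vectorspace.dim K V = (if j = cycle_end s i 1 then 1 else 0)"
    using quiver[OF i j] unfolding num_quiver_arrows_def Let_def jacobson_radical_eq peirce .
  have u: "?c p \<in> U" by (rule c_rad[OF p])
  have WR: "x \<in> ideal_prod T rad rad" if "x \<in> W" for x using that by (simp add: W_def)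
  show ?thesis
  proof (cases "j = cycle_end s i 1")
    case True
    have a: "arrow i \<otimes>\<^bsub>T\<^esub> e j = arrow i" using arrow_e[OF i j] True by simp
    have "arrow i \<in> U" using arrow_rad[OF i] a e_arrow[OF i] by (simp add: U_def)
    moreover have "arrow i \<notin> W" using arrow_notin[OF i] WR by blast
    ultimately have "\<exists>c\<in>carrier K. \<exists>w\<in>W. ?c p = w \<oplus>\<^bsub>T\<^esub> c \<odot>\<^bsub>T\<^esub> arrow i"
      using dim True u by (intro decompose_if_dim_1) auto
    then show ?thesis unfolding a using WR by blast
  next
    case False
    then have "?c p \<in> W" using subset_if_dim_0 dim u by auto
    moreover have "?c p = ?c p \<oplus>\<^bsub>T\<^esub> \<zero>\<^bsub>K\<^esub> \<odot>\<^bsub>T\<^esub> (arrow i \<otimes>\<^bsub>T\<^esub> e j)"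
      using i j rad_closed[OF p] by (simp del: atLeastAtMost_iff)
    ultimately show ?thesis using WR by blast
  qed
qed

fun path :: "nat \<Rightarrow> nat \<Rightarrow> 'a \<times> ('a \<Rightarrow> 'k)" where
  "path i 0 = e i"
| "path i (Suc k) = path i k \<otimes>\<^bsub>T\<^esub> arrow (cycle_end s i k)"

lemma path_closed [simp]: "i \<in> {1..s} \<Longrightarrow> path i k \<in> carrier T"
  by (induction k) (simp_all add: arrow_closed[OF end_in] del: atLeastAtMost_iff)

lemma path_1: "i \<in> {1..s} \<Longrightarrow> path i 1 = arrow i"
  by (simp add: e_arrow del: atLeastAtMost_iff)

lemma e_path: "i \<in> {1..s} \<Longrightarrow> e i \<otimes>\<^bsub>T\<^esub> path i k = path i k"
proof (induction k)
  case (Suc k)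
  then show ?case
    using arrow_closed[OF end_in, of i k]
    by (simp add: T.B.m_assoc[symmetric] del: atLeastAtMost_iff)
qed (simp add: e_mult del: atLeastAtMost_iff)

lemma path_e: "\<lbrakk>i \<in> {1..s}; j \<in> {1..s}\<rbrakk> \<Longrightarrow>
    path i k \<otimes>\<^bsub>T\<^esub> e j = (if j = cycle_end s i k then path i k else \<zero>\<^bsub>T\<^esub>)"
proof (induction k)
  case (Suc k)
  then show ?case
    using arrow_closed[OF end_in, of i k] arrow_e[OF end_in, of j i k]
    by (simp add: T.B.m_assoc del: atLeastAtMost_iff)
qed (auto simp: e_mult simp del: atLeastAtMost_iff)

lemma path_path: "i \<in> {1..s} \<Longrightarrow> path i k \<otimes>\<^bsub>T\<^esub> path (cycle_end s i k) l = path i (k + l)"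
proof (induction l)
  case 0
  then show ?case using path_e[OF _ end_in[of i k], of i k] by simp
next
  case (Suc l)
  then show ?case
    using arrow_closed[OF end_in, of i "k + l"] path_closed[OF end_in, of i k l]
    by (simp add: T.B.m_assoc[symmetric] del: atLeastAtMost_iff)
qed

lemma path_mult:
  assumes i: "i \<in> {1..s}" and j: "j \<in> {1..s}"
  shows "path i k \<otimes>\<^bsub>T\<^esub> path j l = (if j = cycle_end s i k then path i (k + l) else \<zero>\<^bsub>T\<^esub>)"
proof (cases "j = cycle_end s i k")
  case False
  have "path i k \<otimes>\<^bsub>T\<^esub> path j l = path i k \<otimes>\<^bsub>T\<^esub> e j \<otimes>\<^bsub>T\<^esub> path j l"
    using i j e_path[OF j, of l] by (simp add: T.B.m_assoc del: atLeastAtMost_iff)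
  then show ?thesis using False i j path_e[OF i j, of k] by (simp del: atLeastAtMost_iff)
qed (use path_path[OF i] in simp)

lemma fst_path: "i \<in> {1..s} \<Longrightarrow> fst (path i k) = path_basis i k"
  by (induction k)
    (simp_all add: fst_e fst_mult fst_arrow[OF end_in] path_basis_mult[OF _ end_in] del: atLeastAtMost_iff)

lemma path_rad_power: "i \<in> {1..s} \<Longrightarrow> path i (Suc k) \<in> rad_power k"
proof (induction k)
  case 0
  then show ?case using path_1[of i] arrow_rad[of i] by simp
next
  case (Suc k)
  have "path i (Suc k) \<otimes>\<^bsub>T\<^esub> arrow (cycle_end s i (Suc k)) \<in> rad_power (Suc k)"
    using Suc arrow_rad[OF end_in] by (subst rad_power.simps(2), intro ideal_prod.prod) auto
  then show ?case by simp
qed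

lemma path_vanish:
  assumes i: "i \<in> {1..s}" and k: "k \<ge> 2 * n"
  shows "path i k = \<zero>\<^bsub>T\<^esub>"
proof -
  have "path i (Suc (2 * n - 1)) \<in> layer (Suc (2 * n - 1))"
    using path_rad_power[OF i] rad_power_layer by blast
  then have z: "path i (2 * n) = \<zero>\<^bsub>T\<^esub>" using n layer_top by simp
  have "path i k = path i (2 * n) \<otimes>\<^bsub>T\<^esub> path (cycle_end s i (2 * n)) (k - 2 * n)"
    using path_path[OF i, of "2 * n" "k - 2 * n"] k by simp
  then show ?thesis using z path_closed[OF end_in] by simp
qed

section \<open>The lifted paths span the extension\<close>

definition path_span :: "nat \<Rightarrow> ('a \<times> ('a \<Rightarrow> 'k)) set" where
  "path_span i = {(\<Oplus>\<^bsub>T\<^esub>k\<in>{..<2 * n}. c k \<odot>\<^bsub>T\<^esub> path i k) |c. \<forall>k. c k \<in> carrier K}"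

lemma path_span_add:
  assumes i: "i \<in> {1..s}" and "t \<in> path_span i" "u \<in> path_span i"
  shows "t \<oplus>\<^bsub>T\<^esub> u \<in> path_span i"
proof -
  obtain c d where c: "\<And>k. c k \<in> carrier K" "t = (\<Oplus>\<^bsub>T\<^esub>k\<in>{..<2 * n}. c k \<odot>\<^bsub>T\<^esub> path i k)"
    and d: "\<And>k. d k \<in> carrier K" "u = (\<Oplus>\<^bsub>T\<^esub>k\<in>{..<2 * n}. d k \<odot>\<^bsub>T\<^esub> path i k)"
    using assms unfolding path_span_def by blast
  have "t \<oplus>\<^bsub>T\<^esub> u = (\<Oplus>\<^bsub>T\<^esub>k\<in>{..<2 * n}. c k \<odot>\<^bsub>T\<^esub> path i k \<oplus>\<^bsub>T\<^esub> d k \<odot>\<^bsub>T\<^esub> path i k)"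
    unfolding c d by (rule T.B.finsum_addf[symmetric]) (use c d i in auto)
  also have "\<dots> = (\<Oplus>\<^bsub>T\<^esub>k\<in>{..<2 * n}. (c k \<oplus>\<^bsub>K\<^esub> d k) \<odot>\<^bsub>T\<^esub> path i k)"
    by (rule T.B.finsum_cong'[OF refl]) (use c d i in \<open>auto simp: T.smult_l_distr\<close>)
  finally show ?thesis unfolding path_span_def using c(1) d(1) by (intro CollectI exI[of _ "\<lambda>k. c k \<oplus>\<^bsub>K\<^esub> d k"]) simp
qed

lemma path_span_path:
  assumes i: "i \<in> {1..s}" and r: "r \<in> carrier K"
  shows "r \<odot>\<^bsub>T\<^esub> path i l \<in> path_span i"
proof -
  \<comment> \<open>For \<open>l \<ge> 2 * n\<close> the path is zero, which the zero coefficient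
    family represents; so no bound on \<open>l\<close> is required.\<close>
  define c where "c k = (if k = l \<and> l < 2 * n then r else \<zero>\<^bsub>K\<^esub>)" for k
  have c: "c k \<in> carrier K" for k using r by (simp add: c_def)
  have "(\<Oplus>\<^bsub>T\<^esub>k\<in>{..<2 * n}. c k \<odot>\<^bsub>T\<^esub> path i k) = r \<odot>\<^bsub>T\<^esub> path i l"
  proof (cases "l < 2 * n")
    case True
    then have "(\<Oplus>\<^bsub>T\<^esub>k\<in>{..<2 * n}. c k \<odot>\<^bsub>T\<^esub> path i k) = c l \<odot>\<^bsub>T\<^esub> path i l"
      by (intro T.B.finsum_single) (use i r in \<open>auto simp: c_def\<close>)
    then show ?thesis using True by (simp add: c_def)
  next
    case False
    then have "(\<Oplus>\<^bsub>T\<^esub>k\<in>{..<2 * n}. c k \<odot>\<^bsub>T\<^esub> path i k) = \<zero>\<^bsub>T\<^esub>"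
      by (intro T.B.add.finprod_one_eqI) (use i in \<open>auto simp: c_def\<close>)
    then show ?thesis using False path_vanish[OF i, of l] r by simp
  qed
  then show ?thesis unfolding path_span_def using c by (intro CollectI exI[of _ c]) simp
qed

lemma path_span_zero: "i \<in> {1..s} \<Longrightarrow> \<zero>\<^bsub>T\<^esub> \<in> path_span i"
  using path_span_path[of i "\<zero>\<^bsub>K\<^esub>" 0] by (simp del: atLeastAtMost_iff)

lemma sum_e:
  assumes "t \<in> carrier T"
  shows "t = (\<Oplus>\<^bsub>T\<^esub>j\<in>{1..s}. t \<otimes>\<^bsub>T\<^esub> e j)"
proof -
  have "t = t \<otimes>\<^bsub>T\<^esub> (\<Oplus>\<^bsub>T\<^esub>j\<in>{1..s}. e j)" using assms by (simp only: e_sum T.B.r_one)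
  also have "\<dots> = (\<Oplus>\<^bsub>T\<^esub>j\<in>{1..s}. t \<otimes>\<^bsub>T\<^esub> e j)"
    using assms by (intro T.B.finsum_rdistr) auto
  finally show ?thesis .
qed

text \<open>Summing the corner decompositions over all end vertices leaves a single arrow, because
  only one vertex follows \<open>i\<close>.\<close>

lemma leading_term_1:
  assumes i: "i \<in> {1..s}" and p: "p \<in> rad"
  shows "\<exists>c\<in>carrier K. \<exists>q\<in>rad_power 1. e i \<otimes>\<^bsub>T\<^esub> p = q \<oplus>\<^bsub>T\<^esub> c \<odot>\<^bsub>T\<^esub> arrow i"
proof -
  have pT: "p \<in> carrier T" using p by (rule rad_closed)
  have "\<exists>cq. fst cq \<in> carrier K \<and> snd cq \<in> rad_power 1 \<and>
      e i \<otimes>\<^bsub>T\<^esub> p \<otimes>\<^bsub>T\<^esub> e j = snd cq \<oplus>\<^bsub>T\<^esub> fst cq \<odot>\<^bsub>T\<^esub> (arrow i \<otimes>\<^bsub>T\<^esub> e j)" if j: "j \<in> {1..s}" for j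
  proof -
    obtain c q where "c \<in> carrier K" "q \<in> ideal_prod T rad rad"
      "e i \<otimes>\<^bsub>T\<^esub> p \<otimes>\<^bsub>T\<^esub> e j = q \<oplus>\<^bsub>T\<^esub> c \<odot>\<^bsub>T\<^esub> (arrow i \<otimes>\<^bsub>T\<^esub> e j)"
      using corner_decomposition[OF i j p] by blast
    then show ?thesis by (intro exI[of _ "(c, q)"]) simp
  qed
  then obtain f where f: "\<And>j. j \<in> {1..s} \<Longrightarrow> fst (f j) \<in> carrier K \<and> snd (f j) \<in> rad_power 1 \<and>
      e i \<otimes>\<^bsub>T\<^esub> p \<otimes>\<^bsub>T\<^esub> e j = snd (f j) \<oplus>\<^bsub>T\<^esub> fst (f j) \<odot>\<^bsub>T\<^esub> (arrow i \<otimes>\<^bsub>T\<^esub> e j)"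
    by metis
  have fT: "snd (f j) \<in> carrier T" if "j \<in> {1..s}" for j
    using f[OF that] rad_power_closed by blast
  let ?j = "cycle_end s i 1"
  have "e i \<otimes>\<^bsub>T\<^esub> p = (\<Oplus>\<^bsub>T\<^esub>j\<in>{1..s}. e i \<otimes>\<^bsub>T\<^esub> p \<otimes>\<^bsub>T\<^esub> e j)"
    by (rule sum_e) (use i pT in auto)
  also have "\<dots> = (\<Oplus>\<^bsub>T\<^esub>j\<in>{1..s}. snd (f j) \<oplus>\<^bsub>T\<^esub> fst (f j) \<odot>\<^bsub>T\<^esub> (arrow i \<otimes>\<^bsub>T\<^esub> e j))"
    by (rule T.B.finsum_cong'[OF refl])
      (use f fT i in \<open>auto intro!: T.B.a_closed T.smult_closed T.B.m_closed simp del: atLeastAtMost_iff\<close>)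
  also have "\<dots> = (\<Oplus>\<^bsub>T\<^esub>j\<in>{1..s}. snd (f j)) \<oplus>\<^bsub>T\<^esub> (\<Oplus>\<^bsub>T\<^esub>j\<in>{1..s}. fst (f j) \<odot>\<^bsub>T\<^esub> (arrow i \<otimes>\<^bsub>T\<^esub> e j))"
    by (rule T.B.finsum_addf)
      (use f fT i in \<open>auto intro!: T.smult_closed T.B.m_closed simp del: atLeastAtMost_iff\<close>)
  also have "(\<Oplus>\<^bsub>T\<^esub>j\<in>{1..s}. fst (f j) \<odot>\<^bsub>T\<^esub> (arrow i \<otimes>\<^bsub>T\<^esub> e j)) = fst (f ?j) \<odot>\<^bsub>T\<^esub> (arrow i \<otimes>\<^bsub>T\<^esub> e ?j)"
    by (rule T.B.finsum_single)
      (use f[OF end_in] f i end_in in \<open>auto simp: arrow_e simp del: atLeastAtMost_iff\<close>)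
  also have "arrow i \<otimes>\<^bsub>T\<^esub> e ?j = arrow i" using arrow_e[OF i end_in[of i 1]] by simp
  finally have "e i \<otimes>\<^bsub>T\<^esub> p = (\<Oplus>\<^bsub>T\<^esub>j\<in>{1..s}. snd (f j)) \<oplus>\<^bsub>T\<^esub> fst (f ?j) \<odot>\<^bsub>T\<^esub> arrow i" .
  moreover have "(\<Oplus>\<^bsub>T\<^esub>j\<in>{1..s}. snd (f j)) \<in> rad_power 1"
    using f by (intro ideal.finsum_closed_ideal[OF rad_power_ideal]) blast
  ultimately show ?thesis using f[OF end_in] by blast
qed

text \<open>The leading coefficients multiply. If \<open>e i a\<close> is \<open>c\<close> times a
  path \<open>b\<close> modulo a higher power, and \<open>r\<close>, cut at the end of
  \<open>b\<close>, is \<open>d\<close> times an arrow modulo the square, then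
  \<open>e i a r\<close> is \<open>c d\<close> times the extended path modulo the next
  power.\<close>

lemma leading_term:
  assumes i: "i \<in> {1..s}" and p: "p \<in> rad_power k"
  shows "\<exists>c\<in>carrier K. \<exists>q\<in>rad_power (Suc k). e i \<otimes>\<^bsub>T\<^esub> p = q \<oplus>\<^bsub>T\<^esub> c \<odot>\<^bsub>T\<^esub> path i (Suc k)"
  using p
proof (induction k arbitrary: p)
  case 0
  then show ?case using leading_term_1[OF i, of p] path_1[OF i] by simp
next
  case (Suc k)
  interpret R: ideal "rad_power (Suc (Suc k))" T by (rule rad_power_ideal)
  have "p \<in> ideal_prod T (rad_power k) rad" using Suc.prems by simp
  then have "p \<in> carrier T \<and> (\<exists>c\<in>carrier K. \<exists>q\<in>rad_power (Suc (Suc k)).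
      e i \<otimes>\<^bsub>T\<^esub> p = q \<oplus>\<^bsub>T\<^esub> c \<odot>\<^bsub>T\<^esub> path i (Suc (Suc k)))"
  proof (induction rule: ideal_prod.induct)
    case (prod a r)
    have aT: "a \<in> carrier T" and rT: "r \<in> carrier T" by (rule rad_power_closed[OF prod(1)], rule rad_closed[OF prod(2)])
    let ?j = "cycle_end s i (Suc k)" and ?b = "path i (Suc k)"
    obtain c q where c: "c \<in> carrier K" and q: "q \<in> rad_power (Suc k)" and a: "e i \<otimes>\<^bsub>T\<^esub> a = q \<oplus>\<^bsub>T\<^esub> c \<odot>\<^bsub>T\<^esub> ?b"
      using Suc.IH[OF prod(1)] by blast
    obtain d q' where d: "d \<in> carrier K" and q': "q' \<in> rad_power 1" and r: "e ?j \<otimes>\<^bsub>T\<^esub> r = q' \<oplus>\<^bsub>T\<^esub> d \<odot>\<^bsub>T\<^esub> arrow ?j"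
      using leading_term_1[OF end_in prod(2)] by blast
    have qT: "q \<in> carrier T" and q'T: "q' \<in> carrier T" by (rule rad_power_closed[OF q], rule rad_power_closed[OF q'])
    have bT: "?b \<in> carrier T" using i by (rule path_closed)
    have xT: "arrow ?j \<in> carrier T" by (rule arrow_closed[OF end_in])
    have be: "?b \<otimes>\<^bsub>T\<^esub> e ?j = ?b" using path_e[OF i end_in[of i "Suc k"], of "Suc k"] by simp
    \<comment> \<open>Since \<open>?b\<close> ends in \<open>?j\<close>, the idempotent there can be
      inserted, and the decomposition of \<open>r\<close> cut at \<open>?j\<close> applies.\<close>
    have "?b \<otimes>\<^bsub>T\<^esub> r = ?b \<otimes>\<^bsub>T\<^esub> (e ?j \<otimes>\<^bsub>T\<^esub> r)"
      using bT rT be T.B.m_assoc[of ?b "e ?j" r] by (simp del: path.simps)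
    also have "\<dots> = ?b \<otimes>\<^bsub>T\<^esub> q' \<oplus>\<^bsub>T\<^esub> d \<odot>\<^bsub>T\<^esub> path i (Suc (Suc k))"
      unfolding r using bT q'T xT d
      by (simp add: T.B.r_distr T.smult_mult_right path.simps(2)[of i "Suc k"] del: path.simps)
    finally have br: "?b \<otimes>\<^bsub>T\<^esub> r = ?b \<otimes>\<^bsub>T\<^esub> q' \<oplus>\<^bsub>T\<^esub> d \<odot>\<^bsub>T\<^esub> path i (Suc (Suc k))" .
    have qr: "q \<otimes>\<^bsub>T\<^esub> r \<in> rad_power (Suc (Suc k))"
      using q prod(2) by (subst rad_power.simps(2)) (rule ideal_prod.prod)
    have bq: "?b \<otimes>\<^bsub>T\<^esub> q' \<in> rad_power (Suc (Suc k))"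
      by (rule rad_power_mult[OF path_rad_power[OF i] q'])
    have cbq: "c \<odot>\<^bsub>T\<^esub> (?b \<otimes>\<^bsub>T\<^esub> q') \<in> rad_power (Suc (Suc k))"
      by (rule Module.submodule.smult_closed[OF submodule_if_ideal[OF T.noncomm_algebra_axioms rad_power_ideal] c bq])
    have b2T: "path i (Suc (Suc k)) \<in> carrier T" using i by (rule path_closed)
    have "e i \<otimes>\<^bsub>T\<^esub> (a \<otimes>\<^bsub>T\<^esub> r) = (e i \<otimes>\<^bsub>T\<^esub> a) \<otimes>\<^bsub>T\<^esub> r"
      using i aT rT by (simp add: T.B.m_assoc del: atLeastAtMost_iff)
    also have "\<dots> = q \<otimes>\<^bsub>T\<^esub> r \<oplus>\<^bsub>T\<^esub> c \<odot>\<^bsub>T\<^esub> (?b \<otimes>\<^bsub>T\<^esub> r)"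
      unfolding a using qT bT rT c by (simp add: T.B.l_distr T.smult_mult_left del: path.simps)
    also have "\<dots> = (q \<otimes>\<^bsub>T\<^esub> r \<oplus>\<^bsub>T\<^esub> c \<odot>\<^bsub>T\<^esub> (?b \<otimes>\<^bsub>T\<^esub> q')) \<oplus>\<^bsub>T\<^esub> (c \<otimes>\<^bsub>K\<^esub> d) \<odot>\<^bsub>T\<^esub> path i (Suc (Suc k))"
      unfolding br using qT bT rT c d q'T b2T
      by (simp add: T.smult_r_distr T.smult_assoc1 T.B.a_assoc del: path.simps)
    finally have eq: "e i \<otimes>\<^bsub>T\<^esub> (a \<otimes>\<^bsub>T\<^esub> r) = (q \<otimes>\<^bsub>T\<^esub> r \<oplus>\<^bsub>T\<^esub> c \<odot>\<^bsub>T\<^esub> (?b \<otimes>\<^bsub>T\<^esub> q')) \<oplus>\<^bsub>T\<^esub> (c \<otimes>\<^bsub>K\<^esub> d) \<odot>\<^bsub>T\<^esub> path i (Suc (Suc k))" .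
    show ?case
      using aT rT c d eq R.a_closed[OF qr cbq] by (intro conjI bexI[of _ "c \<otimes>\<^bsub>K\<^esub> d"]) auto
  next
    case (sum u v)
    let ?b = "path i (Suc (Suc k))"
    obtain c q d q' where c: "c \<in> carrier K" "q \<in> rad_power (Suc (Suc k))" "e i \<otimes>\<^bsub>T\<^esub> u = q \<oplus>\<^bsub>T\<^esub> c \<odot>\<^bsub>T\<^esub> ?b"
      and d: "d \<in> carrier K" "q' \<in> rad_power (Suc (Suc k))" "e i \<otimes>\<^bsub>T\<^esub> v = q' \<oplus>\<^bsub>T\<^esub> d \<odot>\<^bsub>T\<^esub> ?b"
      and uv: "u \<in> carrier T" "v \<in> carrier T"
      using sum.IH by blast
    have cl: "q \<in> carrier T" "q' \<in> carrier T" "?b \<in> carrier T" using c d i by (auto simp: R.a_Hcarr simp del: path.simps)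
    have "e i \<otimes>\<^bsub>T\<^esub> (u \<oplus>\<^bsub>T\<^esub> v) = (q \<oplus>\<^bsub>T\<^esub> c \<odot>\<^bsub>T\<^esub> ?b) \<oplus>\<^bsub>T\<^esub> (q' \<oplus>\<^bsub>T\<^esub> d \<odot>\<^bsub>T\<^esub> ?b)"
      using i uv c(3) d(3) by (simp add: T.B.r_distr del: path.simps atLeastAtMost_iff)
    also have "\<dots> = (q \<oplus>\<^bsub>T\<^esub> q') \<oplus>\<^bsub>T\<^esub> (c \<oplus>\<^bsub>K\<^esub> d) \<odot>\<^bsub>T\<^esub> ?b"
      using cl c(1) d(1) by (simp add: T.smult_l_distr T.B.a_ac del: path.simps)
    finally show ?case
      using uv c d R.a_closed[OF c(2) d(2)] by (intro conjI bexI[of _ "c \<oplus>\<^bsub>K\<^esub> d"]) auto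
  qed
  then show ?case by blast
qed

text \<open>Splitting off leading terms pushes the remainder into ever higher powers of the radical,
  until it vanishes; hence the induction on \<open>2 * n - k\<close>.\<close>

lemma rad_power_span:
  assumes i: "i \<in> {1..s}" and p: "p \<in> rad_power k"
  shows "e i \<otimes>\<^bsub>T\<^esub> p \<in> path_span i"
  using p
proof (induction "2 * n - k" arbitrary: k p)
  case 0
  then have k: "2 * n \<le> k" by simp
  \<comment> \<open>Because of the shifted index, \<open>rad_power (2 * n - 1)\<close> is already
    the vanishing power, and the later ones are contained in it.\<close>
  have "rad_power (2 * n - 1 + l) \<subseteq> {\<zero>\<^bsub>T\<^esub>}" for l
  proof (induction l)
    case 0
    show ?case using rad_power_layer[of "2 * n - 1"] n layer_top by simp
  next
    case (Suc l)
    have "rad_power (Suc (2 * n - 1 + l)) \<subseteq> rad_power (2 * n - 1 + l)"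
      using T.B.ideal_prod_inter[OF rad_power_ideal rad_ideal] by auto
    then show ?case using Suc by simp
  qed
  from this[of "k - (2 * n - 1)"] have "p = \<zero>\<^bsub>T\<^esub>" using 0 k n by auto
  then show ?case using i path_span_zero by (simp del: atLeastAtMost_iff)
next
  case (Suc d)
  obtain c q where c: "c \<in> carrier K" and q: "q \<in> rad_power (Suc k)" and eq: "e i \<otimes>\<^bsub>T\<^esub> p = q \<oplus>\<^bsub>T\<^esub> c \<odot>\<^bsub>T\<^esub> path i (Suc k)"
    using leading_term[OF i Suc.prems] by blast
  have pT: "p \<in> carrier T" and qT: "q \<in> carrier T" by (rule rad_power_closed[OF Suc.prems], rule rad_power_closed[OF q])
  have bT: "path i (Suc k) \<in> carrier T" using i by (rule path_closed)
  \<comment> \<open>The remainder \<open>q\<close> need not lie in \<open>e i T\<close>. A second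
    multiplication by \<open>e i\<close> replaces it by \<open>e i q\<close>, to which the induction
    hypothesis applies.\<close>
  have "e i \<otimes>\<^bsub>T\<^esub> p = e i \<otimes>\<^bsub>T\<^esub> (e i \<otimes>\<^bsub>T\<^esub> p)"
    using i pT e_mult[OF i i] by (simp add: T.B.m_assoc[symmetric] del: atLeastAtMost_iff)
  also have "\<dots> = e i \<otimes>\<^bsub>T\<^esub> q \<oplus>\<^bsub>T\<^esub> c \<odot>\<^bsub>T\<^esub> path i (Suc k)"
    unfolding eq using i qT bT c e_path[OF i, of "Suc k"]
    by (simp add: T.B.r_distr T.smult_mult_right del: path.simps atLeastAtMost_iff)
  finally have eq': "e i \<otimes>\<^bsub>T\<^esub> p = e i \<otimes>\<^bsub>T\<^esub> q \<oplus>\<^bsub>T\<^esub> c \<odot>\<^bsub>T\<^esub> path i (Suc k)" .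
  have "e i \<otimes>\<^bsub>T\<^esub> q \<in> path_span i" using Suc.hyps q by (intro Suc.hyps(1)[of "Suc k"]) auto
  then show ?case unfolding eq' by (rule path_span_add[OF i _ path_span_path[OF i c]])
qed

text \<open>Subtracting the multiple of \<open>e i\<close> given by the coefficient of the trivial
  path leaves an element of the radical.\<close>

lemma e_mult_span:
  assumes i: "i \<in> {1..s}" and t: "t \<in> carrier T"
  shows "e i \<otimes>\<^bsub>T\<^esub> t \<in> path_span i"
proof -
  define c where "c = co (fst t) i 0"
  have c: "c \<in> carrier K" unfolding c_def using t i by (intro co0_closed) auto
  define p where "p = e i \<otimes>\<^bsub>T\<^esub> t \<ominus>\<^bsub>T\<^esub> c \<odot>\<^bsub>T\<^esub> e i"
  have pT: "p \<in> carrier T" unfolding p_def using t i c by auto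
  have eq: "e i \<otimes>\<^bsub>T\<^esub> t = p \<oplus>\<^bsub>T\<^esub> c \<odot>\<^bsub>T\<^esub> e i"
    unfolding p_def using t i c by (simp add: T.B.minus_eq T.B.a_assoc T.B.l_neg del: atLeastAtMost_iff)
  have "co (fst p) j 0 = \<zero>\<^bsub>K\<^esub>" if j: "j \<in> {1..s}" for j
  proof -
    have "co (fst (e i \<otimes>\<^bsub>T\<^esub> t)) j 0 = co (fst p) j 0 \<oplus>\<^bsub>K\<^esub> co (fst (c \<odot>\<^bsub>T\<^esub> e i)) j 0"
      unfolding eq fst_add by (rule co_add) (use pT i c j n in auto)
    moreover have "co (fst (e i \<otimes>\<^bsub>T\<^esub> t)) j 0 = co (fst (c \<odot>\<^bsub>T\<^esub> e i)) j 0"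
      using i j t c n co0_closed[of "fst t" j]
      by (auto simp: fst_mult fst_smult fst_e co_mult_0 co_smult co_path_basis c_def simp del: atLeastAtMost_iff)
    ultimately have "co (fst (c \<odot>\<^bsub>T\<^esub> e i)) j 0 = co (fst p) j 0 \<oplus>\<^bsub>K\<^esub> co (fst (c \<odot>\<^bsub>T\<^esub> e i)) j 0" by simp
    moreover have "co (fst (c \<odot>\<^bsub>T\<^esub> e i)) j 0 \<in> carrier K" "co (fst p) j 0 \<in> carrier K"
      using i j c pT by (auto intro!: co0_closed simp del: atLeastAtMost_iff)
    ultimately show ?thesis using K.add.r_cancel_one' by simp
  qed
  then have p: "p \<in> rad_power 0" using pT by (simp add: rad_iff)
  have "e i \<otimes>\<^bsub>T\<^esub> t = e i \<otimes>\<^bsub>T\<^esub> (e i \<otimes>\<^bsub>T\<^esub> t)"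
    using i t e_mult[OF i i] by (simp add: T.B.m_assoc[symmetric] del: atLeastAtMost_iff)
  also have "\<dots> = e i \<otimes>\<^bsub>T\<^esub> p \<oplus>\<^bsub>T\<^esub> c \<odot>\<^bsub>T\<^esub> path i 0"
    unfolding eq using i pT c e_mult[OF i i] by (simp add: T.B.r_distr T.smult_mult_right del: atLeastAtMost_iff)
  finally have eq': "e i \<otimes>\<^bsub>T\<^esub> t = e i \<otimes>\<^bsub>T\<^esub> p \<oplus>\<^bsub>T\<^esub> c \<odot>\<^bsub>T\<^esub> path i 0" .
  show ?thesis
    unfolding eq' by (rule path_span_add[OF i rad_power_span[OF i p] path_span_path[OF i c]])
qed

text \<open>
  The functional \<open>\<delta>\<close> dual to a path of length \<open>n - 1\<close> that ends in \<open>i\<close> lies in \<open>e i T\<close> and is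
  therefore a combination of the elements \<open>path i k\<close> with \<open>k \<ge> n\<close>. Its product with that path is
  nonzero, and only \<open>path i (2 * n - 1)\<close> can contribute to it.
\<close>

lemma path_top:
  assumes i: "i \<in> {1..s}"
  shows "path i (2 * n - 1) \<noteq> \<zero>\<^bsub>T\<^esub> \<and> cycle_end s i (2 * n - 1) = i"
proof -
  \<comment> \<open>Modulo \<open>s\<close> the length equals \<open>- (n - 1)\<close>, so
    \<open>j\<close> is the vertex from which the path of length \<open>n - 1\<close> ends in
    \<open>i\<close>; the multiple \<open>s * n\<close> keeps the natural subtraction from being cut
    off.\<close>
  define j where "j = cycle_end s i (s * n - (n - 1))"
  have j: "j \<in> {1..s}" unfolding j_def by (rule end_in)
  have "n \<le> s * n" using s_pos by simp
  then have "s * n - (n - 1) + (n - 1) = s * n" by linarith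
  then have j_end: "cycle_end s j (n - 1) = i"
    using cycle_end_self_iff[OF i, of "s * n"] unfolding j_def by simp
  define \<delta> where "\<delta> = dual_path j (n - 1)"
  have n1: "n - 1 < n" using n by simp
  have \<delta>: "\<delta> \<in> carrier D" unfolding \<delta>_def by (rule dual_path_closed[OF j n1])
  define \<psi> where "\<psi> = (\<zero>\<^bsub>B\<^esub>, \<delta>)"
  have \<psi>: "\<psi> \<in> carrier T" using \<delta> by (simp add: \<psi>_def hochschild_carrier)
  have "snd (e i \<otimes>\<^bsub>T\<^esub> \<psi>) = \<delta>"
  proof (rule dual_eqI[OF _ \<delta>])
    show "snd (e i \<otimes>\<^bsub>T\<^esub> \<psi>) \<in> carrier D" using i \<psi> by (intro snd_closed T.B.m_closed) auto
    fix x assume x: "x \<in> carrier B"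
    have "snd (e i \<otimes>\<^bsub>T\<^esub> \<psi>) x = \<delta> (x \<otimes>\<^bsub>B\<^esub> path_basis i 0)"
      using x \<delta> i snd_closed[OF e_closed[OF i]]
      by (simp add: snd_mult \<psi>_def fst_e dual_apply cocycle_zero_right dual_zero del: atLeastAtMost_iff)
    also have "\<dots> = \<delta> x"
      using x co_mult_vertex[OF x i j n1] j_end by (simp add: \<delta>_def dual_path_def)
    finally show "snd (e i \<otimes>\<^bsub>T\<^esub> \<psi>) x = \<delta> x" .
  qed
  then have "e i \<otimes>\<^bsub>T\<^esub> \<psi> = \<psi>" using i by (simp add: prod_eq_iff fst_mult \<psi>_def fst_e del: atLeastAtMost_iff)
  then have "\<psi> \<in> path_span i" using e_mult_span[OF i \<psi>] by simp
  then obtain c where c: "\<And>k. c k \<in> carrier K" and \<psi>_eq: "\<psi> = (\<Oplus>\<^bsub>T\<^esub>k\<in>{..<2 * n}. c k \<odot>\<^bsub>T\<^esub> path i k)"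
    unfolding path_span_def by blast
  have cb: "c k \<odot>\<^bsub>T\<^esub> path i k \<in> carrier T" for k using c i by simp
  \<comment> \<open>The first component of the functional is zero, while those of the paths shorter
    than \<open>n\<close> are distinct basis elements of \<open>B\<close>.\<close>
  have c0: "c k = \<zero>\<^bsub>K\<^esub>" if k: "k < n" for k
  proof -
    have "co (fst \<psi>) i k = (\<Oplus>\<^bsub>K\<^esub>l\<in>{..<2 * n}. co (fst (c l \<odot>\<^bsub>T\<^esub> path i l)) i k)"
      unfolding \<psi>_eq
      by (rule additive_finsum[OF T.B.is_abelian_group K.is_abelian_group, of "\<lambda>t. co (fst t) i k"])
        (use cb i k in \<open>auto simp: fst_add co_add co_closed simp del: atLeastAtMost_iff\<close>)
    also have "\<dots> = co (fst (c k \<odot>\<^bsub>T\<^esub> path i k)) i k"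
      by (rule K.finsum_single)
        (use i k c in \<open>auto simp: fst_smult fst_path co_smult co_path_basis simp del: atLeastAtMost_iff\<close>)
    also have "\<dots> = c k"
      using i k c by (simp add: fst_smult fst_path co_smult co_path_basis del: atLeastAtMost_iff)
    finally show ?thesis using i k by (simp add: \<psi>_def co_zero del: atLeastAtMost_iff)
  qed
  let ?b = "path j (n - 1)"
  have bT: "?b \<in> carrier T" using j by (rule path_closed)
  have "snd (\<psi> \<otimes>\<^bsub>T\<^esub> ?b) (path_basis i 0) = \<one>\<^bsub>K\<^esub>"
  proof -
    have "snd (\<psi> \<otimes>\<^bsub>T\<^esub> ?b) (path_basis i 0) = \<delta> (path_basis j (n - 1) \<otimes>\<^bsub>B\<^esub> path_basis i 0)"
      using \<delta> j snd_closed[OF bT]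
      by (simp add: snd_mult \<psi>_def fst_path dual_apply cocycle_zero_left dual_zero del: atLeastAtMost_iff)
    also have "\<dots> = \<one>\<^bsub>K\<^esub>"
      using i j n1 j_end by (simp add: \<delta>_def dual_path_def path_basis_mult co_path_basis del: atLeastAtMost_iff)
    finally show ?thesis .
  qed
  then have nz: "\<psi> \<otimes>\<^bsub>T\<^esub> ?b \<noteq> \<zero>\<^bsub>T\<^esub>" by (auto simp: snd_zero zero_dual_apply)
  have "\<psi> \<otimes>\<^bsub>T\<^esub> ?b = (\<Oplus>\<^bsub>T\<^esub>k\<in>{..<2 * n}. (c k \<odot>\<^bsub>T\<^esub> path i k) \<otimes>\<^bsub>T\<^esub> ?b)"
    unfolding \<psi>_eq by (rule T.B.finsum_ldistr) (use cb bT in auto)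
  \<comment> \<open>Coefficients below \<open>n\<close> vanish, and for \<open>k > n\<close> the
    total length \<open>k + (n - 1)\<close> is at least \<open>2 * n\<close>, so only
    \<open>k = n\<close> is left.\<close>
  also have "\<dots> = (c n \<odot>\<^bsub>T\<^esub> path i n) \<otimes>\<^bsub>T\<^esub> ?b"
  proof (rule T.B.finsum_single)
    fix k assume k: "k \<in> {..<2 * n}" "k \<noteq> n"
    show "(c k \<odot>\<^bsub>T\<^esub> path i k) \<otimes>\<^bsub>T\<^esub> ?b = \<zero>\<^bsub>T\<^esub>"
    proof (cases "k < n")
      case True
      then show ?thesis using c0[OF True] i bT by (simp del: atLeastAtMost_iff)
    next
      case False
      then have "path i k \<otimes>\<^bsub>T\<^esub> ?b = \<zero>\<^bsub>T\<^esub>"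
        using path_mult[OF i j, of k "n - 1"] path_vanish[OF i, of "k + (n - 1)"] k by auto
      then show ?thesis using c i bT by (simp add: T.smult_mult_left del: atLeastAtMost_iff)
    qed
  qed (use n cb bT in auto)
  also have "\<dots> = c n \<odot>\<^bsub>T\<^esub> (path i n \<otimes>\<^bsub>T\<^esub> ?b)"
    using c i bT by (simp add: T.smult_mult_left del: atLeastAtMost_iff)
  finally have "path i n \<otimes>\<^bsub>T\<^esub> ?b \<noteq> \<zero>\<^bsub>T\<^esub>" using nz c by auto
  \<comment> \<open>A nonzero product forces the path of length \<open>n\<close> from
    \<open>i\<close> to end in \<open>j\<close>. Together with the path back from \<open>j\<close>
    it closes up at \<open>i\<close>, with total length \<open>2 * n - 1\<close>.\<close>
  then have jn: "j = cycle_end s i n" and "path i (n + (n - 1)) \<noteq> \<zero>\<^bsub>T\<^esub>"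
    using path_mult[OF i j, of n "n - 1"] by (auto split: if_splits)
  moreover have "n + (n - 1) = 2 * n - 1" using n by simp
  ultimately show ?thesis using j_end by simp
qed

text \<open>Spanning and the nonvanishing longest paths make the lifted paths a basis that
  multiplies like paths of the cycle; the divisibility is read off from the closed longest
  path.\<close>

theorem hochschild_truncated_cycle: "\<exists>co'. truncated_cycle K T s (2 * n) co'"
  and cycle_length_dvd: "s dvd 2 * n - 1"
proof -
  interpret cycle_path_system K T s "2 * n" path
  proof (intro cycle_path_system.intro cycle_path_system_axioms.intro)
    show "(\<Oplus>\<^bsub>T\<^esub>i\<in>{1..s}. path i 0) = \<one>\<^bsub>T\<^esub>" using e_sum by simp
    show "\<exists>c. (\<forall>k. c k \<in> carrier K) \<and> path i 0 \<otimes>\<^bsub>T\<^esub> t = (\<Oplus>\<^bsub>T\<^esub>k\<in>{..<2 * n}. c k \<odot>\<^bsub>T\<^esub> path i k)"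
      if "t \<in> carrier T" "i \<in> {1..s}" for t i
      using e_mult_span[OF that(2,1)] unfolding path_span_def by auto
  qed (use s_pos path_closed path_mult path_vanish path_top T.noncomm_algebra_axioms in auto)
  show "\<exists>co'. truncated_cycle K T s (2 * n) co'" using truncated_cycle_coord by blast
  have 1: "1 \<in> {1..s}" using s_pos by simp
  show "s dvd 2 * n - 1" using path_top[OF 1] cycle_end_self_iff[OF 1] by blast
qed

end

section \<open>Application to the cyclic quiver\<close>

lemma card_arrows_cyclic_quiver:
  assumes "i \<in> {1..s}" "j \<in> {1..s}"
  shows "card {x \<in> arcs (cyclic_quiver s). tail (cyclic_quiver s) x = i \<and> head (cyclic_quiver s) x = j}
    = (if j = cycle_end s i 1 then 1 else 0)"
proof -
  have "{x \<in> arcs (cyclic_quiver s). tail (cyclic_quiver s) x = i \<and> head (cyclic_quiver s) x = j}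
      = (if j = cycle_end s i 1 then {i} else {})"
    using assms cyclic_quiver_sel(4)[OF assms(1)] by (auto simp: cyclic_quiver_sel simp del: atLeastAtMost_iff)
  then show ?thesis by simp
qed

theorem corollary4p5:
  fixes K :: "('k, 'm) ring_scheme" and s n :: nat
    and A :: "('k, (nat \<times> nat list \<Rightarrow> 'k) set) module"
    and \<alpha> :: "(nat \<times> nat list \<Rightarrow> 'k) set \<Rightarrow> (nat \<times> nat list \<Rightarrow> 'k) set \<Rightarrow>
              ((nat \<times> nat list \<Rightarrow> 'k) set \<Rightarrow> 'k)"
    and e :: "nat \<Rightarrow> (nat \<times> nat list \<Rightarrow> 'k) set \<times> ((nat \<times> nat list \<Rightarrow> 'k) set \<Rightarrow> 'k)"
  assumes "field K" and "s \<ge> 1" and "n \<ge> 2"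
    and "A = truncated_path_algebra K (cyclic_quiver s) n"
    and "two_cocycle K A \<alpha>"
    and "complete_primitive_orthogonal_idempotents (hochschild_extension K A \<alpha>) {1..s} e"
    and "\<forall>i\<in>{1..s}. fst (e i) = trivial_path K (cyclic_quiver s) n i"
    and "ordinary_quiver_eq K (hochschild_extension K A \<alpha>) e (cyclic_quiver s)"
  shows "algebra_isomorphic K (hochschild_extension K A \<alpha>)
           (truncated_path_algebra K (cyclic_quiver s) (2 * n))
         \<and> symmetric_algebra K (hochschild_extension K A \<alpha>)"
proof -
  interpret P: cyclic_path_algebra K s
    using assms(1,2) by (intro cyclic_path_algebra.intro cyclic_path_algebra_axioms.intro)
  interpret A: truncated_cycle K A s n P.coset_coord
    unfolding assms(4) by (rule P.truncated_path_algebra_truncated_cycle)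
  interpret H: cycle_hochschild K A s n P.coset_coord \<alpha>
    using A.truncated_cycle_axioms A.noncomm_algebra_axioms assms(3,5)
    by (intro cycle_hochschild.intro hochschild.intro hochschild_axioms.intro cycle_hochschild_axioms.intro)
  interpret Q: cycle_hochschild_quiver K A s n P.coset_coord \<alpha> e
  proof (intro cycle_hochschild_quiver.intro[OF H.cycle_hochschild_axioms] cycle_hochschild_quiver_axioms.intro)
    note idem = assms(6)[unfolded complete_primitive_orthogonal_idempotents_def
        primitive_idempotent_def idempotent_elem_def]
    show "e i \<in> carrier H.T" if "i \<in> {1..s}" for i using idem that by blast
    show "e i \<otimes>\<^bsub>H.T\<^esub> e j = (if i = j then e i else \<zero>\<^bsub>H.T\<^esub>)"
      if "i \<in> {1..s}" "j \<in> {1..s}" for i j using idem that by auto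
    show "(\<Oplus>\<^bsub>H.T\<^esub>i\<in>{1..s}. e i) = \<one>\<^bsub>H.T\<^esub>" using idem by blast
    \<comment> \<open>The trivial path is given as a coset, whereas \<open>A.path_basis\<close>
      comes from the abstract coordinates; the two are identified by comparing coordinates.\<close>
    show "fst (e i) = A.path_basis i 0" if i: "i \<in> {1..s}" for i
    proof (rule A.co_inject)
      show "fst (e i) \<in> carrier A" using assms(7) i P.trivial_path_closed[OF i, of n] assms(4) by simp
      show "P.coset_coord (fst (e i)) j k = P.coset_coord (A.path_basis i 0) j k"
        if "j \<in> {1..s}" "k < n" for j k
        using assms(7) i that P.trivial_path_coord[OF i that] A.co_path_basis[OF that, of i 0] by simp
    qed simp
    show "num_quiver_arrows K H.T (e i) (e j) = (if j = cycle_end s i 1 then 1 else 0)"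
      if "i \<in> {1..s}" "j \<in> {1..s}" for i j
      unfolding card_arrows_cyclic_quiver[OF that, symmetric]
      using assms(8) that unfolding ordinary_quiver_eq_def cyclic_quiver_sel(1) by blast
  qed
  obtain co' where co': "truncated_cycle K H.T s (2 * n) co'"
    using Q.hochschild_truncated_cycle by blast
  have "symmetric_algebra K H.T"
    by (rule truncated_cycle_symmetric[OF co'])
      (use assms(3) Q.cycle_length_dvd in auto)
  then show ?thesis
    using truncated_cycle_isomorphic[OF co' P.truncated_path_algebra_truncated_cycle] by simp
qed

end
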